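(* For each rational number $r$ with $1 \leq r < 2$, the set $\mathcal{S}^{\mathrm{ED}}_{r}$ is $\mathrm{P}^{\mathrm{NP}}_{\|}$-complete under polynomial-time many-one reductions.
   Context: All graphs are undirected, nonempty, finite, without multiple edges or self-loops. A vertex cover of a graph $G$ is a set $C \subseteq V(G)$ with $\{v,w\}\cap C \neq \emptyset$ for every edge $\{v,w\}\in E(G)$; $\mathrm{mvc}(G)$ denotes the minimum size of a vertex cover of $G$. The edge deletion heuristic (ED) on input $G$ starts with $C=\emptyset$ and, as long as an edge remains, nondeterministically chooses an edge $\{u,v\}$ of the current graph, adds $u$ and $v$ to $C$, and deletes $u$, $v$ and all edges incident to them; it outputs $C$. Let $\mathrm{min\text{-}ed}(G)$ be the minimum size of an output of ED on input $G$ over all possible sequences of nondeterministic choices. For a rational $r \geq 1$, $\mathcal{S}^{\mathrm{ED}}_{r} = \{G \mid G \text{ is a graph and } \mathrm{min\text{-}ed}(G) \leq r\cdot \mathrm{mvc}(G)\}$ (graphs encoded as binary strings in a standard way). $\mathrm{P}^{\mathrm{NP}}_{\|}$ is the class of problems decidable in polynomial time with parallel (truth-table) access to an NP oracle. Hardness/completeness is with respect to polynomial-time many-one reducibility: $A \leq^p_m B$ iff there is a polynomial-time computable $f$ with $x\in A \iff f(x)\in B$ for all $x$. *)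

theory Defs
  imports Complex_Main "HOL-Computational_Algebra.Polynomial"
begin

section \<open>Vertex covers and the edge deletion heuristic\<close>

type_synonym 'a graph = "'a set \<times> 'a set set"

definition is_graph :: "'a graph \<Rightarrow> bool" where
  "is_graph G \<longleftrightarrow> (case G of (V, E) \<Rightarrow>
     finite V \<and> V \<noteq> {} \<and> (\<forall>e\<in>E. e \<subseteq> V \<and> card e = 2))"

definition vertex_cover :: "'a graph \<Rightarrow> 'a set \<Rightarrow> bool" where
  "vertex_cover G C \<longleftrightarrow> (case G of (V, E) \<Rightarrow>
     C \<subseteq> V \<and> (\<forall>v w. {v, w} \<in> E \<longrightarrow> {v, w} \<inter> C \<noteq> {}))"

definition mvc :: "'a graph \<Rightarrow> nat" where
  "mvc G = (LEAST k. \<exists>C. vertex_cover G C \<and> card C = k)"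

text \<open>A state of the heuristic consists of the current graph and the set collected so far.
  The current vertex set may become empty during a run.\<close>

inductive ed_step :: "'a graph \<times> 'a set \<Rightarrow> 'a graph \<times> 'a set \<Rightarrow> bool" where
  "{u, v} \<in> E \<Longrightarrow>
   ed_step ((V, E), C) ((V - {u, v}, {e \<in> E. e \<inter> {u, v} = {}}), C \<union> {u, v})"

definition ed_outputs :: "'a graph \<Rightarrow> 'a set set" where
  "ed_outputs G = {C. \<exists>V'. ed_step\<^sup>*\<^sup>* (G, {}) ((V', {}), C)}"

definition min_ed :: "'a graph \<Rightarrow> nat" where
  "min_ed G = (LEAST k. \<exists>C \<in> ed_outputs G. card C = k)"

text \<open>A graph with vertex set \<open>{0..<n}\<close> is encoded by its adjacency matrix, listed row by row;
  the length \<open>n * n\<close> of the code determines \<open>n\<close>.\<close>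

definition encode_graph :: "nat graph \<Rightarrow> bool list" where
  "encode_graph G = (case G of (V, E) \<Rightarrow>
     concat (map (\<lambda>i. map (\<lambda>j. {i, j} \<in> E) [0..<card V]) [0..<card V]))"

definition S_ED :: "rat \<Rightarrow> bool list set" where
  "S_ED r = {encode_graph G | G. is_graph G \<and> fst G = {0..<card (fst G)} \<and>
     of_nat (min_ed G) \<le> r * of_nat (mvc G)}"

section \<open>Deterministic multitape Turing machines\<close>

datatype move = Go_Left | Stay | Go_Right

text \<open>The tape symbols are \<open>0, \<dots>, num_symbols M - 1\<close>, where \<open>0\<close> is the blank and \<open>1\<close>, \<open>2\<close>
  represent the bits \<open>False\<close>, \<open>True\<close>. The states are \<open>0, \<dots>, num_states M\<close>; the
  initial state is \<open>0\<close> and the only halting state is \<open>num_states M\<close>. The transition function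
  maps a state and the list of scanned symbols to the next state and, for each tape, the
  symbol written and the subsequent head movement.\<close>

record tm =
  num_tapes :: nat
  num_symbols :: nat
  num_states :: nat
  delta :: "nat \<Rightarrow> nat list \<Rightarrow> nat \<times> (nat \<times> move) list"

text \<open>Tape 0 is the input tape and tape 1 the output tape, hence the lower bound 2.\<close>

definition wf_tm :: "tm \<Rightarrow> bool" where
  "wf_tm M \<longleftrightarrow> 2 \<le> num_tapes M \<and> 3 \<le> num_symbols M \<and>
     (\<forall>q ss. q < num_states M \<longrightarrow> length ss = num_tapes M \<longrightarrow> set ss \<subseteq> {..<num_symbols M} \<longrightarrow>
        (case delta M q ss of (q', as) \<Rightarrow>
           q' \<le> num_states M \<and> length as = num_tapes M \<and> fst ` set as \<subseteq> {..<num_symbols M}))"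

text \<open>Tapes are infinite in both directions: cell contents and head position.\<close>

type_synonym tape = "(int \<Rightarrow> nat) \<times> int"
type_synonym config = "nat \<times> tape list"

definition read_tape :: "tape \<Rightarrow> nat" where
  "read_tape t = fst t (snd t)"

fun move_head :: "move \<Rightarrow> int \<Rightarrow> int" where
  "move_head Go_Left p = p - 1"
| "move_head Stay p = p"
| "move_head Go_Right p = p + 1"

definition act_tape :: "nat \<times> move \<Rightarrow> tape \<Rightarrow> tape" where
  "act_tape a t = ((fst t)(snd t := fst a), move_head (snd a) (snd t))"

definition tm_step :: "tm \<Rightarrow> config \<Rightarrow> config" where
  "tm_step M c = (case c of (q, ts) \<Rightarrow>
     if q < num_states M
     then (case delta M q (map read_tape ts) of (q', as) \<Rightarrow> (q', map2 act_tape as ts))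
     else (q, ts))"

definition tape_content :: "bool list \<Rightarrow> int \<Rightarrow> nat" where
  "tape_content x i =
     (if 0 \<le> i \<and> i < int (length x) then (if x ! nat i then 2 else 1) else 0)"

definition init_config :: "tm \<Rightarrow> bool list \<Rightarrow> config" where
  "init_config M x = (0, (tape_content x, 0) # replicate (num_tapes M - 1) (tape_content [], 0))"

text \<open>Halting configurations are fixed points of the step function, so the following says that
  \<open>M\<close> on input \<open>x\<close> halts after at most \<open>t\<close> steps with output \<open>y\<close>.\<close>

definition computes_within :: "tm \<Rightarrow> bool list \<Rightarrow> bool list \<Rightarrow> nat \<Rightarrow> bool" where
  "computes_within M x y t \<longleftrightarrow> (case (tm_step M ^^ t) (init_config M x) of (q, ts) \<Rightarrow>
     q = num_states M \<and> fst (ts ! 1) = tape_content y)"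

definition polytime_computable :: "(bool list \<Rightarrow> bool list) \<Rightarrow> bool" where
  "polytime_computable f \<longleftrightarrow>
     (\<exists>M (p :: nat poly). wf_tm M \<and> (\<forall>x. computes_within M x (f x) (poly p (length x))))"

section \<open>Complexity classes and reductions\<close>

definition class_P :: "bool list set set" where
  "class_P = {L. polytime_computable (\<lambda>x. [x \<in> L])}"

text \<open>Self-delimiting code of a string (bits doubled, end marked by \<open>01\<close>), used for encoding
  pairs and lists of strings as strings.\<close>

definition encode_string :: "bool list \<Rightarrow> bool list" where
  "encode_string x = concat (map (\<lambda>b. [b, b]) x) @ [False, True]"

definition encode_pair :: "bool list \<Rightarrow> bool list \<Rightarrow> bool list" where
  "encode_pair x y = encode_string x @ y"

definition encode_list :: "bool list list \<Rightarrow> bool list" where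
  "encode_list xs = concat (map encode_string xs)"

definition class_NP :: "bool list set set" where
  "class_NP = {L. \<exists>R \<in> class_P. \<exists>p :: nat poly. \<forall>x.
     x \<in> L \<longleftrightarrow> (\<exists>y. length y \<le> poly p (length x) \<and> encode_pair x y \<in> R)}"

text \<open>Polynomial-time truth-table reducibility: all queries \<open>Q x\<close> are computed from \<open>x\<close> before
  any answer is available; the decision is then made in polynomial time from \<open>x\<close> and the list of
  answers.\<close>

definition tt_reducible :: "bool list set \<Rightarrow> bool list set \<Rightarrow> bool"  (infix \<open>\<le>\<^sub>t\<^sub>t\<close> 50) where
  "A \<le>\<^sub>t\<^sub>t B \<longleftrightarrow> (\<exists>Q. polytime_computable (\<lambda>x. encode_list (Q x)) \<and>
     (\<exists>D \<in> class_P. \<forall>x. x \<in> A \<longleftrightarrow> encode_pair x (map (\<lambda>q. q \<in> B) (Q x)) \<in> D))"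

definition class_P_NP_par :: "bool list set set" where
  "class_P_NP_par = {A. \<exists>B \<in> class_NP. A \<le>\<^sub>t\<^sub>t B}"

definition many_one_reducible :: "bool list set \<Rightarrow> bool list set \<Rightarrow> bool"  (infix \<open>\<le>\<^sub>m\<close> 50) where
  "A \<le>\<^sub>m B \<longleftrightarrow> (\<exists>f. polytime_computable f \<and> (\<forall>x. x \<in> A \<longleftrightarrow> f x \<in> B))"

definition complete_for :: "bool list set set \<Rightarrow> bool list set \<Rightarrow> bool" where
  "complete_for \<C> L \<longleftrightarrow> L \<in> \<C> \<and> (\<forall>A \<in> \<C>. A \<le>\<^sub>m L)"

end

theory Submission
  imports Defs "HOL-Library.Nat_Bijection"
begin

text \<open>Hardness. Suppose \<open>x \<in> A\<close> is decided from the answers of an NP set to a list of queries. Among all vectors of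
  answers in which every yes is certified, the correct one has the most yes entries, so \<open>x \<in> A\<close> iff the maximum of
  (number of yes entries, plus one if the decider accepts) exceeds the maximum number of yes entries. Both maxima are,
  up to a known constant, halves of independence numbers of graphs whose independent sets describe the computations
  of a circuit that runs all machines involved: every gate contributes its possible local assignments, in so many
  copies that violating a gate never pays, and vertices that reward a gate for showing the desired output.
  Combining the two graphs gives one graph \<open>K\<close> in which a minimum vertex cover has a perfect matching if \<open>x \<in> A\<close>,
  and in which, for parity reasons, the cheapest cover with a perfect matching costs exactly one more if \<open>x \<notin> A\<close>.
  Since the outputs of ED are the vertex covers with a perfect matching, this settles \<open>r = 1\<close>. For \<open>r = p / q\<close> take
  disjoint copies of \<open>K\<close>, isolated edges, and copies of \<open>K\<close> where each vertex is the end of a new path on four vertices: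
  in these, the minimum cover has a fixed size while the best ED output grows with that of \<open>K\<close>.

  Membership. Ask in parallel, for all \<open>j\<close>, whether a cover of size at most \<open>j\<close> and an ED output of size at most
  \<open>r * j\<close> exist; the ratio is at most \<open>r\<close> iff a yes to the former always comes with a yes to the latter.\<close>

subsection \<open>Register programs on Turing machines\<close>

text \<open>The reduction knows neither the answers of the NP set nor the size \<open>s\<close> of a
  cheapest matched cover of the combined graph, so its construction must work for every value of
  \<open>s\<close>. Parity is the lever: a set with a perfect matching has even size. Rewards count
  twice, so the two independence numbers are even and either equal or two apart, and one extra
  independent vertex is added to the second graph. If \<open>x \<in> A\<close>, the largest
  independent set lies in the first graph and its complement is even; otherwise the odd one wins and
  the minimum cover has size \<open>s - 1\<close>, too odd to be matched.

  Turing machines are concrete here, so running times have to be proved on machines. A compiler for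
  arithmetic expressions with bounded sums does this once; every later function is given by its
  length and a formula for the bit at a given position. This is why gates and vertices are numbers
  whose digits are addresses, and why the circuit has gates for every conceivable place of a query
  instead of the actual ones.\<close>

datatype test = NZ nat | Nonblank | Is_one

text \<open>\<open>Mark\<close> runs once, at the start, and puts the marks on the register tapes.
  \<open>JumpF\<close> jumps when its test fails, which is the form that loops and conditionals
  need.\<close>

datatype instr = Mark | Inc nat | Dec nat | InR | InL | Emit bool | JumpF test nat | Jump nat

definition mark_tape :: "int \<Rightarrow> nat" where
  "mark_tape i = (if i = 0 then 1 else 0)"

type_synonym mstate = "nat \<times> bool list \<times> (nat \<Rightarrow> nat)"

text \<open>A register of value \<open>v\<close> is a tape with a mark on cell 0, blank elsewhere, whose head is at cell \<open>v\<close>.\<close>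

fun tapes :: "bool list \<Rightarrow> nat \<Rightarrow> mstate \<Rightarrow> tape list" where
  "tapes x K (h, w, \<rho>) = (tape_content x, int h) # (tape_content w, int (length w)) #
     map (\<lambda>j. (mark_tape, int (\<rho> j))) [0..<K]"

definition idle :: "nat list \<Rightarrow> (nat \<times> move) list" where
  "idle ss = map (\<lambda>s. (s, Stay)) ss"

fun test_on :: "test \<Rightarrow> nat list \<Rightarrow> bool" where
  "test_on (NZ r) ss = (ss ! (r + 2) \<noteq> 1)"
| "test_on Nonblank ss = (ss ! 0 \<noteq> 0)"
| "test_on Is_one ss = (ss ! 0 = 2)"

fun instr_delta :: "instr \<Rightarrow> nat \<Rightarrow> nat list \<Rightarrow> nat \<times> (nat \<times> move) list" where
  "instr_delta Mark q ss = (q + 1, take 2 (idle ss) @ map (\<lambda>s. (1, Stay)) (drop 2 ss))"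
| "instr_delta (Inc r) q ss = (q + 1, (idle ss)[r + 2 := (ss ! (r + 2), Go_Right)])"
| "instr_delta (Dec r) q ss =
     (q + 1, (idle ss)[r + 2 := (ss ! (r + 2), if ss ! (r + 2) = 1 then Stay else Go_Left)])"
| "instr_delta InR q ss = (q + 1, (idle ss)[0 := (ss ! 0, Go_Right)])"
| "instr_delta InL q ss = (q + 1, (idle ss)[0 := (ss ! 0, Go_Left)])"
| "instr_delta (Emit b) q ss = (q + 1, (idle ss)[1 := (if b then 2 else 1, Go_Right)])"
| "instr_delta (JumpF b t) q ss = (if test_on b ss then q + 1 else t, idle ss)"
| "instr_delta (Jump t) q ss = (t, idle ss)"

fun target_ok :: "nat \<Rightarrow> instr \<Rightarrow> bool" where
  "target_ok n (JumpF b t) = (t \<le> n)"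
| "target_ok n (Jump t) = (t \<le> n)"
| "target_ok n _ = True"

definition machine :: "nat \<Rightarrow> instr list \<Rightarrow> tm" where
  "machine K C = \<lparr>num_tapes = K + 2, num_symbols = 3, num_states = length C,
     delta = \<lambda>q ss. instr_delta (C ! q) q ss\<rparr>"

lemma idle_update_symbols:
  assumes "set ss \<subseteq> {..<3}" "r < length ss \<Longrightarrow> c < 3"
  shows "fst ` set ((idle ss)[r := (c, m)]) \<subseteq> {..<3}"
proof (cases "r < length ss")
  case True
  have "fst ` set ((idle ss)[r := (c, m)]) \<subseteq> insert c (fst ` set (idle ss))"
    using set_update_subset_insert[of "idle ss" r "(c, m)"] by force
  also have "fst ` set (idle ss) = set ss"
    by (force simp: idle_def)
  finally show ?thesis
    using assms True by auto
next
  case False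
  then have "(idle ss)[r := (c, m)] = idle ss"
    by (intro list_update_beyond) (simp add: idle_def)
  then show ?thesis
    using assms by (auto simp: idle_def)
qed

lemma wf_machine:
  assumes "\<forall>i \<in> set C. target_ok (length C) i"
  shows "wf_tm (machine K C)"
proof -
  have "case instr_delta (C ! q) q ss of (q', as) \<Rightarrow>
          q' \<le> length C \<and> length as = K + 2 \<and> fst ` set as \<subseteq> {..<3}"
    if "q < length C" "length ss = K + 2" "set ss \<subseteq> {..<3}" for q ss
  proof -
    have ok: "target_ok (length C) (C ! q)"
      using assms that by auto
    have nth3: "r < length ss \<Longrightarrow> ss ! r < 3" for r
      using that(3) nth_mem by (metis lessThan_iff subsetD)
    have upd: "fst ` set ((idle ss)[r := (c, m)]) \<subseteq> {..<3}" if "r < length ss \<Longrightarrow> c < 3" for r c m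
      using idle_update_symbols \<open>set ss \<subseteq> {..<3}\<close> that by blast
    have i: "fst ` set (idle ss) \<subseteq> {..<3}"
      using that(3) by (auto simp: idle_def)
    have t: "fst ` set (take 2 (idle ss)) \<subseteq> {..<3}"
      using i set_take_subset by fastforce
    show ?thesis
      using that ok upd nth3 i t
      by (cases "C ! q") (auto simp: idle_def image_Un simp del: set_update_subset_insert)
  qed
  then show ?thesis
    unfolding wf_tm_def machine_def by simp
qed

lemma map2_idle_update:
  assumes "i < length ts"
  shows "map2 act_tape ((idle (map read_tape ts))[i := a]) ts = ts[i := act_tape a (ts ! i)]"
  using assms
  by (intro nth_equalityI) (auto simp: idle_def nth_list_update act_tape_def read_tape_def)

lemma map2_idle: "map2 act_tape (idle (map read_tape ts)) ts = ts"
  by (intro nth_equalityI) (auto simp: idle_def act_tape_def read_tape_def)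

lemma length_tapes [simp]: "length (tapes x K \<sigma>) = K + 2"
  by (cases \<sigma>) simp

lemma tapes_update_reg:
  "r < K \<Longrightarrow> (tapes x K (h, w, \<rho>))[Suc (Suc r) := (mark_tape, int k)] = tapes x K (h, w, \<rho>(r := k))"
  by (auto intro!: nth_equalityI simp: nth_list_update)

lemma tape_content_snoc:
  "(tape_content w)(int (length w) := (if b then 2 else 1)) = tape_content (w @ [b])"
  by (rule ext) (auto simp: tape_content_def nth_append nat_less_iff)

fun eff :: "instr \<Rightarrow> mstate \<Rightarrow> mstate" where
  "eff (Inc r) (h, w, \<rho>) = (h, w, \<rho>(r := \<rho> r + 1))"
| "eff (Dec r) (h, w, \<rho>) = (h, w, \<rho>(r := \<rho> r - 1))"
| "eff InR (h, w, \<rho>) = (h + 1, w, \<rho>)"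
| "eff InL (h, w, \<rho>) = (h - 1, w, \<rho>)"
| "eff (Emit b) (h, w, \<rho>) = (h, w @ [b], \<rho>)"
| "eff _ \<sigma> = \<sigma>"

text \<open>Straight-line instructions only; \<open>Mark\<close> and the jumps are treated
  separately. \<open>InL\<close> asks for \<open>0 < h\<close> because the position of the input
  head is a natural number here, although the tape goes on to the left.\<close>

fun applicable :: "nat \<Rightarrow> instr \<Rightarrow> mstate \<Rightarrow> bool" where
  "applicable K (Inc r) \<sigma> = (r < K)"
| "applicable K (Dec r) \<sigma> = (r < K)"
| "applicable K InL (h, w, \<rho>) = (0 < h)"
| "applicable K InR \<sigma> = True"
| "applicable K (Emit b) \<sigma> = True"
| "applicable K _ \<sigma> = False"

fun holds :: "bool list \<Rightarrow> test \<Rightarrow> mstate \<Rightarrow> bool" where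
  "holds x (NZ r) (h, w, \<rho>) = (\<rho> r \<noteq> 0)"
| "holds x Nonblank (h, w, \<rho>) = (h < length x)"
| "holds x Is_one (h, w, \<rho>) = (h < length x \<and> x ! h)"

fun testable :: "nat \<Rightarrow> test \<Rightarrow> bool" where
  "testable K (NZ r) = (r < K)"
| "testable K _ = True"

lemma tm_step_instr:
  assumes "a < length C" "applicable K (C ! a) \<sigma>"
  shows "tm_step (machine K C) (a, tapes x K \<sigma>) = (a + 1, tapes x K (eff (C ! a) \<sigma>))"
proof -
  obtain h w \<rho> where \<sigma>: "\<sigma> = (h, w, \<rho>)" by (cases \<sigma>)
  let ?ts = "tapes x K \<sigma>"
  have nth: "r < K \<Longrightarrow> ?ts ! Suc (Suc r) = (mark_tape, int (\<rho> r))" for r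
    by (simp add: \<sigma>)
  have rd: "r < K \<Longrightarrow> map read_tape ?ts ! Suc (Suc r) = mark_tape (int (\<rho> r))" for r
    using nth[of r] by (subst nth_map) (auto simp: read_tape_def)
  show ?thesis
  proof (cases "C ! a")
    case (Inc r)
    then have r: "r < K" using assms by simp
    show ?thesis
      using assms r Inc tapes_update_reg[OF r, of x h w \<rho> "\<rho> r + 1"]
      by (simp add: tm_step_def machine_def map2_idle_update nth rd act_tape_def read_tape_def \<sigma>[symmetric] del: tapes.simps)
         (simp add: \<sigma> add.commute)
  next
    case (Dec r)
    then have r: "r < K" using assms by simp
    have "act_tape (read_tape (mark_tape, int (\<rho> r)), if read_tape (mark_tape, int (\<rho> r)) = 1 then Stay else Go_Left)
            (mark_tape, int (\<rho> r)) = (mark_tape, int (\<rho> r - 1))"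
      by (auto simp: act_tape_def mark_tape_def read_tape_def)
    then show ?thesis
      using assms r Dec tapes_update_reg[OF r, of x h w \<rho> "\<rho> r - 1"]
      by (simp add: tm_step_def machine_def map2_idle_update nth \<sigma>[symmetric] del: tapes.simps)
         (simp add: \<sigma> split: if_splits)
  next
    case InR
    then show ?thesis
      using assms by (simp add: tm_step_def machine_def map2_idle_update del: tapes.simps)
        (simp add: \<sigma> act_tape_def read_tape_def add.commute)
  next
    case InL
    then show ?thesis
      using assms by (simp add: tm_step_def machine_def map2_idle_update del: tapes.simps)
        (simp add: \<sigma> act_tape_def read_tape_def of_nat_diff)
  next
    case (Emit b)
    then show ?thesis
      using assms tape_content_snoc[of w b]
      by (simp add: tm_step_def machine_def map2_idle_update del: tapes.simps)
        (cases b; simp add: \<sigma> act_tape_def read_tape_def add.commute)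
  qed (use assms in auto)
qed

lemma test_on_tapes:
  assumes "testable K b"
  shows "test_on b (map read_tape (tapes x K \<sigma>)) = holds x b \<sigma>"
  using assms
  by (cases \<sigma>; cases b) (auto simp: read_tape_def mark_tape_def tape_content_def)

lemma tm_step_jumpF:
  assumes "a < length C" "C ! a = JumpF b t" "testable K b"
  shows "tm_step (machine K C) (a, tapes x K \<sigma>) = (if holds x b \<sigma> then a + 1 else t, tapes x K \<sigma>)"
  using assms by (simp add: tm_step_def machine_def map2_idle test_on_tapes)

lemma tm_step_jump:
  assumes "a < length C" "C ! a = Jump t"
  shows "tm_step (machine K C) (a, tapes x K \<sigma>) = (t, tapes x K \<sigma>)"
  using assms by (simp add: tm_step_def machine_def map2_idle)

section \<open>Structured programs with time bounds\<close>

datatype prog = Skip | Ins instr | Seq prog prog (infixr \<open>;;\<close> 60) | While test prog | If test prog prog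

fun len :: "prog \<Rightarrow> nat" where
  "len Skip = 0"
| "len (Ins i) = 1"
| "len (p ;; q) = len p + len q"
| "len (While b p) = len p + 2"
| "len (If b p q) = len p + len q + 2"

fun assemble :: "nat \<Rightarrow> prog \<Rightarrow> instr list" where
  "assemble a Skip = []"
| "assemble a (Ins i) = [i]"
| "assemble a (p ;; q) = assemble a p @ assemble (a + len p) q"
| "assemble a (While b p) = JumpF b (a + len p + 2) # assemble (a + 1) p @ [Jump a]"
| "assemble a (If b p q) = JumpF b (a + len p + 2) # assemble (a + 1) p @
     Jump (a + len p + 2 + len q) # assemble (a + len p + 2) q"

lemma length_assemble [simp]: "length (assemble a p) = len p"
  by (induction p arbitrary: a) auto

text \<open>Targets are absolute and \<open>assemble\<close> does not relocate those inside
  \<open>Ins\<close>, so such an instruction has to be legal in a program of any length.\<close>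

fun jump_free :: "prog \<Rightarrow> bool" where
  "jump_free Skip = True"
| "jump_free (Ins i) = (\<forall>n. target_ok n i)"
| "jump_free (p ;; q) = (jump_free p \<and> jump_free q)"
| "jump_free (While b p) = jump_free p"
| "jump_free (If b p q) = (jump_free p \<and> jump_free q)"

lemma target_ok_mono: "target_ok n i \<Longrightarrow> n \<le> m \<Longrightarrow> target_ok m i"
  by (cases i) auto

lemma target_ok_assemble: "jump_free p \<Longrightarrow> i \<in> set (assemble a p) \<Longrightarrow> target_ok (a + len p) i"
proof (induction p arbitrary: a)
  case (Seq p q)
  then show ?case
    using target_ok_mono[of "a + len p" i "a + len p + len q"] by (fastforce simp: add.assoc)
next
  case (While b p)
  then show ?case
    using target_ok_mono[of "a + 1 + len p" i "a + len p + 2"] by (fastforce simp: add.assoc)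
next
  case (If b p q)
  then show ?case
    using target_ok_mono[of "a + 1 + len p" i "a + len p + len q + 2"]
      target_ok_mono[of "a + len p + 2 + len q" i "a + len p + len q + 2"]
    by (fastforce simp: add.assoc)
qed auto

definition code_at :: "instr list \<Rightarrow> nat \<Rightarrow> instr list \<Rightarrow> bool" where
  "code_at C a c \<longleftrightarrow> (\<exists>pre post. C = pre @ c @ post \<and> length pre = a)"

lemma code_at_append: "code_at C a (c @ d) \<longleftrightarrow> code_at C a c \<and> code_at C (a + length c) d"
proof
  assume "code_at C a (c @ d)"
  then obtain pre post where "C = pre @ c @ d @ post" "length pre = a"
    by (auto simp: code_at_def)
  then have "C = pre @ c @ (d @ post)" "C = (pre @ c) @ d @ post" "length (pre @ c) = a + length c"
    by auto
  then show "code_at C a c \<and> code_at C (a + length c) d"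
    using \<open>length pre = a\<close> unfolding code_at_def by blast
next
  assume *: "code_at C a c \<and> code_at C (a + length c) d"
  then obtain pre post where 1: "C = pre @ c @ post" "length pre = a"
    unfolding code_at_def by blast
  obtain pre' post' where 2: "C = pre' @ d @ post'" "length pre' = a + length c"
    using * unfolding code_at_def by blast
  from 1 2 have "(pre @ c) @ post = pre' @ (d @ post')" "length (pre @ c) = length pre'"
    by auto
  then have "post = d @ post'"
    using append_eq_append_conv by blast
  then show "code_at C a (c @ d)"
    using 1 unfolding code_at_def by auto
qed

lemma code_at_Cons: "code_at C a (i # c) \<longleftrightarrow> a < length C \<and> C ! a = i \<and> code_at C (a + 1) c"
proof -
  have "code_at C a [i] \<longleftrightarrow> a < length C \<and> C ! a = i"
  proof
    assume "a < length C \<and> C ! a = i"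
    then have "C = take a C @ [i] @ drop (Suc a) C" "length (take a C) = a"
      using id_take_nth_drop by auto
    then show "code_at C a [i]" unfolding code_at_def by blast
  qed (auto simp: code_at_def nth_append)
  then show ?thesis
    using code_at_append[of C a "[i]" c] by simp
qed

text \<open>A timed Hoare triple for relocatable code: it holds wherever the block lies in a
  program, ends at the first address behind the block, and speaks of a single start state.\<close>

definition does :: "bool list \<Rightarrow> nat \<Rightarrow> prog \<Rightarrow> mstate \<Rightarrow> nat \<Rightarrow> mstate \<Rightarrow> bool" where
  "does x K p \<sigma> B \<sigma>' \<longleftrightarrow> (\<exists>t \<le> B. \<forall>C a. code_at C a (assemble a p) \<longrightarrow>
     (tm_step (machine K C) ^^ t) (a, tapes x K \<sigma>) = (a + len p, tapes x K \<sigma>'))"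

lemma funpow_one: "(f ^^ 1) = (f :: 'a \<Rightarrow> 'a)"
  by simp

lemma does_mono: "does x K p \<sigma> B \<sigma>' \<Longrightarrow> B \<le> B' \<Longrightarrow> does x K p \<sigma> B' \<sigma>'"
  unfolding does_def using le_trans by blast

lemma does_Skip: "does x K Skip \<sigma> 0 \<sigma>"
  by (auto simp: does_def)

lemma does_Ins: "applicable K i \<sigma> \<Longrightarrow> eff i \<sigma> = \<sigma>' \<Longrightarrow> does x K (Ins i) \<sigma> 1 \<sigma>'"
  unfolding does_def by (intro exI[of _ 1]) (auto simp: code_at_Cons tm_step_instr)

lemma does_Seq:
  assumes "does x K p \<sigma> B \<sigma>'" "does x K q \<sigma>' B' \<sigma>''"
  shows "does x K (p ;; q) \<sigma> (B + B') \<sigma>''"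
proof -
  obtain t u where t: "t \<le> B" "\<And>C a. code_at C a (assemble a p) \<Longrightarrow>
      (tm_step (machine K C) ^^ t) (a, tapes x K \<sigma>) = (a + len p, tapes x K \<sigma>')"
    and u: "u \<le> B'" "\<And>C a. code_at C a (assemble a q) \<Longrightarrow>
      (tm_step (machine K C) ^^ u) (a, tapes x K \<sigma>') = (a + len q, tapes x K \<sigma>'')"
    using assms unfolding does_def by blast
  have "(tm_step (machine K C) ^^ (u + t)) (a, tapes x K \<sigma>) = (a + len (p ;; q), tapes x K \<sigma>'')"
    if "code_at C a (assemble a (p ;; q))" for C a
    using that t(2)[of C a] u(2)[of C "a + len p"] by (simp add: code_at_append funpow_add add.assoc)
  then show ?thesis
    unfolding does_def using t(1) u(1) by (intro exI[of _ "u + t"]) auto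
qed

lemma does_If_True:
  assumes "testable K b" "holds x b \<sigma>" "does x K p \<sigma> B \<sigma>'"
  shows "does x K (If b p q) \<sigma> (B + 2) \<sigma>'"
proof -
  obtain t where t: "t \<le> B" "\<And>C a. code_at C a (assemble a p) \<Longrightarrow>
      (tm_step (machine K C) ^^ t) (a, tapes x K \<sigma>) = (a + len p, tapes x K \<sigma>')"
    using assms(3) unfolding does_def by blast
  have "(tm_step (machine K C) ^^ (1 + t + 1)) (a, tapes x K \<sigma>) = (a + len (If b p q), tapes x K \<sigma>')"
    if "code_at C a (assemble a (If b p q))" for C a
  proof -
    have c: "a < length C" "C ! a = JumpF b (a + len p + 2)" "code_at C (a + 1) (assemble (a + 1) p)"
      "a + 1 + len p < length C" "C ! (a + 1 + len p) = Jump (a + len p + 2 + len q)"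
      using that by (auto simp: code_at_append code_at_Cons)
    show ?thesis
      unfolding funpow_add comp_apply funpow_one tm_step_jumpF[OF c(1,2) assms(1)]
      using assms(2) t(2)[OF c(3)] tm_step_jump[OF c(4,5)] by simp
  qed
  then show ?thesis
    unfolding does_def using t(1) by (intro exI[of _ "1 + t + 1"]) auto
qed

lemma does_If_False:
  assumes "testable K b" "\<not> holds x b \<sigma>" "does x K q \<sigma> B \<sigma>'"
  shows "does x K (If b p q) \<sigma> (B + 2) \<sigma>'"
proof -
  obtain t where t: "t \<le> B" "\<And>C a. code_at C a (assemble a q) \<Longrightarrow>
      (tm_step (machine K C) ^^ t) (a, tapes x K \<sigma>) = (a + len q, tapes x K \<sigma>')"
    using assms(3) unfolding does_def by blast
  have "(tm_step (machine K C) ^^ (t + 1)) (a, tapes x K \<sigma>) = (a + len (If b p q), tapes x K \<sigma>')"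
    if "code_at C a (assemble a (If b p q))" for C a
  proof -
    have c: "a < length C" "C ! a = JumpF b (a + len p + 2)"
      "code_at C (a + len p + 2) (assemble (a + len p + 2) q)"
      using that by (auto simp: code_at_append code_at_Cons)
    show ?thesis
      unfolding funpow_add comp_apply funpow_one tm_step_jumpF[OF c(1,2) assms(1)]
      using assms(2) t(2)[OF c(3)] by simp
  qed
  then show ?thesis
    unfolding does_def using t(1) by (intro exI[of _ "t + 1"]) auto
qed

lemma does_While_False:
  assumes "testable K b" "\<not> holds x b \<sigma>"
  shows "does x K (While b p) \<sigma> 1 \<sigma>"
  unfolding does_def using assms
  by (intro exI[of _ 1]) (auto simp: code_at_Cons code_at_append tm_step_jumpF)

lemma does_While_True:
  assumes "testable K b" "holds x b \<sigma>" "does x K p \<sigma> B \<sigma>'" "does x K (While b p) \<sigma>' B' \<sigma>''"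
  shows "does x K (While b p) \<sigma> (B + 2 + B') \<sigma>''"
proof -
  obtain t u where t: "t \<le> B" "\<And>C a. code_at C a (assemble a p) \<Longrightarrow>
      (tm_step (machine K C) ^^ t) (a, tapes x K \<sigma>) = (a + len p, tapes x K \<sigma>')"
    and u: "u \<le> B'" "\<And>C a. code_at C a (assemble a (While b p)) \<Longrightarrow>
      (tm_step (machine K C) ^^ u) (a, tapes x K \<sigma>') = (a + len (While b p), tapes x K \<sigma>'')"
    using assms(3,4) unfolding does_def by blast
  have "(tm_step (machine K C) ^^ (u + 1 + t + 1)) (a, tapes x K \<sigma>) = (a + len (While b p), tapes x K \<sigma>'')"
    if "code_at C a (assemble a (While b p))" for C a
  proof -
    have c: "a < length C" "C ! a = JumpF b (a + len p + 2)" "code_at C (a + 1) (assemble (a + 1) p)"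
      "a + 1 + len p < length C" "C ! (a + 1 + len p) = Jump a"
      using that by (auto simp: code_at_append code_at_Cons)
    show ?thesis
      unfolding funpow_add comp_apply funpow_one tm_step_jumpF[OF c(1,2) assms(1)]
      using assms(2) t(2)[OF c(3)] tm_step_jump[OF c(4,5)] u(2)[OF that] by simp
  qed
  then show ?thesis
    unfolding does_def using t(1) u(1) by (intro exI[of _ "u + 1 + t + 1"]) auto
qed

text \<open>The listed states \<open>st 0\<close>, ..., \<open>st m\<close> at the loop head take
  the place of an invariant and a termination measure, as all loops here have a known number of
  rounds. A round pays 2 for the test and the jump back, the failing test pays 1.\<close>

lemma does_While:
  assumes "testable K b" "\<And>i. i < m \<Longrightarrow> holds x b (st i)" "\<not> holds x b (st m)"
    "\<And>i. i < m \<Longrightarrow> does x K p (st i) B (st (Suc i))"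
  shows "does x K (While b p) (st 0) (m * (B + 2) + 1) (st m)"
  using assms
proof (induction m arbitrary: st)
  case 0
  then show ?case using does_While_False by simp
next
  case (Suc m)
  have "does x K (While b p) (st (Suc 0)) (m * (B + 2) + 1) (st (Suc m))"
    by (rule Suc.IH[of "\<lambda>i. st (Suc i)"]) (use Suc.prems in auto)
  then have "does x K (While b p) (st 0) (B + 2 + (m * (B + 2) + 1)) (st (Suc m))"
    by (rule does_While_True[rotated 3]) (use Suc.prems in auto)
  then show ?case by (simp add: algebra_simps)
qed

section \<open>Arithmetic expressions with bounded sums and their compilation\<close>

datatype ex = Hd | Wk ex | One | Plus ex ex | Times ex ex | Minus ex ex | LetE ex ex | SumE ex ex |
  Bit ex | Len

definition hd0 :: "nat list \<Rightarrow> nat" where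
  "hd0 vs = (case vs of [] \<Rightarrow> 0 | v # _ \<Rightarrow> v)"

lemma hd0_simps [simp]: "hd0 [] = 0" "hd0 (v # vs) = v"
  by (auto simp: hd0_def)

definition bit_at :: "bool list \<Rightarrow> nat \<Rightarrow> nat" where
  "bit_at x i = of_bool (i < length x \<and> x ! i)"

text \<open>Variables are de Bruijn indices: \<open>Hd\<close> is the innermost one and
  \<open>Wk\<close> skips it. The bounded sum is the only iteration, which keeps values and running
  times polynomial.\<close>

fun ev :: "ex \<Rightarrow> bool list \<Rightarrow> nat list \<Rightarrow> nat" where
  "ev Hd x vs = hd0 vs"
| "ev (Wk e) x vs = ev e x (tl vs)"
| "ev One x vs = 1"
| "ev (Plus a b) x vs = ev a x vs + ev b x vs"
| "ev (Times a b) x vs = ev a x vs * ev b x vs"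
| "ev (Minus a b) x vs = ev a x vs - ev b x vs"
| "ev (LetE a b) x vs = ev b x (ev a x vs # vs)"
| "ev (SumE a b) x vs = (\<Sum>i<ev a x vs. ev b x (i # vs))"
| "ev (Bit a) x vs = bit_at x (ev a x vs)"
| "ev Len x vs = length x"

abbreviation clear :: "nat \<Rightarrow> prog" where
  "clear r \<equiv> While (NZ r) (Ins (Dec r))"

text \<open>\<open>code e R z s\<close> adds the value of \<open>e\<close> to register \<open>z\<close>; the variables are held in the registers \<open>R\<close>, and
  the registers from \<open>s\<close> on are scratch space, zero before and after.\<close>

fun code :: "ex \<Rightarrow> nat list \<Rightarrow> nat \<Rightarrow> nat \<Rightarrow> prog" where
  "code Hd [] z s = Skip"
| "code Hd (r # R) z s = While (NZ r) (Ins (Dec r) ;; Ins (Inc z) ;; Ins (Inc s)) ;;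
     While (NZ s) (Ins (Dec s) ;; Ins (Inc r))"
| "code (Wk e) R z s = code e (tl R) z s"
| "code One R z s = Ins (Inc z)"
| "code (Plus a b) R z s = code a R z s ;; code b R z s"
| "code (Times a b) R z s = code a R s (s + 1) ;;
     While (NZ s) (Ins (Dec s) ;; code b R z (s + 1))"
| "code (Minus a b) R z s = code a R s (s + 1) ;; code b R (s + 1) (s + 2) ;;
     While (NZ (s + 1)) (Ins (Dec (s + 1)) ;; Ins (Dec s)) ;; While (NZ s) (Ins (Dec s) ;; Ins (Inc z))"
| "code (LetE a b) R z s = code a R s (s + 1) ;; code b (s # R) z (s + 1) ;; clear s"
| "code (SumE a b) R z s = code a R s (s + 2) ;;
     While (NZ s) (Ins (Dec s) ;; code b ((s + 1) # R) z (s + 2) ;; Ins (Inc (s + 1))) ;; clear (s + 1)"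
| "code (Bit a) R z s = code a R s (s + 2) ;;
     While (NZ s) (Ins (Dec s) ;; Ins InR ;; Ins (Inc (s + 1))) ;; If Is_one (Ins (Inc z)) Skip ;;
     While (NZ (s + 1)) (Ins (Dec (s + 1)) ;; Ins InL)"
| "code Len R z s = While Nonblank (Ins InR ;; Ins (Inc s) ;; Ins (Inc z)) ;;
     While (NZ s) (Ins (Dec s) ;; Ins InL)"

fun width :: "ex \<Rightarrow> nat" where
  "width Hd = 1"
| "width (Wk e) = width e"
| "width One = 0"
| "width (Plus a b) = max (width a) (width b)"
| "width (Times a b) = 1 + max (width a) (width b)"
| "width (Minus a b) = 2 + max (width a) (width b)"
| "width (LetE a b) = 1 + max (width a) (width b)"
| "width (SumE a b) = 2 + max (width a) (width b)"
| "width (Bit a) = 2 + width a"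
| "width Len = 1"

text \<open>Each equation repeats the shape of the time bound that the rules for \<open>does\<close>
  yield for the compiled code, so that the correctness proof needs no arithmetic on running
  times.\<close>

fun cost :: "ex \<Rightarrow> bool list \<Rightarrow> nat list \<Rightarrow> nat" where
  "cost Hd x vs = hd0 vs * 5 + 1 + (hd0 vs * 4 + 1)"
| "cost (Wk e) x vs = cost e x (tl vs)"
| "cost One x vs = 1"
| "cost (Plus a b) x vs = cost a x vs + cost b x vs"
| "cost (Times a b) x vs = cost a x vs + (ev a x vs * (1 + cost b x vs + 2) + 1)"
| "cost (Minus a b) x vs = cost a x vs + (cost b x vs + (ev b x vs * 4 + 1 + (ev a x vs * 4 + 1)))"
| "cost (LetE a b) x vs = cost a x vs + (cost b x (ev a x vs # vs) + (ev a x vs * 3 + 1))"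
| "cost (SumE a b) x vs = cost a x vs +
     (ev a x vs * (1 + ((\<Sum>i<ev a x vs. cost b x (i # vs)) + 1) + 2) + 1 + (ev a x vs * 3 + 1))"
| "cost (Bit a) x vs = cost a x vs + (ev a x vs * 5 + 1 + (3 + (ev a x vs * 4 + 1)))"
| "cost Len x vs = length x * 5 + 1 + (length x * 4 + 1)"

lemma does_While_eq:
  assumes "testable K b" "\<And>i. i < m \<Longrightarrow> holds x b (st i)" "\<not> holds x b (st m)"
    "\<And>i. i < m \<Longrightarrow> does x K p (st i) B (st (Suc i))"
    "st 0 = \<sigma>" "st m = \<sigma>'" "m * (B + 2) + 1 = T"
  shows "does x K (While b p) \<sigma> T \<sigma>'"
  using does_While[of K b m x st p B] assms by simp

lemma does_clear:
  assumes "r < K"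
  shows "does x K (clear r) (h, w, \<rho>) (\<rho> r * 3 + 1) (h, w, \<rho>(r := 0))"
  using assms
  by (intro does_While_eq[where st = "\<lambda>i. (h, w, \<rho>(r := \<rho> r - i))" and m = "\<rho> r" and B = 1])
     (auto intro!: does_Ins[of K "Dec r", unfolded One_nat_def])

lemma does_Ins2:
  assumes "applicable K i \<sigma>" "applicable K j (eff i \<sigma>)" "eff j (eff i \<sigma>) = \<sigma>'"
  shows "does x K (Ins i ;; Ins j) \<sigma> 2 \<sigma>'"
  using does_Seq[OF does_Ins[OF assms(1) refl] does_Ins[OF assms(2,3)]] by (simp add: numeral_2_eq_2)

lemma does_Ins3:
  assumes "applicable K i \<sigma>" "applicable K j (eff i \<sigma>)" "applicable K k (eff j (eff i \<sigma>))"
    "eff k (eff j (eff i \<sigma>)) = \<sigma>'"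
  shows "does x K (Ins i ;; Ins j ;; Ins k) \<sigma> 3 \<sigma>'"
  using does_Seq[OF does_Ins[OF assms(1) refl] does_Ins2[OF assms(2,3,4)]] by (simp add: numeral_3_eq_3 numeral_2_eq_2)

lemma does_code:
  assumes "z < s" "z \<notin> set R" "\<forall>r \<in> set R. r < s" "\<forall>j \<ge> s. \<rho> j = 0" "s + width e \<le> K"
  shows "does x K (code e R z s) (0, w, \<rho>) (cost e x (map \<rho> R)) (0, w, \<rho>(z := \<rho> z + ev e x (map \<rho> R)))"
  using assms
proof (induction e arbitrary: R z s \<rho>)
  case Hd
  show ?case
  proof (cases R)
    case Nil
    then show ?thesis using does_mono[OF does_Skip] by simp
  next
    case (Cons r R')
    let ?v = "\<rho> r"
    have ne: "z \<noteq> r" "r \<noteq> s" "z \<noteq> s" "r < K" "s < K" "z < K" "\<rho> s = 0"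
      using Hd Cons by auto
    have 1: "does x K (While (NZ r) (Ins (Dec r) ;; Ins (Inc z) ;; Ins (Inc s))) (0, w, \<rho>) (?v * 5 + 1)
        (0, w, \<rho>(r := 0, z := \<rho> z + ?v, s := ?v))"
      using ne
      by (intro does_While_eq[where st = "\<lambda>i. (0, w, \<rho>(r := ?v - i, z := \<rho> z + i, s := i))" and m = ?v and B = 3])
         (auto intro!: does_Ins3 simp: fun_eq_iff)
    have 2: "does x K (While (NZ s) (Ins (Dec s) ;; Ins (Inc r))) (0, w, \<rho>(r := 0, z := \<rho> z + ?v, s := ?v))
        (?v * 4 + 1) (0, w, \<rho>(z := \<rho> z + ?v))"
      using ne
      by (intro does_While_eq[where st = "\<lambda>i. (0, w, \<rho>(z := \<rho> z + ?v, s := ?v - i, r := i))" and m = ?v and B = 2])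
         (auto intro!: does_Ins2 simp: fun_eq_iff)
    show ?thesis
      using does_Seq[OF 1 2] Cons by (simp add: fun_upd_def)
  qed
next
  case (Wk e)
  have "set (tl R) \<subseteq> set R"
    by (cases R) auto
  then have "does x K (code e (tl R) z s) (0, w, \<rho>) (cost e x (map \<rho> (tl R)))
     (0, w, \<rho>(z := \<rho> z + ev e x (map \<rho> (tl R))))"
    using Wk.prems by (intro Wk.IH) auto
  then show ?case by (simp add: map_tl fun_upd_def)
next
  case One
  then show ?case by (auto intro!: does_Ins[unfolded One_nat_def] simp: fun_upd_def)
next
  case (Plus a b)
  let ?\<rho> = "\<rho>(z := \<rho> z + ev a x (map \<rho> R))"
  have m: "map ?\<rho> R = map \<rho> R"
    using Plus.prems by (auto intro!: map_cong)
  have 1: "does x K (code a R z s) (0, w, \<rho>) (cost a x (map \<rho> R)) (0, w, ?\<rho>)"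
    using Plus.prems by (intro Plus.IH) auto
  have "does x K (code b R z s) (0, w, ?\<rho>) (cost b x (map ?\<rho> R)) (0, w, ?\<rho>(z := ?\<rho> z + ev b x (map ?\<rho> R)))"
    using Plus.prems by (intro Plus.IH) auto
  then have 2: "does x K (code b R z s) (0, w, ?\<rho>) (cost b x (map \<rho> R))
      (0, w, \<rho>(z := \<rho> z + ev (Plus a b) x (map \<rho> R)))"
    unfolding m by (simp add: add.assoc)
  show ?case
    using does_Seq[OF 1 2] by (simp add: fun_upd_def)
next
  case (Times a b)
  let ?v = "ev a x (map \<rho> R)" and ?u = "ev b x (map \<rho> R)"
  have 1: "does x K (code a R s (s + 1)) (0, w, \<rho>) (cost a x (map \<rho> R)) (0, w, \<rho>(s := \<rho> s + ?v))"
    using Times.prems by (intro Times.IH) (auto simp: less_SucI)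
  let ?st = "\<lambda>i. (0, w, \<rho>(s := ?v - i, z := \<rho> z + i * ?u))"
  have 2: "does x K (Ins (Dec s) ;; code b R z (s + 1)) (?st i) (1 + cost b x (map \<rho> R)) (?st (Suc i))"
    if "i < ?v" for i
  proof -
    let ?\<rho> = "\<rho>(s := ?v - Suc i, z := \<rho> z + i * ?u)"
    have m: "map ?\<rho> R = map \<rho> R"
      using Times.prems by (auto intro!: map_cong)
    have d: "does x K (Ins (Dec s)) (?st i) 1 (0, w, ?\<rho>)"
      using Times.prems by (intro does_Ins) (auto simp: fun_eq_iff)
    have "does x K (code b R z (s + 1)) (0, w, ?\<rho>) (cost b x (map ?\<rho> R)) (0, w, ?\<rho>(z := ?\<rho> z + ev b x (map ?\<rho> R)))"
      using Times.prems by (intro Times.IH) (auto simp: less_SucI)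
    then have "does x K (code b R z (s + 1)) (0, w, ?\<rho>) (cost b x (map \<rho> R)) (?st (Suc i))"
      unfolding m by (simp add: algebra_simps)
    then show ?thesis using does_Seq[OF d] by blast
  qed
  have w: "does x K (While (NZ s) (Ins (Dec s) ;; code b R z (s + 1))) (?st 0) (?v * (1 + cost b x (map \<rho> R) + 2) + 1) (?st ?v)"
    using Times.prems by (intro does_While[where st = ?st] 2) auto
  have st: "?st 0 = (0, w, \<rho>(s := \<rho> s + ?v))" "?st ?v = (0, w, \<rho>(z := \<rho> z + ?v * ?u))"
    using Times.prems by (auto simp: fun_eq_iff)
  show ?case
    using does_Seq[OF 1 w[unfolded st]] by (simp add: fun_upd_def)
next
  case (Minus a b)
  let ?v = "ev a x (map \<rho> R)" and ?u = "ev b x (map \<rho> R)"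
  let ?\<rho> = "\<rho>(s := ?v)"
  have s: "\<rho> s = 0" "\<rho> (s + 1) = 0"
    using Minus.prems by (auto simp: less_SucI)
  have m: "map ?\<rho> R = map \<rho> R"
    using Minus.prems by (auto intro!: map_cong)
  have 1: "does x K (code a R s (s + 1)) (0, w, \<rho>) (cost a x (map \<rho> R)) (0, w, ?\<rho>)"
  proof -
    have "does x K (code a R s (s + 1)) (0, w, \<rho>) (cost a x (map \<rho> (R)))
      (0, w, (\<rho>)(s := (\<rho>) (s) + ev a x (map \<rho> (R))))"
      using Minus.prems by (intro Minus.IH) (auto simp: less_SucI)
    then show ?thesis
      using s by simp
  qed
  have 2: "does x K (code b R (s + 1) (s + 2)) (0, w, ?\<rho>) (cost b x (map \<rho> R)) (0, w, ?\<rho>(s + 1 := ?u))"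
  proof -
    have "does x K (code b R (s + 1) (s + 2)) (0, w, ?\<rho>) (cost b x (map ?\<rho> (R)))
      (0, w, (?\<rho>)(s + 1 := (?\<rho>) (s + 1) + ev b x (map ?\<rho> (R))))"
      using Minus.prems by (intro Minus.IH) (auto simp: less_SucI)
    then show ?thesis
      unfolding m using s by simp
  qed
  have 3: "does x K (While (NZ (s + 1)) (Ins (Dec (s + 1)) ;; Ins (Dec s))) (0, w, ?\<rho>(s + 1 := ?u)) (?u * 4 + 1)
      (0, w, \<rho>(s := ?v - ?u))"
    using Minus.prems s
      by (intro does_While_eq[where st = "\<lambda>i. (0, w, \<rho>(s + 1 := ?u - i, s := ?v - i))" and m = ?u and B = 2])
         (auto intro!: does_Ins2 simp: fun_eq_iff)
  have "does x K (While (NZ s) (Ins (Dec s) ;; Ins (Inc z))) (0, w, \<rho>(s := ?v - ?u)) ((?v - ?u) * 4 + 1)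
      (0, w, \<rho>(z := \<rho> z + (?v - ?u)))"
    using Minus.prems s
      by (intro does_While_eq[where st = "\<lambda>i. (0, w, \<rho>(s := ?v - ?u - i, z := \<rho> z + i))" and m = "?v - ?u" and B = 2])
         (auto intro!: does_Ins2 simp: fun_eq_iff)
  then have 4: "does x K (While (NZ s) (Ins (Dec s) ;; Ins (Inc z))) (0, w, \<rho>(s := ?v - ?u)) (?v * 4 + 1)
      (0, w, \<rho>(z := \<rho> z + (?v - ?u)))"
    by (rule does_mono) simp
  show ?case
    using does_Seq[OF 1 does_Seq[OF 2 does_Seq[OF 3 4]]] by (simp add: fun_upd_def)
next
  case (LetE a b)
  let ?v = "ev a x (map \<rho> R)"
  let ?\<rho> = "\<rho>(s := ?v)"
  have s: "\<rho> s = 0"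
    using LetE.prems by (auto simp: less_SucI)
  have m: "map ?\<rho> (s # R) = ?v # map \<rho> R"
    using LetE.prems by auto
  have 1: "does x K (code a R s (s + 1)) (0, w, \<rho>) (cost a x (map \<rho> R)) (0, w, ?\<rho>)"
  proof -
    have "does x K (code a R s (s + 1)) (0, w, \<rho>) (cost a x (map \<rho> (R)))
      (0, w, (\<rho>)(s := (\<rho>) (s) + ev a x (map \<rho> (R))))"
      using LetE.prems by (intro LetE.IH) (auto simp: less_SucI)
    then show ?thesis
      using s by simp
  qed
  have 2: "does x K (code b (s # R) z (s + 1)) (0, w, ?\<rho>) (cost b x (?v # map \<rho> R))
      (0, w, ?\<rho>(z := ?\<rho> z + ev b x (?v # map \<rho> R)))"
  proof -
    have "does x K (code b (s # R) z (s + 1)) (0, w, ?\<rho>) (cost b x (map ?\<rho> (s # R)))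
      (0, w, (?\<rho>)(z := (?\<rho>) (z) + ev b x (map ?\<rho> (s # R))))"
      using LetE.prems by (intro LetE.IH) (auto simp: less_SucI)
    then show ?thesis
      unfolding m using s by simp
  qed
  have 3: "does x K (clear s) (0, w, ?\<rho>(z := ?\<rho> z + ev b x (?v # map \<rho> R))) (?v * 3 + 1)
      (0, w, \<rho>(z := \<rho> z + ev b x (?v # map \<rho> R)))"
    using does_clear[of s K x 0 w "?\<rho>(z := ?\<rho> z + ev b x (?v # map \<rho> R))"] LetE.prems s
    by (auto simp: fun_upd_twist fun_upd_idem)
  show ?case
    using does_Seq[OF 1 does_Seq[OF 2 3]] by (simp add: fun_upd_def)
next
  case (SumE a b)
  let ?v = "ev a x (map \<rho> R)" and ?u = "\<lambda>i. ev b x (i # map \<rho> R)"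
  \<comment> \<open>The loop rule wants one time bound for all rounds; the sum over all rounds
    serves.\<close>
  let ?B = "\<Sum>i<?v. cost b x (i # map \<rho> R)"
  have s: "\<rho> s = 0" "\<rho> (s + 1) = 0"
    using SumE.prems by (auto simp: less_SucI)
  have 1: "does x K (code a R s (s + 2)) (0, w, \<rho>) (cost a x (map \<rho> R)) (0, w, \<rho>(s := ?v))"
  proof -
    have "does x K (code a R s (s + 2)) (0, w, \<rho>) (cost a x (map \<rho> (R)))
      (0, w, (\<rho>)(s := (\<rho>) (s) + ev a x (map \<rho> (R))))"
      using SumE.prems by (intro SumE.IH) (auto simp: less_SucI)
    then show ?thesis
      using s by simp
  qed
  let ?r = "\<lambda>k i j. \<rho>(s := k, s + 1 := i, z := \<rho> z + (\<Sum>i<j. ?u i))"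
  let ?st = "\<lambda>i. (0, w, ?r (?v - i) i i)"
  have 2: "does x K (Ins (Dec s) ;; code b ((s + 1) # R) z (s + 2) ;; Ins (Inc (s + 1))) (?st i) (1 + (?B + 1)) (?st (Suc i))"
    if "i < ?v" for i
  proof -
    let ?\<rho> = "?r (?v - Suc i) i i"
    have m: "map ?\<rho> ((s + 1) # R) = i # map \<rho> R"
      using SumE.prems by auto
    have d: "does x K (Ins (Dec s)) (?st i) 1 (0, w, ?\<rho>)"
      using SumE.prems by (intro does_Ins) (auto simp: fun_eq_iff)
    have "does x K (code b ((s + 1) # R) z (s + 2)) (0, w, ?\<rho>) (cost b x (map ?\<rho> ((s + 1) # R)))
       (0, w, ?\<rho>(z := ?\<rho> z + ev b x (map ?\<rho> ((s + 1) # R))))"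
      using SumE.prems by (intro SumE.IH) (auto simp: less_SucI)
    then have "does x K (code b ((s + 1) # R) z (s + 2)) (0, w, ?\<rho>) (cost b x (i # map \<rho> R)) (0, w, ?r (?v - Suc i) i (Suc i))"
      unfolding m by (simp add: add.assoc)
    moreover have "cost b x (i # map \<rho> R) \<le> ?B"
      using that by (intro member_le_sum) auto
    ultimately have e: "does x K (code b ((s + 1) # R) z (s + 2)) (0, w, ?\<rho>) ?B (0, w, ?r (?v - Suc i) i (Suc i))"
      using does_mono by blast
    have f: "does x K (Ins (Inc (s + 1))) (0, w, ?r (?v - Suc i) i (Suc i)) 1 (?st (Suc i))"
      using SumE.prems by (intro does_Ins) (auto simp: fun_eq_iff)
    show ?thesis using does_Seq[OF d does_Seq[OF e f]] by blast
  qed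
  have w: "does x K (While (NZ s) (Ins (Dec s) ;; code b ((s + 1) # R) z (s + 2) ;; Ins (Inc (s + 1)))) (?st 0)
      (?v * (1 + (?B + 1) + 2) + 1) (?st ?v)"
    using SumE.prems by (intro does_While[where st = ?st] 2) auto
  have c: "does x K (clear (s + 1)) (?st ?v) (?v * 3 + 1) (0, w, (?r (?v - ?v) ?v ?v)(s + 1 := 0))"
    using does_clear[of "s + 1" K x 0 w "?r (?v - ?v) ?v ?v"] SumE.prems s by simp
  have st: "?st 0 = (0, w, \<rho>(s := ?v))" "(?r (?v - ?v) ?v ?v)(s + 1 := 0) = \<rho>(z := \<rho> z + (\<Sum>i<?v. ?u i))"
    using SumE.prems s by (auto simp: fun_eq_iff)
  show ?case
    using does_Seq[OF 1 does_Seq[OF w c, unfolded st]] by (simp add: fun_upd_def)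
next
  case (Bit a)
  let ?v = "ev a x (map \<rho> R)"
  let ?\<rho> = "\<rho>(z := \<rho> z + bit_at x ?v)"
  have s: "\<rho> s = 0" "\<rho> (s + 1) = 0"
    using Bit.prems by (auto simp: less_SucI)
  have 1: "does x K (code a R s (s + 2)) (0, w, \<rho>) (cost a x (map \<rho> R)) (0, w, \<rho>(s := ?v))"
  proof -
    have "does x K (code a R s (s + 2)) (0, w, \<rho>) (cost a x (map \<rho> (R)))
      (0, w, (\<rho>)(s := (\<rho>) (s) + ev a x (map \<rho> (R))))"
      using Bit.prems by (intro Bit.IH) (auto simp: less_SucI)
    then show ?thesis
      using s by simp
  qed
  have 2: "does x K (While (NZ s) (Ins (Dec s) ;; Ins InR ;; Ins (Inc (s + 1)))) (0, w, \<rho>(s := ?v)) (?v * 5 + 1)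
      (?v, w, \<rho>(s + 1 := ?v))"
    using Bit.prems s
      by (intro does_While_eq[where st = "\<lambda>i. (i, w, \<rho>(s := ?v - i, s + 1 := i))" and m = ?v and B = 3])
         (auto intro!: does_Ins3 simp: fun_eq_iff)
  have 3: "does x K (If Is_one (Ins (Inc z)) Skip) (?v, w, \<rho>(s + 1 := ?v)) 3 (?v, w, ?\<rho>(s + 1 := ?v))"
  proof (cases "holds x Is_one (?v, w, \<rho>(s + 1 := ?v))")
    case True
    then have bit: "bit_at x ?v = 1" by (simp add: bit_at_def)
    have "does x K (Ins (Inc z)) (?v, w, \<rho>(s + 1 := ?v)) 1 (?v, w, ?\<rho>(s + 1 := ?v))"
      unfolding bit using Bit.prems by (intro does_Ins) (auto simp: fun_eq_iff)
    from does_If_True[OF _ True this, of Skip] show ?thesis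
      by (simp add: numeral_3_eq_3 numeral_2_eq_2)
  next
    case False
    then have bit: "bit_at x ?v = 0" by (auto simp: bit_at_def)
    have "does x K (If Is_one (Ins (Inc z)) Skip) (?v, w, \<rho>(s + 1 := ?v)) (0 + 2) (?v, w, \<rho>(s + 1 := ?v))"
      by (rule does_If_False[OF _ False does_Skip]) simp
    then show ?thesis
      unfolding bit by (auto intro: does_mono)
  qed
  have 4: "does x K (While (NZ (s + 1)) (Ins (Dec (s + 1)) ;; Ins InL)) (?v, w, ?\<rho>(s + 1 := ?v)) (?v * 4 + 1)
      (0, w, ?\<rho>)"
    using Bit.prems s
      by (intro does_While_eq[where st = "\<lambda>i. (?v - i, w, ?\<rho>(s + 1 := ?v - i))" and m = ?v and B = 2])
         (auto intro!: does_Ins2 simp: fun_eq_iff)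
  show ?case
    using does_Seq[OF 1 does_Seq[OF 2 does_Seq[OF 3 4]]] by (simp add: fun_upd_def)
next
  case Len
  let ?n = "length x"
  have s: "\<rho> s = 0" using Len.prems by auto
  have 1: "does x K (While Nonblank (Ins InR ;; Ins (Inc s) ;; Ins (Inc z))) (0, w, \<rho>) (?n * 5 + 1)
      (?n, w, \<rho>(z := \<rho> z + ?n, s := ?n))"
    using Len.prems s
      by (intro does_While_eq[where st = "\<lambda>i. (i, w, \<rho>(z := \<rho> z + i, s := i))" and m = ?n and B = 3])
         (auto intro!: does_Ins3 simp: fun_eq_iff)
  have 2: "does x K (While (NZ s) (Ins (Dec s) ;; Ins InL)) (?n, w, \<rho>(z := \<rho> z + ?n, s := ?n)) (?n * 4 + 1)
      (0, w, \<rho>(z := \<rho> z + ?n))"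
    using Len.prems s
      by (intro does_While_eq[where st = "\<lambda>i. (?n - i, w, \<rho>(z := \<rho> z + ?n, s := ?n - i))" and m = ?n and B = 2])
         (auto intro!: does_Ins2 simp: fun_eq_iff)
  show ?case
    using does_Seq[OF 1 2] by (simp add: fun_upd_def)
qed


text \<open>\<open>N\<close> bounds the input length and all variables. Below a binder it grows by
  the bound of the new variable; the nesting of binders is fixed with the expression, so polynomials
  are composed only a fixed number of times.\<close>

fun value_bound :: "ex \<Rightarrow> nat \<Rightarrow> nat" where
  "value_bound Hd N = N"
| "value_bound (Wk e) N = value_bound e N"
| "value_bound One N = 1"
| "value_bound (Plus a b) N = value_bound a N + value_bound b N"
| "value_bound (Times a b) N = value_bound a N * value_bound b N"
| "value_bound (Minus a b) N = value_bound a N"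
| "value_bound (LetE a b) N = value_bound b (N + value_bound a N)"
| "value_bound (SumE a b) N = value_bound a N * value_bound b (N + value_bound a N)"
| "value_bound (Bit a) N = 1"
| "value_bound Len N = N"

fun cost_bound :: "ex \<Rightarrow> nat \<Rightarrow> nat" where
  "cost_bound Hd N = N * 5 + 1 + (N * 4 + 1)"
| "cost_bound (Wk e) N = cost_bound e N"
| "cost_bound One N = 1"
| "cost_bound (Plus a b) N = cost_bound a N + cost_bound b N"
| "cost_bound (Times a b) N = cost_bound a N + (value_bound a N * (1 + cost_bound b N + 2) + 1)"
| "cost_bound (Minus a b) N =
     cost_bound a N + (cost_bound b N + (value_bound b N * 4 + 1 + (value_bound a N * 4 + 1)))"
| "cost_bound (LetE a b) N =
     cost_bound a N + (cost_bound b (N + value_bound a N) + (value_bound a N * 3 + 1))"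
| "cost_bound (SumE a b) N = cost_bound a N + (value_bound a N *
     (1 + (value_bound a N * cost_bound b (N + value_bound a N) + 1) + 2) + 1 + (value_bound a N * 3 + 1))"
| "cost_bound (Bit a) N = cost_bound a N + (value_bound a N * 5 + 1 + (3 + (value_bound a N * 4 + 1)))"
| "cost_bound Len N = N * 5 + 1 + (N * 4 + 1)"

lemma ev_cost_le_bounds:
  assumes "length x \<le> N" "\<forall>v \<in> set vs. v \<le> N"
  shows "ev e x vs \<le> value_bound e N \<and> cost e x vs \<le> cost_bound e N"
  using assms
proof (induction e arbitrary: vs N)
  case Hd
  then have "hd0 vs \<le> N" by (cases vs) auto
  then show ?case by simp
next
  case (Wk e)
  have "set (tl vs) \<subseteq> set vs" by (cases vs) auto
  then have "\<forall>v \<in> set (tl vs). v \<le> N" using Wk.prems by blast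
  then show ?case using Wk by simp
next
  case (Plus a b)
  then show ?case by (simp add: add_mono)
next
  case (Times a b)
  then show ?case by (simp add: add_mono mult_mono)
next
  case (Minus a b)
  then have "ev a x vs \<le> value_bound a N" "ev b x vs \<le> value_bound b N"
    "cost a x vs \<le> cost_bound a N" "cost b x vs \<le> cost_bound b N"
    by auto
  then show ?case by simp
next
  case (LetE a b)
  let ?N = "N + value_bound a N"
  have a: "ev a x vs \<le> value_bound a N" "cost a x vs \<le> cost_bound a N"
    using LetE by auto
  have "ev b x (ev a x vs # vs) \<le> value_bound b ?N \<and> cost b x (ev a x vs # vs) \<le> cost_bound b ?N"
    using a LetE.prems by (intro LetE.IH) (auto simp: trans_le_add1 trans_le_add2)
  then show ?case using a by simp
next
  case (SumE a b)
  let ?N = "N + value_bound a N"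
  have a: "ev a x vs \<le> value_bound a N" "cost a x vs \<le> cost_bound a N"
    using SumE by auto
  have b: "ev b x (i # vs) \<le> value_bound b ?N \<and> cost b x (i # vs) \<le> cost_bound b ?N"
    if "i < ev a x vs" for i
    using a that SumE.prems by (intro SumE.IH) (auto simp: trans_le_add1 trans_le_add2)
  have "(\<Sum>i<ev a x vs. ev b x (i # vs)) \<le> ev a x vs * value_bound b ?N"
    using sum_bounded_above[of "{..<ev a x vs}" "\<lambda>i. ev b x (i # vs)" "value_bound b ?N"] b by simp
  then have 1: "(\<Sum>i<ev a x vs. ev b x (i # vs)) \<le> value_bound a N * value_bound b ?N"
    using a by (meson le_trans mult_le_mono1)
  have "(\<Sum>i<ev a x vs. cost b x (i # vs)) \<le> ev a x vs * cost_bound b ?N"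
    using sum_bounded_above[of "{..<ev a x vs}" "\<lambda>i. cost b x (i # vs)" "cost_bound b ?N"] b by simp
  then have "(\<Sum>i<ev a x vs. cost b x (i # vs)) \<le> value_bound a N * cost_bound b ?N"
    using a by (meson le_trans mult_le_mono1)
  then show ?case
    using 1 a by (auto intro!: add_mono mult_mono)
next
  case (Bit a)
  then have "ev a x vs \<le> value_bound a N" "cost a x vs \<le> cost_bound a N"
    by auto
  then show ?case by (simp add: bit_at_def)
qed auto

text \<open>The base is at least 2 for every \<open>N\<close>, so that larger exponents absorb
  constants, sums and compositions.\<close>

definition poly_bounded :: "(nat \<Rightarrow> nat) \<Rightarrow> bool" where
  "poly_bounded f \<longleftrightarrow> (\<exists>k. \<forall>N. f N \<le> (N + 2) ^ k)"

lemma poly_bounded_const: "poly_bounded (\<lambda>N. c)"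
proof -
  have "c \<le> (N + 2) ^ c" for N
  proof -
    have "c \<le> 2 ^ c" using less_exp[of c] by simp
    also have "\<dots> \<le> (N + 2) ^ c" by (intro power_mono) auto
    finally show ?thesis .
  qed
  then show ?thesis unfolding poly_bounded_def by blast
qed

lemma poly_bounded_id: "poly_bounded (\<lambda>N. N)"
  unfolding poly_bounded_def by (intro exI[of _ 1]) auto

lemma poly_bounded_mult: "poly_bounded f \<Longrightarrow> poly_bounded g \<Longrightarrow> poly_bounded (\<lambda>N. f N * g N)"
  unfolding poly_bounded_def by (metis mult_le_mono power_add)

lemma poly_bounded_add:
  assumes "poly_bounded f" "poly_bounded g"
  shows "poly_bounded (\<lambda>N. f N + g N)"
proof -
  obtain k l where kl: "\<And>N. f N \<le> (N + 2) ^ k" "\<And>N. g N \<le> (N + 2) ^ l"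
    using assms unfolding poly_bounded_def by blast
  have "f N + g N \<le> (N + 2) ^ Suc (k + l)" for N
  proof -
    have "f N \<le> (N + 2) ^ (k + l)" "g N \<le> (N + 2) ^ (k + l)"
      using kl[of N] power_increasing[of k "k + l" "N + 2"] power_increasing[of l "k + l" "N + 2"]
      by (auto intro: order.trans)
    then have "f N + g N \<le> 2 * (N + 2) ^ (k + l)" by simp
    also have "\<dots> \<le> (N + 2) * (N + 2) ^ (k + l)" by (intro mult_mono) auto
    finally show ?thesis by simp
  qed
  then show ?thesis unfolding poly_bounded_def by blast
qed

lemma poly_bounded_compose:
  assumes "poly_bounded f" "poly_bounded g"
  shows "poly_bounded (\<lambda>N. f (g N))"
proof -
  obtain k l where kl: "\<And>N. f N \<le> (N + 2) ^ k" "\<And>N. g N \<le> (N + 2) ^ l"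
    using assms unfolding poly_bounded_def by blast
  have "f (g N) \<le> (N + 2) ^ ((l + 2) * k)" for N
  proof -
    have "1 * 2 \<le> (N + 2) ^ l * (N + 2)"
      by (intro mult_mono) auto
    moreover have "2 * (N + 2) ^ Suc l \<le> (N + 2) * (N + 2) ^ Suc l"
      by (intro mult_mono) auto
    ultimately have "g N + 2 \<le> (N + 2) ^ (l + 2)"
      using kl(2)[of N] power_increasing[of l "Suc l" "N + 2"] by (simp add: mult.commute)
    then have "(g N + 2) ^ k \<le> ((N + 2) ^ (l + 2)) ^ k"
      by (intro power_mono) auto
    then show ?thesis
      using kl(1)[of "g N"] by (simp only: power_mult[symmetric])
  qed
  then show ?thesis unfolding poly_bounded_def by blast
qed

lemmas poly_bounded_intros = poly_bounded_add poly_bounded_mult poly_bounded_id poly_bounded_const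

lemma poly_bounded_cong: "(\<And>N. f N = g N) \<Longrightarrow> poly_bounded g \<Longrightarrow> poly_bounded f"
  by (simp add: poly_bounded_def)

lemma poly_bounded_compose_shift:
  assumes "poly_bounded f" "poly_bounded g"
  shows "poly_bounded (\<lambda>N. f (N + g N))"
  by (intro poly_bounded_compose[OF assms(1)] poly_bounded_intros assms)

lemma poly_bounded_value_bound: "poly_bounded (value_bound e)"
  by (induction e; (rule poly_bounded_cong, rule value_bound.simps);
      (intro poly_bounded_compose_shift[of "value_bound _"] poly_bounded_intros)?; assumption?)

lemma poly_bounded_cost_bound: "poly_bounded (cost_bound e)"
  by (induction e; (rule poly_bounded_cong, rule cost_bound.simps);
      (intro poly_bounded_compose_shift[of "cost_bound _"] poly_bounded_intros poly_bounded_value_bound)?; assumption?)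

section \<open>From programs to machines that run in polynomial time\<close>

lemma jump_free_code: "jump_free (code e R z s)"
proof (induction e arbitrary: R z s)
  case Hd
  then show ?case by (cases R) auto
qed auto

lemma tm_step_Mark:
  "tm_step (machine K (Mark # c)) (init_config (machine K (Mark # c)) x) = (1, tapes x K (0, [], \<lambda>_. 0))"
proof -
  have "(tape_content [])(0 := 1) = mark_tape"
    by (auto simp: tape_content_def mark_tape_def)
  moreover have "(tape_content [])(0 := 0) = tape_content []"
    by (auto simp: tape_content_def)
  moreover have "tape_content [] 0 = 0" by (simp add: tape_content_def)
  moreover have "num_tapes (machine K (Mark # c)) - 1 = Suc K" by (simp add: machine_def)
  ultimately show ?thesis
    unfolding tm_step_def init_config_def
    by (simp add: machine_def idle_def act_tape_def read_tape_def map_replicate_const zip_replicate1)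
qed

lemma tm_step_halted: "(tm_step M ^^ t) (num_states M, ts) = (num_states M, ts)"
  by (induction t) (auto simp: tm_step_def)

lemma computes_within_mono:
  assumes "computes_within M x y t" "t \<le> t'"
  shows "computes_within M x y t'"
proof -
  obtain ts where ts: "(tm_step M ^^ t) (init_config M x) = (num_states M, ts)"
    using assms(1) by (auto simp: computes_within_def split: prod.splits)
  have "(tm_step M ^^ t') (init_config M x) = (tm_step M ^^ (t' - t)) ((tm_step M ^^ t) (init_config M x))"
    using funpow_add[of "t' - t" t "tm_step M"] assms(2) by simp
  then show ?thesis
    using assms(1) ts tm_step_halted[of "t' - t" M ts] by (simp add: computes_within_def)
qed

lemma polytime_computable_bounded:
  assumes "wf_tm M" "poly_bounded f" "\<And>x. computes_within M x (g x) (f (length x))"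
  shows "polytime_computable g"
proof -
  obtain k where k: "\<And>N. f N \<le> (N + 2) ^ k"
    using assms(2) unfolding poly_bounded_def by blast
  have "poly ([:2, 1:] ^ k) N = (N + 2) ^ k" for N :: nat
    by (simp add: poly_power add.commute)
  then have "computes_within M x (g x) (poly ([:2, 1:] ^ k) (length x))" for x
    using computes_within_mono[OF assms(3)[of x]] k by simp
  then show ?thesis
    unfolding polytime_computable_def using assms(1) by blast
qed

text \<open>Each output bit is evaluated afresh from its index \<open>i\<close>, the only variable,
  and the output tape is never read back. So a function is presented by the length of its value and
  a formula for a single bit.\<close>

lemma polytime_computable_ev:
  "polytime_computable (\<lambda>x. map (\<lambda>i. ev e x [i] \<noteq> 0) [0..<ev l x []])"
proof -
  define K where "K = 3 + width l + width e"
  \<comment> \<open>Register 0 counts the bits still to come, 1 is the index and 2 the value of the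
    current bit; scratch space starts at 3.\<close>
  define body where "body = Ins (Dec 0) ;; code e [1] 2 3 ;;
     If (NZ 2) (Ins (Emit True)) (Ins (Emit False)) ;; clear 2 ;; Ins (Inc 1)"
  define P where "P = code l [] 0 2 ;; While (NZ 0) body"
  define C where "C = Mark # assemble 1 P"
  define N where "N n = n + value_bound l n" for n
  define B where "B n = 1 + (cost_bound e (N n) + (3 + ((value_bound e (N n) * 3 + 1) + 1)))" for n
  define T where "T n = cost_bound l n + (value_bound l n * (B n + 2) + 1)" for n
  have wf: "wf_tm (machine K C)"
  proof (rule wf_machine)
    have "jump_free P" by (simp add: P_def body_def jump_free_code)
    then show "\<forall>i \<in> set C. target_ok (length C) i"
      using target_ok_assemble[of P _ 1] by (auto simp: C_def)
  qed
  have "poly_bounded N"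
    unfolding N_def by (intro poly_bounded_intros poly_bounded_value_bound)
  then have pbB: "poly_bounded B"
    unfolding B_def
    by (intro poly_bounded_add poly_bounded_mult poly_bounded_const
        poly_bounded_compose[OF poly_bounded_cost_bound] poly_bounded_compose[OF poly_bounded_value_bound])
  have pbT: "poly_bounded (\<lambda>n. Suc (T n))"
    unfolding T_def Suc_eq_plus1
    by (intro poly_bounded_intros pbB poly_bounded_value_bound poly_bounded_cost_bound)
  have "computes_within (machine K C) x (map (\<lambda>i. ev e x [i] \<noteq> 0) [0..<ev l x []]) (Suc (T (length x)))" for x
  proof -
    let ?n = "length x" and ?m = "ev l x []"
    let ?w = "\<lambda>i. map (\<lambda>i. ev e x [i] \<noteq> 0) [0..<i]"
    let ?st = "\<lambda>i. (0 :: nat, ?w i, (\<lambda>_. 0 :: nat)(0 := ?m - i, 1 := i))"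
    have l: "?m \<le> value_bound l ?n" "cost l x [] \<le> cost_bound l ?n"
      using ev_cost_le_bounds[of x ?n "[]" l] by auto
    have "does x K (code l [] 0 2) (0, [], \<lambda>_. 0) (cost l x []) (0, [], (\<lambda>_. 0)(0 := ?m))"
      using does_code[of 0 2 "[]" "\<lambda>_. 0" l K x "[]"] by (simp add: K_def)
    then have "does x K (code l [] 0 2) (0, [], \<lambda>_. 0) (cost_bound l ?n) (?st 0)"
      using l(2) by (auto intro: does_mono simp: fun_upd_idem)
    moreover have "does x K body (?st i) (B ?n) (?st (Suc i))" if i: "i < ?m" for i
    proof -
      let ?\<rho> = "(\<lambda>_. 0 :: nat)(0 := ?m - Suc i, 1 := i)"
      let ?v = "ev e x [i]"
      have e: "?v \<le> value_bound e (N ?n)" "cost e x [i] \<le> cost_bound e (N ?n)"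
        using ev_cost_le_bounds[of x "N ?n" "[i]" e] i l by (auto simp: N_def)
      have 1: "does x K (Ins (Dec 0)) (?st i) 1 (0, ?w i, ?\<rho>)"
        by (rule does_Ins) (auto simp: K_def fun_eq_iff)
      have "does x K (code e [1] 2 3) (0, ?w i, ?\<rho>) (cost e x [i]) (0, ?w i, ?\<rho>(2 := ?v))"
        using does_code[of 2 3 "[1]" ?\<rho> e K x "?w i"] by (simp add: K_def)
      then have 2: "does x K (code e [1] 2 3) (0, ?w i, ?\<rho>) (cost_bound e (N ?n)) (0, ?w i, ?\<rho>(2 := ?v))"
        using e by (auto intro: does_mono)
      have 3: "does x K (If (NZ 2) (Ins (Emit True)) (Ins (Emit False))) (0, ?w i, ?\<rho>(2 := ?v)) (1 + 2)
          (0, ?w (Suc i), ?\<rho>(2 := ?v))"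
      proof (cases "?v = 0")
        case True
        then show ?thesis by (intro does_If_False does_Ins) (auto simp: K_def)
      next
        case False
        then show ?thesis by (intro does_If_True does_Ins) (auto simp: K_def)
      qed
      have "does x K (clear 2) (0, ?w (Suc i), ?\<rho>(2 := ?v)) (?v * 3 + 1) (0, ?w (Suc i), ?\<rho>)"
        using does_clear[of 2 K x 0 "?w (Suc i)" "?\<rho>(2 := ?v)"] by (simp add: K_def fun_upd_idem)
      then have 4: "does x K (clear 2) (0, ?w (Suc i), ?\<rho>(2 := ?v)) (value_bound e (N ?n) * 3 + 1) (0, ?w (Suc i), ?\<rho>)"
        using e by (auto intro: does_mono)
      have 5: "does x K (Ins (Inc 1)) (0, ?w (Suc i), ?\<rho>) 1 (?st (Suc i))"
        by (rule does_Ins) (auto simp: K_def fun_eq_iff)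
      show ?thesis
        using does_Seq[OF 1 does_Seq[OF 2 does_Seq[OF 3 does_Seq[OF 4 5]]]]
        by (simp add: body_def B_def numeral_3_eq_3)
    qed
    then have "does x K (While (NZ 0) body) (?st 0) (?m * (B ?n + 2) + 1) (?st ?m)"
      by (intro does_While[where st = ?st]) (auto simp: K_def)
    then have "does x K (While (NZ 0) body) (?st 0) (value_bound l ?n * (B ?n + 2) + 1) (?st ?m)"
      by (rule does_mono) (intro add_mono mult_mono l order.refl, auto)
    ultimately have "does x K P (0, [], \<lambda>_. 0) (T ?n) (?st ?m)"
      unfolding P_def T_def by (rule does_Seq)
    then obtain t where t: "t \<le> T ?n" "\<And>C a. code_at C a (assemble a P) \<Longrightarrow>
        (tm_step (machine K C) ^^ t) (a, tapes x K (0, [], \<lambda>_. 0)) = (a + len P, tapes x K (?st ?m))"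
      unfolding does_def by blast
    have "code_at C 1 (assemble 1 P)"
      unfolding code_at_def C_def by (intro exI[of _ "[Mark]"] exI[of _ "[]"]) simp
    then have "(tm_step (machine K C) ^^ t) (1, tapes x K (0, [], \<lambda>_. 0)) = (length C, tapes x K (?st ?m))"
      using t(2) by (simp add: C_def)
    then have "(tm_step (machine K C) ^^ Suc t) (init_config (machine K C) x) = (length C, tapes x K (?st ?m))"
      unfolding funpow_Suc_right comp_apply C_def tm_step_Mark .
    then have "computes_within (machine K C) x (?w ?m) (Suc t)"
      by (simp add: computes_within_def machine_def)
    then show ?thesis
      using computes_within_mono t(1) by auto
  qed
  then show ?thesis
    by (rule polytime_computable_bounded[OF wf pbT])
qed

subsection \<open>Expressions for polynomial-time functions\<close>

text \<open>The second argument is the stack of the values of the enclosing bound variables, innermost first.\<close>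

definition pexp :: "(bool list \<Rightarrow> nat list \<Rightarrow> nat) \<Rightarrow> bool" where
  "pexp f \<longleftrightarrow> (\<exists>e. \<forall>x vs. ev e x vs = f x vs)"

text \<open>All later proofs of polynomial time pass through this rule and are then a matter of the
  closure rules of \<open>pexp\<close>.\<close>

theorem polytime_computable_pexp:
  assumes "pexp l" "pexp (\<lambda>x e. of_bool (P x (hd0 e)))" "\<And>x. f x = map (P x) [0..<l x []]"
  shows "polytime_computable f"
proof -
  obtain el eb where e: "\<And>x vs. ev el x vs = l x vs" "\<And>x vs. ev eb x vs = of_bool (P x (hd0 vs))"
    using assms(1,2) unfolding pexp_def by blast
  have "f = (\<lambda>x. map (P x) [0..<l x []])" using assms(3) by blast
  then show ?thesis
    using polytime_computable_ev[of eb el] by (simp add: e)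
qed

lemma pexp_hd: "pexp (\<lambda>x e. hd0 e)"
  unfolding pexp_def by (rule exI[of _ Hd]) simp

lemma pexp_tl: "pexp f \<Longrightarrow> pexp (\<lambda>x e. f x (tl e))"
  unfolding pexp_def by (metis ev.simps(2))

lemma pexp_add: "pexp f \<Longrightarrow> pexp g \<Longrightarrow> pexp (\<lambda>x e. f x e + g x e)"
  unfolding pexp_def by (metis ev.simps(4))

lemma pexp_mult: "pexp f \<Longrightarrow> pexp g \<Longrightarrow> pexp (\<lambda>x e. f x e * g x e)"
  unfolding pexp_def by (metis ev.simps(5))

lemma pexp_diff: "pexp f \<Longrightarrow> pexp g \<Longrightarrow> pexp (\<lambda>x e. f x e - g x e)"
  unfolding pexp_def by (metis ev.simps(6))

text \<open>In \<open>f x e i\<close> the bound value \<open>i\<close> becomes the head of the stack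
  and \<open>e\<close> its tail; a premise of this form lets resolution descend below binders. The
  rules for sums and bounded quantifiers have the same shape.\<close>

lemma pexp_let: "pexp g \<Longrightarrow> pexp (\<lambda>x e. f x (tl e) (hd0 e)) \<Longrightarrow> pexp (\<lambda>x e. f x e (g x e))"
  unfolding pexp_def by (elim exE, rule_tac x = "LetE e ea" in exI) simp

lemma pexp_sum: "pexp g \<Longrightarrow> pexp (\<lambda>x e. f x (tl e) (hd0 e)) \<Longrightarrow> pexp (\<lambda>x e. \<Sum>i<g x e. f x e i)"
  unfolding pexp_def by (elim exE, rule_tac x = "SumE e ea" in exI) simp

lemma pexp_bit_at: "pexp f \<Longrightarrow> pexp (\<lambda>x e. bit_at x (f x e))"
  unfolding pexp_def by (metis ev.simps(9))

lemma pexp_length: "pexp (\<lambda>x e. length x)"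
  unfolding pexp_def by (rule exI[of _ Len]) simp

lemma pexp_const: "pexp (\<lambda>x e. c)"
proof (induction c)
  case 0
  have "ev (Minus One One) x vs = 0" for x vs by simp
  then show ?case unfolding pexp_def by blast
next
  case (Suc c)
  then obtain e where e: "\<And>x vs. ev e x vs = c" unfolding pexp_def by blast
  have "ev (Plus One e) x vs = Suc c" for x vs by (simp add: e)
  then show ?case unfolding pexp_def by blast
qed

lemma pexp_cong: "pexp g \<Longrightarrow> (\<And>x e. f x e = g x e) \<Longrightarrow> pexp f"
  by (simp add: pexp_def)

lemma pexp_Suc: "pexp f \<Longrightarrow> pexp (\<lambda>x e. Suc (f x e))"
  by (rule pexp_cong[OF pexp_add[OF _ pexp_const[of 1]]]) auto

text \<open>Truncated subtraction makes \<open>1 - (f x e - g x e)\<close> the truth value of the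
  comparison.\<close>

lemma pexp_le:
  assumes "pexp f" "pexp g" shows "pexp (\<lambda>x e. of_bool (f x e \<le> g x e))"
  by (rule pexp_cong[OF pexp_diff[OF pexp_const[of 1] pexp_diff[OF assms]]]) auto

lemma pexp_less: "pexp f \<Longrightarrow> pexp g \<Longrightarrow> pexp (\<lambda>x e. of_bool (f x e < g x e))"
  using pexp_le[OF pexp_Suc] by (simp add: Suc_le_eq)

lemma pexp_conj: "pexp (\<lambda>x e. of_bool (P x e)) \<Longrightarrow> pexp (\<lambda>x e. of_bool (Q x e)) \<Longrightarrow>
  pexp (\<lambda>x e. of_bool (P x e \<and> Q x e))"
  by (drule pexp_mult, assumption) (simp add: of_bool_conj)

lemma pexp_not: "pexp (\<lambda>x e. of_bool (P x e)) \<Longrightarrow> pexp (\<lambda>x e. of_bool (\<not> P x e))"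
  by (rule pexp_cong[OF pexp_diff[OF pexp_const[of 1]]]) auto

lemma pexp_disj: "pexp (\<lambda>x e. of_bool (P x e)) \<Longrightarrow> pexp (\<lambda>x e. of_bool (Q x e)) \<Longrightarrow>
  pexp (\<lambda>x e. of_bool (P x e \<or> Q x e))"
  by (rule pexp_cong[OF pexp_not[OF pexp_conj[OF pexp_not pexp_not]]]) auto

lemma pexp_imp: "pexp (\<lambda>x e. of_bool (P x e)) \<Longrightarrow> pexp (\<lambda>x e. of_bool (Q x e)) \<Longrightarrow>
  pexp (\<lambda>x e. of_bool (P x e \<longrightarrow> Q x e))"
  by (rule pexp_cong[OF pexp_disj[OF pexp_not]]) auto

lemma pexp_eq: "pexp f \<Longrightarrow> pexp g \<Longrightarrow> pexp (\<lambda>x e. of_bool (f x e = g x e))"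
  by (rule pexp_cong[OF pexp_conj[OF pexp_le pexp_le]], assumption+) auto

lemma pexp_if: "pexp (\<lambda>x e. of_bool (P x e)) \<Longrightarrow> pexp f \<Longrightarrow> pexp g \<Longrightarrow>
  pexp (\<lambda>x e. if P x e then f x e else g x e)"
  by (rule pexp_cong[OF pexp_add[OF pexp_mult[OF _ _] pexp_mult[OF pexp_not]]], assumption+) auto

lemma pexp_ex:
  assumes "pexp g" "pexp (\<lambda>x e. of_bool (P x (tl e) (hd0 e)))"
  shows "pexp (\<lambda>x e. of_bool (\<exists>i<g x e. P x e i))"
proof (rule pexp_cong)
  show "pexp (\<lambda>x e. of_bool (0 < (\<Sum>i<g x e. of_bool (P x e i) :: nat)))"
    by (intro pexp_less pexp_const pexp_sum assms)
  show "of_bool (\<exists>i<g x e. P x e i) = of_bool (0 < (\<Sum>i<g x e. of_bool (P x e i) :: nat))" for x e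
    by (simp add: zero_less_iff_neq_zero) blast
qed

lemma pexp_all:
  assumes "pexp g" "pexp (\<lambda>x e. of_bool (P x (tl e) (hd0 e)))"
  shows "pexp (\<lambda>x e. of_bool (\<forall>i<g x e. P x e i))"
  by (rule pexp_cong[OF pexp_not[OF pexp_ex[OF assms(1) pexp_not[OF assms(2)]]]]) simp

text \<open>The quotient counts the positive multiples of \<open>b\<close> up to \<open>a\<close>,
  which turns division into a bounded sum.\<close>

lemma div_eq_sum: "(a :: nat) div b = (if b = 0 then 0 else (\<Sum>i<a. of_bool (Suc i * b \<le> a)))"
proof (cases "b = 0")
  case False
  then have "Suc i * b \<le> a \<longleftrightarrow> i < a div b" for i
    using less_eq_div_iff_mult_less_eq[of b "Suc i" a] by (simp add: Suc_le_eq)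
  then have "(\<Sum>i<a. of_bool (Suc i * b \<le> a)) = (\<Sum>i<a. of_bool (i < a div b) :: nat)"
    by simp
  also have "\<dots> = card ({..<a} \<inter> {i. i < a div b})"
    by (simp add: of_bool_def sum.If_cases)
  also have "{..<a} \<inter> {i. i < a div b} = {..<a div b}"
    using div_le_dividend[of a b] by (auto intro: less_le_trans)
  finally show ?thesis using False by simp
qed simp

lemma pexp_div:
  assumes "pexp f" "pexp g" shows "pexp (\<lambda>x e. f x e div g x e)"
  unfolding div_eq_sum[of "f _ _"]
  by (intro pexp_if pexp_eq pexp_const pexp_sum pexp_le pexp_mult pexp_Suc pexp_hd pexp_tl assms)

lemma pexp_mod: 
  assumes "pexp f" "pexp g" shows "pexp (\<lambda>x e. f x e mod g x e)"
  unfolding modulo_nat_def by (intro pexp_diff pexp_mult pexp_div assms)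

lemma pexp_power: "pexp f \<Longrightarrow> pexp (\<lambda>x e. f x e ^ k)"
  by (induction k) (auto intro: pexp_mult pexp_const[of 1, simplified])

lemma pexp_poly: "pexp f \<Longrightarrow> pexp (\<lambda>x e. poly p (f x e))"
  by (induction p) (auto intro: pexp_const[of 0] pexp_add pexp_mult pexp_const)

text \<open>\<open>d\<close> is a constant, so any function below \<open>d\<close> can be written
  out as a finite sum; this is how transition functions enter expressions.\<close>

lemma pexp_table:
  assumes "pexp f" shows "pexp (\<lambda>x e. if f x e < d then F (f x e) else 0)"
proof (rule pexp_cong)
  show "pexp (\<lambda>x e. \<Sum>i<d. of_bool (f x e = i) * F i)"
    for d
  proof (induction d)
    case 0
    show ?case using pexp_const[of 0] by simp
  next
    case (Suc d)
    then show ?case by (auto intro!: pexp_add pexp_mult pexp_eq pexp_const assms)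
  qed
  show "(if f x e < d then F (f x e) else 0) = (\<Sum>i<d. of_bool (f x e = i) * F i)" for x e
    by (simp add: of_bool_def if_distrib[of "\<lambda>c. c * _"] sum.delta' cong: if_cong)
qed

lemma pexp_comp1: "pexp (\<lambda>x e. h x (hd0 e)) \<Longrightarrow> pexp a \<Longrightarrow> pexp (\<lambda>x e. h x (a x e))"
  using pexp_let[of a "\<lambda>x e. h x"] by simp

lemma pexp_vars:
  "pexp (\<lambda>x e. hd0 (tl e))" "pexp (\<lambda>x e. hd0 (tl (tl e)))" "pexp (\<lambda>x e. hd0 (tl (tl (tl e))))"
  "pexp (\<lambda>x e. hd0 (tl (tl (tl (tl e)))))" "pexp (\<lambda>x e. hd0 (tl (tl (tl (tl (tl e))))))"
  "pexp (\<lambda>x e. hd0 (tl (tl (tl (tl (tl (tl e)))))))" "pexp (\<lambda>x e. hd0 (tl (tl (tl (tl (tl (tl (tl e))))))))"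
  by (rule pexp_tl pexp_hd)+

lemmas pexp_intros = pexp_hd pexp_vars pexp_const pexp_add pexp_mult pexp_diff pexp_sum pexp_length
  pexp_bit_at pexp_Suc pexp_le pexp_less pexp_conj pexp_not pexp_disj pexp_imp pexp_eq pexp_if pexp_ex
  pexp_all pexp_div pexp_mod pexp_power pexp_poly

subsection \<open>Outputs of the edge deletion heuristic as perfectly matched covers\<close>

definition cover :: "'a set \<Rightarrow> ('a \<Rightarrow> 'a \<Rightarrow> bool) \<Rightarrow> 'a set \<Rightarrow> bool" where
  "cover V adj C \<longleftrightarrow> C \<subseteq> V \<and> (\<forall>u \<in> V. \<forall>w \<in> V. adj u w \<longrightarrow> u \<in> C \<or> w \<in> C)"

text \<open>A perfect matching inside \<open>C\<close>, coded as the involution that exchanges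
  partners.\<close>

definition pmatch :: "('a \<Rightarrow> 'a \<Rightarrow> bool) \<Rightarrow> 'a set \<Rightarrow> ('a \<Rightarrow> 'a) \<Rightarrow> bool" where
  "pmatch adj C f \<longleftrightarrow> (\<forall>u \<in> C. f u \<in> C \<and> f (f u) = u \<and> adj u (f u))"

definition indep :: "nat \<Rightarrow> (nat \<Rightarrow> nat \<Rightarrow> bool) \<Rightarrow> nat set \<Rightarrow> bool" where
  "indep n adj I \<longleftrightarrow> I \<subseteq> {..<n} \<and> (\<forall>u \<in> I. \<forall>w \<in> I. \<not> adj u w)"

definition simple_adj :: "('a \<Rightarrow> 'a \<Rightarrow> bool) \<Rightarrow> bool" where
  "simple_adj adj \<longleftrightarrow> (\<forall>u w. adj u w \<longrightarrow> adj w u) \<and> (\<forall>u. \<not> adj u u)"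

definition graph_of :: "nat \<Rightarrow> (nat \<Rightarrow> nat \<Rightarrow> bool) \<Rightarrow> nat graph" where
  "graph_of n adj = ({0..<n}, {{u, w} | u w. u < n \<and> w < n \<and> adj u w})"

lemma ed_steps_invariant:
  assumes "ed_step\<^sup>*\<^sup>* ((V, E), {}) s" "\<forall>e \<in> E. card e = 2"
  shows "\<exists>f. finite (snd s) \<and> (\<forall>u \<in> snd s. f u \<in> snd s \<and> f (f u) = u \<and> {u, f u} \<in> E) \<and>
    snd (fst s) = {e \<in> E. e \<inter> snd s = {}}"
  using assms(1)
proof (induction rule: rtranclp_induct)
  case base
  then show ?case by auto
next
  case (step s t)
  then obtain f where f: "finite (snd s)" "\<forall>u \<in> snd s. f u \<in> snd s \<and> f (f u) = u \<and> {u, f u} \<in> E"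
    "snd (fst s) = {e \<in> E. e \<inter> snd s = {}}"
    by blast
  from step.hyps(2) show ?case
  proof (cases rule: ed_step.cases)
    case (1 u v E' V' C)
    then have uv: "{u, v} \<in> E" "u \<notin> C" "v \<notin> C" "u \<noteq> v"
      using f assms(2) by (auto simp: card_insert_if)
    \<comment> \<open>The chosen edge avoids \<open>C\<close>, so making its ends partners leaves
      the older pairs intact.\<close>
    then show ?thesis
      using 1 f by (intro exI[of _ "f(u := v, v := u)"]) (auto simp: insert_commute[of u v])
  qed
qed

text \<open>The pairs are disjoint, so the matching edges can be chosen one after the other: no
  choice deletes another matching edge.\<close>

lemma ed_steps_matching:
  assumes "finite D" "\<forall>u \<in> D. f u \<in> D \<and> f (f u) = u \<and> {u, f u} \<in> E"
  shows "ed_step\<^sup>*\<^sup>* ((V, E), {}) ((V - D, {e \<in> E. e \<inter> D = {}}), D)"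
  using assms
proof (induction D rule: finite_psubset_induct)
  case (psubset D)
  show ?case
  proof (cases "D = {}")
    case False
    then obtain u where u: "u \<in> D" by auto
    let ?D = "D - {u, f u}"
    have "\<forall>w \<in> ?D. f w \<in> ?D \<and> f (f w) = w \<and> {w, f w} \<in> E"
      using psubset.prems u by (metis Diff_iff insert_iff empty_iff)
    moreover have "?D \<subset> D" using u by auto
    ultimately have "ed_step\<^sup>*\<^sup>* ((V, E), {}) ((V - ?D, {e \<in> E. e \<inter> ?D = {}}), ?D)"
      using psubset.IH[of ?D] by blast
    moreover have "ed_step ((V - ?D, {e \<in> E. e \<inter> ?D = {}}), ?D)
       ((V - ?D - {u, f u}, {e \<in> {e \<in> E. e \<inter> ?D = {}}. e \<inter> {u, f u} = {}}), ?D \<union> {u, f u})"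
      using psubset.prems u by (intro ed_step.intros) auto
    moreover have "V - ?D - {u, f u} = V - D" "?D \<union> {u, f u} = D"
      "{e \<in> {e \<in> E. e \<inter> ?D = {}}. e \<inter> {u, f u} = {}} = {e \<in> E. e \<inter> D = {}}"
      using u psubset.prems by auto
    ultimately show ?thesis
      by (metis (no_types, lifting) rtranclp.rtrancl_into_rtrancl)
  qed auto
qed

text \<open>An output is the vertex set of a maximal matching, and a matching is maximal exactly if
  its vertices form a cover.\<close>

lemma ed_outputs_iff:
  assumes "\<forall>e \<in> E. card e = 2"
  shows "C \<in> ed_outputs (V, E) \<longleftrightarrow> finite C \<and>
    (\<exists>f. \<forall>u \<in> C. f u \<in> C \<and> f (f u) = u \<and> {u, f u} \<in> E) \<and> (\<forall>e \<in> E. e \<inter> C \<noteq> {})"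
proof
  assume "C \<in> ed_outputs (V, E)"
  then obtain V' where "ed_step\<^sup>*\<^sup>* ((V, E), {}) ((V', {}), C)"
    by (auto simp: ed_outputs_def)
  from ed_steps_invariant[OF this assms]
  show "finite C \<and> (\<exists>f. \<forall>u \<in> C. f u \<in> C \<and> f (f u) = u \<and> {u, f u} \<in> E) \<and> (\<forall>e \<in> E. e \<inter> C \<noteq> {})"
    by auto
next
  assume *: "finite C \<and> (\<exists>f. \<forall>u \<in> C. f u \<in> C \<and> f (f u) = u \<and> {u, f u} \<in> E) \<and> (\<forall>e \<in> E. e \<inter> C \<noteq> {})"
  then obtain f where "\<forall>u \<in> C. f u \<in> C \<and> f (f u) = u \<and> {u, f u} \<in> E" by blast
  with * have "ed_step\<^sup>*\<^sup>* ((V, E), {}) ((V - C, {e \<in> E. e \<inter> C = {}}), C)"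
    by (intro ed_steps_matching[of _ f]) auto
  moreover have "{e \<in> E. e \<inter> C = {}} = {}" using * by auto
  ultimately show "C \<in> ed_outputs (V, E)"
    unfolding ed_outputs_def by auto
qed

text \<open>Each step loses the chosen edge. The purpose is that the \<open>LEAST\<close> in
  \<open>min_ed\<close> ranges over a nonempty set.\<close>

lemma ed_terminates:
  assumes "finite E" "\<forall>e \<in> E. card e = 2"
  shows "\<exists>V' C'. ed_step\<^sup>*\<^sup>* ((V, E), C) ((V', {}), C')"
  using assms
proof (induction E arbitrary: V C rule: finite_psubset_induct)
  case (psubset E)
  show ?case
  proof (cases "E = {}")
    case False
    then obtain e where "e \<in> E" by auto
    moreover from this obtain u v where "e = {u, v}"
      using psubset.prems by (auto simp: card_2_iff)
    ultimately have uv: "{u, v} \<in> E" by simp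
    let ?E = "{e \<in> E. e \<inter> {u, v} = {}}"
    have "?E \<subseteq> E" by (rule Collect_restrict)
    moreover have "{u, v} \<notin> ?E" by simp
    ultimately have "?E \<subset> E" using uv by (metis psubsetI)
    moreover have "\<forall>e \<in> ?E. card e = 2" using psubset.prems by simp
    ultimately have "\<exists>V' C'. ed_step\<^sup>*\<^sup>* ((V - {u, v}, ?E), C \<union> {u, v}) ((V', {}), C')"
      by (rule psubset.IH)
    then obtain V' C' where r: "ed_step\<^sup>*\<^sup>* ((V - {u, v}, ?E), C \<union> {u, v}) ((V', {}), C')" by blast
    have "ed_step\<^sup>*\<^sup>* ((V, E), C) ((V', {}), C')"
      by (rule converse_rtranclp_into_rtranclp[of ed_step, OF ed_step.intros[OF uv] r])
    then show ?thesis by blast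
  qed auto
qed

lemma Least_card_le_iff:
  fixes S :: "'a set set"
  assumes "S \<noteq> {}"
  shows "(LEAST k. \<exists>C \<in> S. card C = k) \<le> m \<longleftrightarrow> (\<exists>C \<in> S. card C \<le> m)"
proof
  assume "(LEAST k. \<exists>C \<in> S. card C = k) \<le> m"
  moreover have "\<exists>C \<in> S. card C = (LEAST k. \<exists>C \<in> S. card C = k)"
    by (rule LeastI_ex) (use assms in auto)
  ultimately show "\<exists>C \<in> S. card C \<le> m" by metis
next
  assume "\<exists>C \<in> S. card C \<le> m"
  then obtain C where "C \<in> S" "card C \<le> m" by auto
  moreover have "(LEAST k. \<exists>C \<in> S. card C = k) \<le> card C"
    by (rule Least_le) (use \<open>C \<in> S\<close> in auto)
  ultimately show "(LEAST k. \<exists>C \<in> S. card C = k) \<le> m" by simp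
qed

lemma graph_of_edge: "simple_adj adj \<Longrightarrow> {u, w} \<in> snd (graph_of n adj) \<longleftrightarrow> u < n \<and> w < n \<and> adj u w"
  unfolding graph_of_def simple_adj_def by (auto simp: doubleton_eq_iff)

lemma graph_of_card_edge: "simple_adj adj \<Longrightarrow> e \<in> snd (graph_of n adj) \<Longrightarrow> card e = 2"
  unfolding graph_of_def simple_adj_def by (auto simp: card_insert_if)

lemma mvc_le_iff:
  assumes "simple_adj adj"
  shows "mvc (graph_of n adj) \<le> k \<longleftrightarrow> (\<exists>C. cover {..<n} adj C \<and> card C \<le> k)"
proof -
  have eq: "vertex_cover (graph_of n adj) C \<longleftrightarrow> cover {..<n} adj C" for C
    using graph_of_edge[OF assms, of _ _ n]
    by (auto simp: vertex_cover_def cover_def graph_of_def)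
  have "cover {..<n} adj {..<n}" by (auto simp: cover_def)
  then show ?thesis
    using Least_card_le_iff[of "{C. cover {..<n} adj C}" k] unfolding mvc_def eq by auto
qed

lemma min_ed_le_iff:
  assumes "simple_adj adj"
  shows "min_ed (graph_of n adj) \<le> k \<longleftrightarrow>
    (\<exists>C f. cover {..<n} adj C \<and> pmatch adj C f \<and> card C \<le> k)"
proof -
  obtain V E where G: "graph_of n adj = (V, E)" by (cases "graph_of n adj")
  have E2: "\<forall>e \<in> E. card e = 2" using graph_of_card_edge[OF assms, of _ n] G by auto
  have edge: "{u, w} \<in> E \<longleftrightarrow> u < n \<and> w < n \<and> adj u w" for u w
    using graph_of_edge[OF assms, of u w n] G by simp
  have E: "E = {{u, w} | u w. u < n \<and> w < n \<and> adj u w}"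
    using G by (simp add: graph_of_def)
  have "finite E"
    by (rule finite_subset[of _ "Pow {..<n}"]) (auto simp: E)
  then have "ed_outputs (graph_of n adj) \<noteq> {}"
    using ed_terminates[OF _ E2, of V "{}"] unfolding ed_outputs_def G by blast
  then have 1: "min_ed (graph_of n adj) \<le> k \<longleftrightarrow> (\<exists>C \<in> ed_outputs (graph_of n adj). card C \<le> k)"
    unfolding min_ed_def by (rule Least_card_le_iff)
  have meets: "(\<forall>e \<in> E. e \<inter> C \<noteq> {}) \<longleftrightarrow> (\<forall>u \<in> {..<n}. \<forall>w \<in> {..<n}. adj u w \<longrightarrow> u \<in> C \<or> w \<in> C)" for C
  proof -
    have "(\<forall>e \<in> E. e \<inter> C \<noteq> {}) \<longleftrightarrow> (\<forall>u w. u < n \<and> w < n \<and> adj u w \<longrightarrow> {u, w} \<inter> C \<noteq> {})"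
      by (auto simp: E)
    then show ?thesis by auto
  qed
  have 2: "C \<in> ed_outputs (graph_of n adj) \<longleftrightarrow> (\<exists>f. cover {..<n} adj C \<and> pmatch adj C f)" for C
  proof
    assume "C \<in> ed_outputs (graph_of n adj)"
    then obtain f where f: "\<forall>u \<in> C. f u \<in> C \<and> f (f u) = u \<and> {u, f u} \<in> E" and m: "\<forall>e \<in> E. e \<inter> C \<noteq> {}"
      unfolding G ed_outputs_iff[OF E2] by blast
    have "C \<subseteq> {..<n}" using f edge by blast
    then have "cover {..<n} adj C" using m unfolding meets cover_def by blast
    moreover have "pmatch adj C f" using f edge unfolding pmatch_def by blast
    ultimately show "\<exists>f. cover {..<n} adj C \<and> pmatch adj C f" by blast
  next
    assume "\<exists>f. cover {..<n} adj C \<and> pmatch adj C f"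
    then obtain f where f: "cover {..<n} adj C" "pmatch adj C f" by blast
    then have C: "C \<subseteq> {..<n}" by (simp add: cover_def)
    then have "finite C" using finite_subset by blast
    moreover have "\<forall>u \<in> C. f u \<in> C \<and> f (f u) = u \<and> {u, f u} \<in> E"
      using f(2) C unfolding pmatch_def edge by blast
    moreover have "\<forall>e \<in> E. e \<inter> C \<noteq> {}" using f(1) unfolding meets cover_def by blast
    ultimately show "C \<in> ed_outputs (graph_of n adj)" unfolding G ed_outputs_iff[OF E2] by blast
  qed
  show ?thesis unfolding 1 using 2 by blast
qed

text \<open>Remove a vertex together with its partner. This parity is what separates the two cases
  of the reduction.\<close>

lemma even_card_pmatch:
  assumes "finite C" "pmatch adj C f" "\<And>u. \<not> adj u u"
  shows "even (card C)"
  using assms(1,2)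
proof (induction C rule: finite_psubset_induct)
  case (psubset C)
  show ?case
  proof (cases "C = {}")
    case False
    then obtain u where u: "u \<in> C" by auto
    let ?D = "C - {u, f u}"
    have fu: "f u \<in> C" "u \<noteq> f u"
      using u psubset.prems assms(3) unfolding pmatch_def by (metis, metis)
    have "pmatch adj ?D f"
      using psubset.prems u unfolding pmatch_def by (metis Diff_iff insert_iff empty_iff)
    moreover have "?D \<subset> C" using u by auto
    ultimately have "even (card ?D)" using psubset.IH by blast
    moreover have "card C = card ?D + 2"
      using psubset.hyps u fu card_Diff_subset[of "{u, f u}" C] card_mono[of C "{u, f u}"] by auto
    ultimately show ?thesis by simp
  qed auto
qed

lemma pmatch_union:
  assumes "pmatch adj A f" "pmatch adj B g" "A \<inter> B = {}"
  shows "pmatch adj (A \<union> B) (\<lambda>u. if u \<in> A then f u else g u)"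
  using assms unfolding pmatch_def by (auto simp: disjoint_iff)

lemma pmatch_bij:
  assumes "bij_betw h A B" "A \<inter> B = {}" "\<And>u. u \<in> A \<Longrightarrow> adj u (h u) \<and> adj (h u) u"
  shows "\<exists>f. pmatch adj (A \<union> B) f"
proof
  show "pmatch adj (A \<union> B) (\<lambda>u. if u \<in> A then h u else inv_into A h u)"
    using assms unfolding pmatch_def bij_betw_def by (auto simp: disjoint_iff inv_into_into f_inv_into_f)
qed

lemma pmatch_clique:
  assumes "finite Q" "even (card Q)" "\<And>u v. u \<in> Q \<Longrightarrow> v \<in> Q \<Longrightarrow> u \<noteq> v \<Longrightarrow> adj u v"
  shows "\<exists>f. pmatch adj Q f"
proof -
  obtain k where k: "card Q = k + k" using assms(2) by (metis evenE mult_2)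
  obtain A where A: "A \<subseteq> Q" "card A = k" using obtain_subset_with_card_n[of k Q] k by auto
  have fin: "finite A" "finite (Q - A)" using A assms(1) finite_subset by auto
  have "card (Q - A) = k" using A k card_Diff_subset[OF fin(1) A(1)] by simp
  then obtain h where h: "bij_betw h A (Q - A)"
    using finite_same_card_bij[OF fin] A by auto
  have "\<exists>f. pmatch adj (A \<union> (Q - A)) f"
  proof (rule pmatch_bij[OF h])
    fix u assume "u \<in> A"
    then have u: "h u \<in> Q" "h u \<notin> A" "u \<in> Q" using h A(1) by (auto dest: bij_betwE)
    moreover have "u \<noteq> h u" using u(2) \<open>u \<in> A\<close> by metis
    ultimately show "adj u (h u) \<and> adj (h u) u" using assms(3)[of u "h u"] assms(3)[of "h u" u] by simp
  qed auto
  then show ?thesis using A(1) by (simp add: Un_absorb1)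
qed

text \<open>Besides the two given graphs there are a clique \<open>{2 * N..4 * N}\<close>, joined to both, and a vertex \<open>4 * N + 1\<close>,
  joined to the first only. The independence number is the maximum of that of the first graph and one more than
  that of the second.\<close>

definition kadj :: "nat \<Rightarrow> (nat \<Rightarrow> nat \<Rightarrow> bool) \<Rightarrow> (nat \<Rightarrow> nat \<Rightarrow> bool) \<Rightarrow> nat \<Rightarrow> nat \<Rightarrow> bool" where
  "kadj N adj1 adj2 v w = (if v < N \<and> w < N then adj1 v w else if v < N \<or> w < N then True
     else if v < 2 * N \<and> w < 2 * N then adj2 (v - N) (w - N)
     else v \<noteq> w \<and> v < 4 * N + 1 \<and> w < 4 * N + 1)"

lemma simple_kadj: "simple_adj adj1 \<Longrightarrow> simple_adj adj2 \<Longrightarrow> simple_adj (kadj N adj1 adj2)"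
  unfolding simple_adj_def kadj_def by auto

text \<open>The complement of a cover is independent. If it meets the first graph it lies inside it,
  since the first graph is joined to everything else. If it contains a clique vertex, only
  \<open>4 * N + 1\<close> can be added, and \<open>1 \<le> b\<close> pays for these two. Otherwise
  it is an independent set of the second graph, possibly with \<open>4 * N + 1\<close>.\<close>

lemma kadj_cover_ge:
  assumes "\<And>I. indep N adj1 I \<Longrightarrow> card I \<le> a" "\<And>I. indep N adj2 I \<Longrightarrow> card I \<le> b" "1 \<le> b"
    and C: "cover {..<4 * N + 2} (kadj N adj1 adj2) C"
  shows "4 * N + 2 \<le> card C + max a (b + 1)"
proof -
  define I where "I = {..<4 * N + 2} - C"
  have I: "I \<subseteq> {..<4 * N + 2}" "\<And>u w. u \<in> I \<Longrightarrow> w \<in> I \<Longrightarrow> \<not> kadj N adj1 adj2 u w"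
    using C unfolding I_def cover_def by auto
  have fin: "finite I" unfolding I_def by simp
  have "card I = 4 * N + 2 - card C"
    unfolding I_def using C card_Diff_subset[of C "{..<4 * N + 2}"] finite_subset[of C "{..<4 * N + 2}"]
    by (simp add: cover_def)
  moreover have "card I \<le> max a (b + 1)"
  proof (cases "\<exists>u \<in> I. u < N")
    case True
    then obtain u where u: "u \<in> I" "u < N" by auto
    have "w < N" if "w \<in> I" for w
      using I(2)[OF u(1) that] u(2) by (auto simp: kadj_def split: if_splits)
    then have "I \<subseteq> {..<N}" by blast
    moreover have "\<not> adj1 v w" if "v \<in> I" "w \<in> I" for v w
      using I(2)[OF that] subsetD[OF calculation that(1)] subsetD[OF calculation that(2)] by (simp add: kadj_def)
    ultimately have "indep N adj1 I" by (simp add: indep_def)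
    then show ?thesis using assms(1) by fastforce
  next
    case noG1: False
    show ?thesis
    proof (cases "\<exists>u \<in> I. 2 * N \<le> u \<and> u < 4 * N + 1")
      case True
      then obtain u where u: "u \<in> I" "2 * N \<le> u" "u < 4 * N + 1" by auto
      have "w = u \<or> w = 4 * N + 1" if "w \<in> I" for w
        using I(2)[OF u(1) that] that I(1) u noG1 by (auto simp: kadj_def split: if_splits)
      then have "I \<subseteq> {u, 4 * N + 1}" by auto
      then have "card I \<le> card {u, 4 * N + 1}" by (intro card_mono) auto
      then have "card I \<le> 2" by (auto simp: card_insert_if split: if_splits)
      then show ?thesis using assms(3) by simp
    next
      case False
      let ?J = "(\<lambda>v. v - N) ` (I - {4 * N + 1})"
      have sub: "I - {4 * N + 1} \<subseteq> {N..<2 * N}"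
        using I(1) noG1 False by force
      have "indep N adj2 ?J"
      proof -
        have "\<not> adj2 (u - N) (w - N)" if "u \<in> I - {4 * N + 1}" "w \<in> I - {4 * N + 1}" for u w
        proof -
          have "N \<le> u" "u < 2 * N" "N \<le> w" "w < 2 * N" using sub that by (meson atLeastLessThan_iff subsetD)+
          then show ?thesis using I(2)[of u w] that by (auto simp: kadj_def split: if_splits)
        qed
        moreover have "?J \<subseteq> {..<N}" using sub by force
        ultimately show ?thesis unfolding indep_def by blast
      qed
      then have "card ?J \<le> b" by (rule assms(2))
      moreover have "card ?J = card (I - {4 * N + 1})"
      proof (rule card_image)
        show "inj_on (\<lambda>v. v - N) (I - {4 * N + 1})"
          using sub by (metis (no_types, lifting) inj_on_diff_nat atLeastLessThan_iff subsetD)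
      qed
      moreover have "card I \<le> card (I - {4 * N + 1}) + 1"
        by (metis Suc_eq_plus1 card_Suc_Diff1 diff_le_self card_Diff_insert Diff_insert0 Diff_empty fin le_SucI order_refl)
      ultimately show ?thesis by simp
    qed
  qed
  ultimately show ?thesis by linarith
qed

lemma cover_complement:
  assumes "simple_adj adj" "indep n adj I"
  shows "cover {..<n} adj ({..<n} - I)" "card ({..<n} - I) + card I = n"
proof -
  show "cover {..<n} adj ({..<n} - I)"
    using assms unfolding cover_def indep_def by auto
  have "I \<subseteq> {..<n}" using assms(2) by (auto simp: indep_def)
  then show "card ({..<n} - I) + card I = n"
    using card_Diff_subset[of I "{..<n}"] card_mono[of "{..<n}" I] finite_subset[of I "{..<n}"] by simp
qed

lemma kadj_cover_second:
  assumes "simple_adj adj1" "simple_adj adj2" "indep N adj2 I"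
  shows "\<exists>C. cover {..<4 * N + 2} (kadj N adj1 adj2) C \<and> card C + (card I + 1) = 4 * N + 2"
proof -
  \<comment> \<open>\<open>4 * N + 1\<close> has no neighbour in the second graph; it makes the size
    odd when \<open>card I\<close> is even.\<close>
  let ?J = "insert (4 * N + 1) ((\<lambda>v. v + N) ` I)"
  have "finite I" "I \<subseteq> {..<N}" using assms(3) finite_subset[of I "{..<N}"] by (auto simp: indep_def)
  then have "card ?J = card I + 1" by (subst card_insert_disjoint) (auto simp: card_image)
  moreover have "indep (4 * N + 2) (kadj N adj1 adj2) ?J"
    using assms(3) \<open>I \<subseteq> {..<N}\<close> by (fastforce simp: indep_def kadj_def)
  ultimately show ?thesis
    using cover_complement[OF simple_kadj[OF assms(1,2)], of "4 * N + 2" N ?J] by metis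
qed

text \<open>Vertex \<open>4 * N + 1\<close> is matched to some \<open>u0\<close> of the first graph
  outside \<open>I\<close>, every other remaining vertex of the two graphs to a clique vertex of its
  own, and the \<open>card I + 2\<close> clique vertices left over, an even number, among
  themselves.\<close>

lemma kadj_pmatch_first:
  assumes s: "simple_adj adj1" "simple_adj adj2" and I: "indep N adj1 I" "even (card I)" "card I < N"
  shows "\<exists>C f. cover {..<4 * N + 2} (kadj N adj1 adj2) C \<and> pmatch (kadj N adj1 adj2) C f \<and>
    card C + card I = 4 * N + 2"
proof -
  let ?adj = "kadj N adj1 adj2"
  let ?C = "{..<4 * N + 2} - I"
  have IN: "I \<subseteq> {..<N}" "finite I" using I(1) finite_subset[of I "{..<N}"] by (auto simp: indep_def)
  then obtain u0 where u0: "u0 < N" "u0 \<notin> I"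
    using I(3) by (metis card_lessThan lessThan_iff subset_antisym subset_iff nat_neq_iff)
  define A where "A = {..<2 * N} - insert u0 I"
  define m where "m = 2 * N - (card I + 1)"
  have "card (insert u0 I) = card I + 1" using u0 IN by simp
  moreover have "insert u0 I \<subseteq> {..<2 * N}" using u0 IN by auto
  ultimately have A: "finite A" "card A = m"
    unfolding A_def m_def using card_Diff_subset[of "insert u0 I" "{..<2 * N}"] IN by auto
  have m: "m + card I + 1 = 2 * N" using I(3) unfolding m_def by simp
  then have ev: "even (2 * N + 1 - m)" using I(2) by presburger
  let ?Q1 = "{2 * N..<2 * N + m}" and ?Q2 = "{2 * N + m..<4 * N + 1}"
  obtain h where h: "bij_betw h A ?Q1" using finite_same_card_bij[of A ?Q1] A by auto
  have hQ: "u \<in> A \<Longrightarrow> h u \<in> ?Q1" for u using h bij_betwE by blast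
  have "\<exists>f. pmatch ?adj (A \<union> ?Q1) f"
  proof (rule pmatch_bij[OF h])
    fix u assume "u \<in> A"
    then show "?adj u (h u) \<and> ?adj (h u) u"
      using hQ[of u] m by (auto simp: A_def kadj_def)
  qed (auto simp: A_def)
  moreover have "\<exists>f. pmatch ?adj ?Q2 f"
    using ev by (intro pmatch_clique) (auto simp: kadj_def)
  ultimately obtain f g where "pmatch ?adj (A \<union> ?Q1) f" "pmatch ?adj ?Q2 g" by blast
  then have "\<exists>f. pmatch ?adj (A \<union> ?Q1 \<union> ?Q2) f"
    by (intro exI, rule pmatch_union) (auto simp: A_def)
  then obtain f where f: "pmatch ?adj (A \<union> ?Q1 \<union> ?Q2) f" by blast
  have g: "pmatch ?adj {u0, 4 * N + 1} (\<lambda>u. if u = u0 then 4 * N + 1 else u0)"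
    using u0 by (auto simp: pmatch_def kadj_def)
  have "(A \<union> ?Q1 \<union> ?Q2) \<inter> {u0, 4 * N + 1} = {}" using u0 m by (auto simp: A_def)
  from pmatch_union[OF f g this] have "\<exists>f. pmatch ?adj (A \<union> ?Q1 \<union> ?Q2 \<union> {u0, 4 * N + 1}) f" by blast
  moreover have "A \<union> ?Q1 \<union> ?Q2 \<union> {u0, 4 * N + 1} = ?C"
    using u0 IN m by (auto simp: A_def)
  moreover have "indep (4 * N + 2) ?adj I"
    using I(1) IN by (auto simp: indep_def kadj_def subset_iff)
  ultimately show ?thesis
    using cover_complement[OF simple_kadj[OF s], of "4 * N + 2" N I] by metis
qed

subsection \<open>Balancing the ratio\<close>

text \<open>A vertex of the disjoint union is \<open>\<sigma> * n + v\<close> with \<open>v < n\<close>. The layers \<open>\<sigma>\<close> with \<open>fbase\<close> carry a copy of the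
  given graph, and \<open>flink\<close> joins each vertex of layer \<open>\<sigma>\<close> to its counterpart in layer \<open>\<sigma> + 1\<close>. So the first
  \<open>4 * Y\<close> layers form \<open>Y\<close> copies with paths attached, the next \<open>2 * Z\<close> isolated edges, the rest plain copies.\<close>

definition fbase :: "nat \<Rightarrow> nat \<Rightarrow> nat \<Rightarrow> bool" where
  "fbase Y Z \<sigma> \<longleftrightarrow> \<sigma> < 4 * Y \<and> \<sigma> mod 4 = 0 \<or> 4 * Y + 2 * Z \<le> \<sigma>"

definition flink :: "nat \<Rightarrow> nat \<Rightarrow> nat \<Rightarrow> bool" where
  "flink Y Z \<sigma> \<longleftrightarrow> \<sigma> < 4 * Y \<and> \<sigma> mod 4 \<noteq> 3 \<or> 4 * Y \<le> \<sigma> \<and> \<sigma> < 4 * Y + 2 * Z \<and> \<sigma> mod 2 = 0"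

text \<open>Used to see that the vertices of a group of four layers are matched among themselves and
  hence even in number.\<close>

lemma flink_same_group:
  assumes "flink Y Z \<sigma>" "\<sigma> div 4 < Y \<or> Suc \<sigma> div 4 < Y"
  shows "Suc \<sigma> div 4 = \<sigma> div 4"
proof -
  have "\<sigma> < 4 * Y" using assms(2) by (auto simp: div_less_iff_less_mult)
  then show ?thesis using assms(1) by (auto simp: flink_def div_Suc mod_Suc split: if_splits)
qed

lemma not_flink_pred:
  assumes "4 * Y + 2 * c = Suc \<tau>"
  shows "\<not> flink Y Z \<tau>"
proof -
  have "\<tau> mod 2 = 1" using assms by presburger
  moreover have "\<tau> mod 4 = 3" if "\<tau> < 4 * Y"
  proof -
    have "4 * Y = Suc \<tau>" using assms that by linarith
    then show ?thesis by presburger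
  qed
  ultimately show ?thesis by (auto simp: flink_def)
qed

lemma flink_Suc_less:
  assumes "flink Y Z \<sigma>"
  shows "Suc \<sigma> < 4 * Y + 2 * Z"
proof (rule ccontr)
  assume "\<not> Suc \<sigma> < 4 * Y + 2 * Z"
  moreover have "\<sigma> < 4 * Y + 2 * Z" using assms by (auto simp: flink_def)
  ultimately have "4 * Y + 2 * Z = Suc \<sigma>" by linarith
  then show False using not_flink_pred assms by blast
qed

definition fadj :: "nat \<Rightarrow> nat \<Rightarrow> nat \<Rightarrow> (nat \<Rightarrow> nat \<Rightarrow> bool) \<Rightarrow> nat \<Rightarrow> nat \<Rightarrow> bool" where
  "fadj Y Z n adj w w' \<longleftrightarrow>
     (w div n = w' div n \<and> fbase Y Z (w div n) \<and> adj (w mod n) (w' mod n)) \<or>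
     (w mod n = w' mod n \<and> (w' div n = Suc (w div n) \<and> flink Y Z (w div n) \<or>
        w div n = Suc (w' div n) \<and> flink Y Z (w' div n)))"

lemma simple_fadj: "simple_adj adj \<Longrightarrow> simple_adj (fadj Y Z n adj)"
  unfolding simple_adj_def fadj_def by fastforce

definition slice :: "nat \<Rightarrow> nat set \<Rightarrow> nat \<Rightarrow> nat set" where
  "slice n C \<sigma> = {v. v < n \<and> \<sigma> * n + v \<in> C}"

lemma finite_slice [simp]: "finite (slice n C \<sigma>)"
  by (simp add: slice_def)

lemma card_slice: "card (slice n C \<sigma>) = (\<Sum>v<n. of_bool (v \<in> slice n C \<sigma>))"
proof -
  have "(\<Sum>v<n. of_bool (v \<in> slice n C \<sigma>)) = card ({..<n} \<inter> {v. v \<in> slice n C \<sigma>})"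
    by (simp add: of_bool_def sum.If_cases)
  also have "{..<n} \<inter> {v. v \<in> slice n C \<sigma>} = slice n C \<sigma>" by (auto simp: slice_def)
  finally show ?thesis by simp
qed

lemma card_eq_sum_slices:
  assumes "C \<subseteq> {..<S * n}" "0 < n"
  shows "card C = (\<Sum>\<sigma><S. card (slice n C \<sigma>))"
proof -
  have "bij_betw (\<lambda>w. (w div n, w mod n)) C (SIGMA \<sigma>:{..<S}. slice n C \<sigma>)"
  proof (rule bij_betw_byWitness[where f' = "\<lambda>(\<sigma>, v). \<sigma> * n + v"])
    show "(\<lambda>w. (w div n, w mod n)) ` C \<subseteq> (SIGMA \<sigma>:{..<S}. slice n C \<sigma>)"
      using assms by (auto simp: slice_def less_mult_imp_div_less)
    show "(\<lambda>(\<sigma>, v). \<sigma> * n + v) ` (SIGMA \<sigma>:{..<S}. slice n C \<sigma>) \<subseteq> C"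
      by (auto simp: slice_def)
  qed (auto simp: slice_def assms(2))
  then have "card C = card (SIGMA \<sigma>:{..<S}. slice n C \<sigma>)"
    by (rule bij_betw_same_card)
  then show ?thesis by simp
qed

lemma sum_groups:
  fixes f :: "nat \<Rightarrow> nat"
  shows "(\<Sum>\<sigma><4 * Y + 2 * Z + X. f \<sigma>) =
    (\<Sum>c<Y. f (4 * c) + f (4 * c + 1) + f (4 * c + 2) + f (4 * c + 3)) +
    (\<Sum>c<Z. f (4 * Y + 2 * c) + f (4 * Y + 2 * c + 1)) + (\<Sum>c<X. f (4 * Y + 2 * Z + c))"
proof (induction X)
  case 0
  show ?case
  proof (induction Z)
    case 0
    show ?case by (induction Y) (simp_all add: eval_nat_numeral)
  next
    case (Suc Z)
    then show ?case by (simp add: eval_nat_numeral)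
  qed
next
  case (Suc X)
  then show ?case by simp
qed

locale copies =
  fixes Y Z X n :: nat and adj :: "nat \<Rightarrow> nat \<Rightarrow> bool"
  assumes simple: "simple_adj adj" and n_pos: "0 < n"
begin

abbreviation "S \<equiv> 4 * Y + 2 * Z + X"
abbreviation "AF \<equiv> fadj Y Z n adj"
abbreviation "base \<equiv> fbase Y Z"
abbreviation "link \<equiv> flink Y Z"

lemma index_less: "\<sigma> < S \<Longrightarrow> v < n \<Longrightarrow> \<sigma> * n + v < S * n"
proof -
  assume "\<sigma> < S" "v < n"
  then have "\<sigma> * n + v < Suc \<sigma> * n" by simp
  also have "\<dots> \<le> S * n" using \<open>\<sigma> < S\<close> by (intro mult_le_mono1) simp
  finally show ?thesis .
qed

lemma slice_cover:
  assumes "cover {..<S * n} AF C" "base \<sigma>" "\<sigma> < S"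
  shows "cover {..<n} adj (slice n C \<sigma>)"
proof -
  have "v \<in> slice n C \<sigma> \<or> w \<in> slice n C \<sigma>" if "v < n" "w < n" "adj v w" for v w
  proof -
    have "AF (\<sigma> * n + v) (\<sigma> * n + w)" using assms(2) that by (simp add: fadj_def)
    then show ?thesis
      using assms(1) index_less[OF assms(3)] that unfolding cover_def slice_def by auto
  qed
  then show ?thesis by (auto simp: cover_def slice_def)
qed

lemma slice_link:
  assumes "cover {..<S * n} AF C" "link \<sigma>" "Suc \<sigma> < S" "v < n"
  shows "v \<in> slice n C \<sigma> \<or> v \<in> slice n C (Suc \<sigma>)"
proof -
  have "AF (\<sigma> * n + v) (Suc \<sigma> * n + v)"
    using assms(2,4) div_mult_self1[of n v "Suc \<sigma>"] mod_mult_self3[of "Suc \<sigma>" n v]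
    by (simp add: fadj_def add.commute del: mult_Suc)
  then show ?thesis
    using assms(1,4) index_less[of \<sigma> v] index_less[OF assms(3,4)] assms(3) unfolding cover_def slice_def
    by (simp del: mult_Suc)
qed

lemma card_slice_link:
  assumes "cover {..<S * n} AF C" "link \<sigma>" "Suc \<sigma> < S"
  shows "n \<le> card (slice n C \<sigma>) + card (slice n C (Suc \<sigma>))"
proof -
  have "{..<n} \<subseteq> slice n C \<sigma> \<union> slice n C (Suc \<sigma>)" using slice_link[OF assms] by auto
  then have "card {..<n} \<le> card (slice n C \<sigma> \<union> slice n C (Suc \<sigma>))" by (intro card_mono) auto
  also have "\<dots> \<le> card (slice n C \<sigma>) + card (slice n C (Suc \<sigma>))" by (rule card_Un_le)
  finally show ?thesis by simp
qed

text \<open>In a copy with paths, the links from layer 0 to 1 and from layer 2 to 3 are disjoint and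
  force \<open>2 * n\<close> vertices whatever the graph is; an isolated edge forces one. Only the
  plain copies depend on \<open>k\<close>.\<close>

lemma cover_lower:
  assumes C: "cover {..<S * n} AF C" and k: "\<And>D. cover {..<n} adj D \<Longrightarrow> k \<le> card D"
  shows "2 * n * Y + n * Z + k * X \<le> card C"
proof -
  let ?f = "\<lambda>\<sigma>. card (slice n C \<sigma>)"
  have 1: "2 * n \<le> ?f (4 * c) + ?f (4 * c + 1) + ?f (4 * c + 2) + ?f (4 * c + 3)" if "c < Y" for c
  proof -
    have "link (4 * c)" "link (4 * c + 2)" "Suc (4 * c + 2) = 4 * c + 3" using that by (auto simp: flink_def; presburger)+
    then show ?thesis using card_slice_link[OF C, of "4 * c"] card_slice_link[OF C, of "4 * c + 2"] that by (simp add: numeral_3_eq_3)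
  qed
  have 2: "n \<le> ?f (4 * Y + 2 * c) + ?f (4 * Y + 2 * c + 1)" if "c < Z" for c
  proof -
    have "link (4 * Y + 2 * c)" using that by (auto simp: flink_def)
    then show ?thesis using card_slice_link[OF C, of "4 * Y + 2 * c"] that by simp
  qed
  have 3: "k \<le> ?f (4 * Y + 2 * Z + c)" if "c < X" for c
    by (intro k slice_cover[OF C]) (use that in \<open>auto simp: fbase_def\<close>)
  have "card C = (\<Sum>\<sigma><S. ?f \<sigma>)" using C n_pos by (intro card_eq_sum_slices) (auto simp: cover_def)
  moreover have "(\<Sum>c<Y. 2 * n) \<le> (\<Sum>c<Y. ?f (4 * c) + ?f (4 * c + 1) + ?f (4 * c + 2) + ?f (4 * c + 3))"
    using 1 by (intro sum_mono) auto
  moreover have "(\<Sum>c<Z. n) \<le> (\<Sum>c<Z. ?f (4 * Y + 2 * c) + ?f (4 * Y + 2 * c + 1))"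
    using 2 by (intro sum_mono) auto
  moreover have "(\<Sum>c<X. k) \<le> (\<Sum>c<X. ?f (4 * Y + 2 * Z + c))"
    using 3 by (intro sum_mono) auto
  ultimately show ?thesis unfolding sum_groups by (simp add: algebra_simps)
qed

text \<open>Layers without a copy of the graph have no edges inside, so a partner lies in an
  adjacent layer.\<close>

lemma matched_neighbour:
  assumes C: "C \<subseteq> {..<S * n}" "pmatch AF C f" and v: "v \<in> slice n C \<sigma>" and "\<not> base \<sigma>"
  shows "link \<sigma> \<and> v \<in> slice n C (Suc \<sigma>) \<or> (\<exists>\<tau>. \<sigma> = Suc \<tau> \<and> link \<tau> \<and> v \<in> slice n C \<tau>)"
proof -
  let ?w = "\<sigma> * n + v"
  have w: "?w \<in> C" "v < n" using v by (auto simp: slice_def)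
  then have dm: "?w div n = \<sigma>" "?w mod n = v" by auto
  have f: "f ?w \<in> C" "AF ?w (f ?w)" using C(2) w unfolding pmatch_def by auto
  have "f ?w = f ?w div n * n + f ?w mod n" by simp
  then have fw: "f ?w div n * n + f ?w mod n \<in> C" using f(1) by simp
  then have "f ?w mod n \<in> slice n C (f ?w div n)" using w(2) by (auto simp: slice_def)
  then show ?thesis using f(2) assms(4) unfolding fadj_def dm by metis
qed

text \<open>In a copy with paths, layer 0 carries a cover with at least \<open>s - 1\<close>
  vertices and each path adds two more; as the copy is matched within itself and \<open>s\<close> is
  even, parity turns \<open>s - 1\<close> into \<open>s\<close>. The same parity acts in the plain
  copies, and an isolated edge that meets \<open>C\<close> lies in it with both ends.\<close>

lemma pmatch_lower:
  assumes C: "cover {..<S * n} AF C" "pmatch AF C f" and s: "even s" "\<And>D. cover {..<n} adj D \<Longrightarrow> s \<le> card D + 1"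
  shows "(2 * n + s) * Y + 2 * n * Z + s * X \<le> card C"
proof -
  let ?f = "\<lambda>\<sigma>. card (slice n C \<sigma>)"
  have sub: "C \<subseteq> {..<S * n}" and fin: "finite C" using C(1) finite_subset[of C "{..<S * n}"] by (auto simp: cover_def)
  have irr: "\<not> AF u u" for u using simple_fadj[OF simple] by (simp add: simple_adj_def)
  have nbr: "link \<sigma> \<and> v \<in> slice n C (Suc \<sigma>) \<or> (\<exists>\<tau>. \<sigma> = Suc \<tau> \<and> link \<tau> \<and> v \<in> slice n C \<tau>)"
    if "v \<in> slice n C \<sigma>" "\<not> base \<sigma>" for v \<sigma>
    using matched_neighbour[OF sub C(2) that] .
  have 1: "2 * n + s \<le> ?f (4 * c) + ?f (4 * c + 1) + ?f (4 * c + 2) + ?f (4 * c + 3)" if c: "c < Y" for c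
  proof -
    have l: "link (4 * c + 1)" "link (4 * c + 2)" "\<not> base (4 * c + 2)" "base (4 * c)"
      "Suc (4 * c + 1) = 4 * c + 2" "Suc (4 * c + 2) = 4 * c + 3"
      using c by (auto simp: flink_def fbase_def; presburger)+
    \<comment> \<open>A vertex of \<open>C\<close> on layer 2 brings its partner from layer 1 or 3;
      if it is not in \<open>C\<close>, both neighbours are needed to cover its links.\<close>
    have "2 \<le> of_bool (v \<in> slice n C (4 * c + 1)) + of_bool (v \<in> slice n C (4 * c + 2)) +
       (of_bool (v \<in> slice n C (4 * c + 3)) :: nat)" if v: "v < n" for v
    proof (cases "v \<in> slice n C (4 * c + 2)")
      case True
      then have "v \<in> slice n C (4 * c + 3) \<or> v \<in> slice n C (4 * c + 1)"
        using nbr[OF True l(3)] l by (auto simp: numeral_3_eq_3)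
      then show ?thesis using True by auto
    next
      case False
      then have "v \<in> slice n C (4 * c + 1)" "v \<in> slice n C (4 * c + 3)"
        using slice_link[OF C(1) l(1) _ v] slice_link[OF C(1) l(2) _ v] l c by (auto simp: numeral_3_eq_3)
      then show ?thesis by simp
    qed
    then have "(\<Sum>v<n. 2) \<le> (\<Sum>v<n. of_bool (v \<in> slice n C (4 * c + 1)) + of_bool (v \<in> slice n C (4 * c + 2)) +
       (of_bool (v \<in> slice n C (4 * c + 3)) :: nat))" by (intro sum_mono) auto
    then have "2 * n \<le> ?f (4 * c + 1) + ?f (4 * c + 2) + ?f (4 * c + 3)"
      unfolding card_slice by (simp add: sum.distrib)
    moreover have "s \<le> ?f (4 * c) + 1" using c by (intro s(2) slice_cover[OF C(1) l(4)]) auto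
    moreover have "even (?f (4 * c) + ?f (4 * c + 1) + ?f (4 * c + 2) + ?f (4 * c + 3))"
    proof -
      \<comment> \<open>The part of \<open>C\<close> in this copy; no edge leaves the copy, so
        \<open>f\<close> matches it internally.\<close>
      define D where "D = {w \<in> C. w div n div 4 = c}"
      have "w' div n div 4 = c" if "AF w w'" "w div n div 4 = c" for w w'
        using that c flink_same_group[of Y Z] unfolding fadj_def by metis
      then have "pmatch AF D f" using C(2) unfolding pmatch_def D_def by blast
      then have "even (card D)" using even_card_pmatch[of D AF f] fin irr by (simp add: D_def)
      moreover have "card D = (\<Sum>\<sigma><S. card (slice n D \<sigma>))"
        using sub n_pos by (intro card_eq_sum_slices) (auto simp: D_def)
      moreover have "(\<Sum>\<sigma><S. card (slice n D \<sigma>)) = (\<Sum>\<sigma>\<in>{4 * c..<4 * c + 4}. ?f \<sigma>)"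
      proof (rule sum.mono_neutral_cong_right)
        have "\<sigma> div 4 \<noteq> c" if "\<sigma> \<notin> {4 * c..<4 * c + 4}" for \<sigma>
          using that by (simp; presburger)
        then show "\<forall>\<sigma> \<in> {..<S} - {4 * c..<4 * c + 4}. card (slice n D \<sigma>) = 0"
          by (auto simp: slice_def D_def)
        have "\<sigma> div 4 = c" if "\<sigma> \<in> {4 * c..<4 * c + 4}" for \<sigma>
          using that by (simp; presburger)
        then show "card (slice n D \<sigma>) = ?f \<sigma>" if "\<sigma> \<in> {4 * c..<4 * c + 4}" for \<sigma>
          using that by (intro arg_cong[of _ _ card]) (auto simp: slice_def D_def)
      qed (use c in auto)
      moreover have "{4 * c..<4 * c + 4} = {4 * c, 4 * c + 1, 4 * c + 2, 4 * c + 3}" by auto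
      ultimately show ?thesis by (simp add: add.assoc)
    qed
    ultimately show ?thesis using s(1) by presburger
  qed
  have 2: "2 * n \<le> ?f (4 * Y + 2 * c) + ?f (4 * Y + 2 * c + 1)" if c: "c < Z" for c
  proof -
    have l: "link (4 * Y + 2 * c)" "\<not> link (4 * Y + 2 * c + 1)" "\<not> base (4 * Y + 2 * c)" "\<not> base (4 * Y + 2 * c + 1)"
      using c by (auto simp: flink_def fbase_def; presburger)+
    have nl: "\<not> link \<tau>" if "4 * Y + 2 * c = Suc \<tau>" for \<tau>
      using not_flink_pred[OF that] .
    have "v \<in> slice n C (4 * Y + 2 * c) \<and> v \<in> slice n C (4 * Y + 2 * c + 1)" if v: "v < n" for v
      using slice_link[OF C(1) l(1) _ v] nbr[OF _ l(3), of v] nbr[OF _ l(4), of v] l nl c by auto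
    then have "slice n C (4 * Y + 2 * c) = {..<n}" "slice n C (4 * Y + 2 * c + 1) = {..<n}"
      by (auto simp: slice_def)
    then show ?thesis by simp
  qed
  have 3: "s \<le> ?f (4 * Y + 2 * Z + c)" if c: "c < X" for c
  proof -
    let ?\<sigma> = "4 * Y + 2 * Z + c"
    have b: "base ?\<sigma>" "?\<sigma> < S" "\<not> link ?\<sigma>" using c by (auto simp: fbase_def flink_def)
    have nl: "\<not> link \<tau>" if "?\<sigma> = Suc \<tau>" for \<tau>
      using that flink_Suc_less[of Y Z \<tau>] by auto
    have "pmatch adj (slice n C ?\<sigma>) (\<lambda>v. f (?\<sigma> * n + v) mod n)"
      unfolding pmatch_def
    proof
      fix v assume "v \<in> slice n C ?\<sigma>"
      then have v: "v < n" "?\<sigma> * n + v \<in> C" by (auto simp: slice_def)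
      let ?w = "?\<sigma> * n + v"
      have dm: "?w div n = ?\<sigma>" "?w mod n = v" using v by auto
      have f: "f ?w \<in> C" "f (f ?w) = ?w" "AF ?w (f ?w)" using C(2) v unfolding pmatch_def by auto
      then have *: "f ?w div n = ?\<sigma>" "adj v (f ?w mod n)"
        using b nl unfolding fadj_def dm by auto
      then have "f ?w = ?\<sigma> * n + f ?w mod n" by (metis div_mult_mod_eq)
      then show "f ?w mod n \<in> slice n C ?\<sigma> \<and> f (?\<sigma> * n + f ?w mod n) mod n = v \<and> adj v (f ?w mod n)"
        using f * dm n_pos by (auto simp: slice_def)
    qed
    then have "even (?f ?\<sigma>)" using simple by (intro even_card_pmatch) (auto simp: simple_adj_def)
    moreover have "s \<le> ?f ?\<sigma> + 1" by (intro s(2) slice_cover[OF C(1) b(1,2)])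
    ultimately show ?thesis using s(1) by presburger
  qed
  have "card C = (\<Sum>\<sigma><S. ?f \<sigma>)" using sub n_pos by (intro card_eq_sum_slices)
  moreover have "(\<Sum>c<Y. 2 * n + s) \<le> (\<Sum>c<Y. ?f (4 * c) + ?f (4 * c + 1) + ?f (4 * c + 2) + ?f (4 * c + 3))"
    using 1 by (intro sum_mono) auto
  moreover have "(\<Sum>c<Z. 2 * n) \<le> (\<Sum>c<Z. ?f (4 * Y + 2 * c) + ?f (4 * Y + 2 * c + 1))"
    using 2 by (intro sum_mono) auto
  moreover have "(\<Sum>c<X. s) \<le> (\<Sum>c<X. ?f (4 * Y + 2 * Z + c))"
    using 3 by (intro sum_mono) auto
  ultimately show ?thesis unfolding sum_groups by (simp add: algebra_simps)
qed

lemma union_of_slices: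
  assumes "\<And>\<sigma>. D \<sigma> \<subseteq> {..<n}"
  defines "C \<equiv> {w. w < S * n \<and> w mod n \<in> D (w div n)}"
  shows "C \<subseteq> {..<S * n}" "\<sigma> < S \<Longrightarrow> slice n C \<sigma> = D \<sigma>"
    "card C = (\<Sum>c<Y. card (D (4 * c)) + card (D (4 * c + 1)) + card (D (4 * c + 2)) + card (D (4 * c + 3))) +
       (\<Sum>c<Z. card (D (4 * Y + 2 * c)) + card (D (4 * Y + 2 * c + 1))) + (\<Sum>c<X. card (D (4 * Y + 2 * Z + c)))"
proof -
  show sub: "C \<subseteq> {..<S * n}" by (auto simp: C_def)
  show sl: "slice n C \<sigma> = D \<sigma>" if "\<sigma> < S" for \<sigma>
    using assms(1)[of \<sigma>] index_less[OF that] by (auto simp: slice_def C_def)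
  have "card C = (\<Sum>\<sigma><S. card (slice n C \<sigma>))" using sub n_pos by (rule card_eq_sum_slices)
  also have "\<dots> = (\<Sum>\<sigma><S. card (D \<sigma>))" using sl by simp
  finally show "card C = (\<Sum>c<Y. card (D (4 * c)) + card (D (4 * c + 1)) + card (D (4 * c + 2)) + card (D (4 * c + 3))) +
       (\<Sum>c<Z. card (D (4 * Y + 2 * c)) + card (D (4 * Y + 2 * c + 1))) + (\<Sum>c<X. card (D (4 * Y + 2 * Z + c)))"
    unfolding sum_groups .
qed

lemma cover_of_slices:
  assumes "\<And>\<sigma>. D \<sigma> \<subseteq> {..<n}" "\<And>\<sigma>. \<sigma> < S \<Longrightarrow> base \<sigma> \<Longrightarrow> cover {..<n} adj (D \<sigma>)"
    "\<And>\<sigma>. Suc \<sigma> < S \<Longrightarrow> link \<sigma> \<Longrightarrow> D \<sigma> \<union> D (Suc \<sigma>) = {..<n}"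
  shows "cover {..<S * n} AF {w. w < S * n \<and> w mod n \<in> D (w div n)}"
proof -
  have "u mod n \<in> D (u div n) \<or> w mod n \<in> D (w div n)" if uw: "u < S * n" "w < S * n" "AF u w" for u w
  proof -
    have m: "u div n < S" "w div n < S" "u mod n < n" "w mod n < n"
      using uw n_pos by (auto simp: less_mult_imp_div_less)
    from uw(3) consider "w div n = u div n" "base (u div n)" "adj (u mod n) (w mod n)"
      | "u mod n = w mod n" "w div n = Suc (u div n)" "link (u div n)"
      | "u mod n = w mod n" "u div n = Suc (w div n)" "link (w div n)"
      unfolding fadj_def by auto
    then show ?thesis
    proof cases
      case 1
      then show ?thesis using assms(2)[of "u div n"] m unfolding cover_def by auto
    next
      case 2
      then have "u mod n \<in> D (u div n) \<union> D (Suc (u div n))" using assms(3)[of "u div n"] m by auto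
      then show ?thesis using 2 by auto
    next
      case 3
      then have "w mod n \<in> D (w div n) \<union> D (Suc (w div n))" using assms(3)[of "w div n"] m by auto
      then show ?thesis using 3 by auto
    qed
  qed
  then show ?thesis unfolding cover_def by auto
qed

lemma cover_upper:
  assumes D: "cover {..<n} adj D"
  shows "\<exists>C. cover {..<S * n} AF C \<and> card C = 2 * n * Y + n * Z + card D * X"
proof -
  \<comment> \<open>Full and empty layers alternate: layer 0 of a copy with paths is full, which
    covers the edges of the graph there at no extra cost.\<close>
  define E where "E \<sigma> = (if 4 * Y + 2 * Z \<le> \<sigma> then D else if \<sigma> mod 2 = 0 then {..<n} else {})" for \<sigma> :: nat
  have Dn: "D \<subseteq> {..<n}" using D by (simp add: cover_def)
  have "cover {..<S * n} AF {w. w < S * n \<and> w mod n \<in> E (w div n)}"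
  proof (rule cover_of_slices)
    show "E \<sigma> \<subseteq> {..<n}" for \<sigma> using Dn by (auto simp: E_def)
    show "cover {..<n} adj (E \<sigma>)" if "base \<sigma>" for \<sigma>
    proof (cases "4 * Y + 2 * Z \<le> \<sigma>")
      case True
      then show ?thesis using D by (simp add: E_def)
    next
      case False
      then have "\<sigma> mod 2 = 0" using that unfolding fbase_def by presburger
      then show ?thesis using False by (auto simp: E_def cover_def)
    qed
    show "E \<sigma> \<union> E (Suc \<sigma>) = {..<n}" if "link \<sigma>" for \<sigma>
    proof -
      have "Suc \<sigma> < 4 * Y + 2 * Z" using that by (rule flink_Suc_less)
      then show ?thesis by (auto simp: E_def; presburger)
    qed
  qed
  moreover have "card {w. w < S * n \<and> w mod n \<in> E (w div n)} = 2 * n * Y + n * Z + card D * X"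
  proof -
    have a: "card (E (4 * c)) + card (E (4 * c + 1)) + card (E (4 * c + 2)) + card (E (4 * c + 3)) = 2 * n"
      if "c < Y" for c
    proof -
      have "(4 * c + 3) mod 2 = 1" "(4 * c + 2) mod 2 = 0" "(4 * c + 1) mod 2 = 1" "(4 * c) mod 2 = 0" by presburger+
      then show ?thesis using that by (simp add: E_def)
    qed
    have b: "card (E (4 * Y + 2 * c)) + card (E (4 * Y + 2 * c + 1)) = n" if "c < Z" for c
    proof -
      have "(4 * Y + 2 * c + 1) mod 2 = 1" "(4 * Y + 2 * c) mod 2 = 0" by presburger+
      then show ?thesis using that by (simp add: E_def)
    qed
    have c: "card (E (4 * Y + 2 * Z + c)) = card D" for c by (simp add: E_def)
    have "E \<sigma> \<subseteq> {..<n}" for \<sigma> using Dn by (auto simp: E_def)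
    note union_of_slices(3)[of E, OF this]
    also have "(\<Sum>c<Y. card (E (4 * c)) + card (E (4 * c + 1)) + card (E (4 * c + 2)) + card (E (4 * c + 3))) = (\<Sum>c<Y. 2 * n)"
      using a by (intro sum.cong) auto
    also have "(\<Sum>c<Z. card (E (4 * Y + 2 * c)) + card (E (4 * Y + 2 * c + 1))) = (\<Sum>c<Z. n)"
      using b by (intro sum.cong) auto
    finally show ?thesis unfolding c by (simp add: algebra_simps)
  qed
  ultimately show ?thesis by blast
qed

lemma pmatch_upper:
  assumes D: "cover {..<n} adj D" "pmatch adj D f"
  shows "\<exists>C g. cover {..<S * n} AF C \<and> pmatch AF C g \<and> card C = (2 * n + card D) * Y + 2 * n * Z + card D * X"
proof -
  \<comment> \<open>In a copy with paths, \<open>D\<close> keeps its own matching on layer 0, layers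
    1 and 2 are full and matched with each other, and layer 3 stays empty; isolated edges are taken
    whole.\<close>
  define E where "E \<sigma> = (if base \<sigma> then D else if \<sigma> < 4 * Y \<and> \<sigma> mod 4 = 3 then {} else {..<n})" for \<sigma>
  define partner where "partner \<sigma> = (if \<sigma> < 4 * Y then if \<sigma> mod 4 = 1 then \<sigma> + 1 else \<sigma> - 1
     else if \<sigma> mod 2 = 0 then \<sigma> + 1 else \<sigma> - 1)" for \<sigma> :: nat
  define g where "g w = (if base (w div n) then w div n * n + f (w mod n) else partner (w div n) * n + w mod n)" for w
  let ?C = "{w. w < S * n \<and> w mod n \<in> E (w div n)}"
  have Dn: "D \<subseteq> {..<n}" using D by (simp add: cover_def)
  then have En: "E \<sigma> \<subseteq> {..<n}" for \<sigma> by (auto simp: E_def)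
  have "cover {..<S * n} AF ?C"
  proof (rule cover_of_slices[OF En])
    show "cover {..<n} adj (E \<sigma>)" if "base \<sigma>" for \<sigma>
      using D that by (auto simp: E_def)
    show "E \<sigma> \<union> E (Suc \<sigma>) = {..<n}" if "link \<sigma>" for \<sigma>
    proof -
      have "E \<sigma> = {..<n} \<or> E (Suc \<sigma>) = {..<n}"
      proof (cases "\<sigma> mod 4 = 0 \<and> \<sigma> < 4 * Y")
        case True
        then have "\<not> base (Suc \<sigma>)" "Suc \<sigma> mod 4 \<noteq> 3" unfolding fbase_def by presburger+
        then show ?thesis by (simp add: E_def)
      next
        case False
        then have "\<not> base \<sigma>" "\<not> (\<sigma> < 4 * Y \<and> \<sigma> mod 4 = 3)" using that flink_Suc_less[OF that] by (auto simp: fbase_def flink_def)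
        then show ?thesis by (auto simp: E_def)
      qed
      then show ?thesis using En[of \<sigma>] En[of "Suc \<sigma>"] by auto
    qed
  qed
  moreover have "pmatch AF ?C g"
    unfolding pmatch_def
  proof
    fix w assume "w \<in> ?C"
    then have w: "w < S * n" "w mod n \<in> E (w div n)" by auto
    define \<sigma> v where "\<sigma> = w div n" and "v = w mod n"
    have wv: "w = \<sigma> * n + v" by (simp add: \<sigma>_def v_def)
    have sv: "\<sigma> < S" "v < n" "v \<in> E \<sigma>" using w n_pos by (auto simp: \<sigma>_def v_def less_mult_imp_div_less)
    show "g w \<in> ?C \<and> g (g w) = w \<and> AF w (g w)"
    proof (cases "base \<sigma>")
      case True
      then have "v \<in> D" using sv by (simp add: E_def)
      then have f: "f v \<in> D" "f (f v) = v" "adj v (f v)" using D(2) by (auto simp: pmatch_def)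
      have "f v < n" using f Dn by auto
      then have gw: "g w = \<sigma> * n + f v" "g w div n = \<sigma>" "g w mod n = f v"
        using True by (auto simp: g_def \<sigma>_def v_def)
      then show ?thesis
        using True f index_less[OF sv(1) \<open>f v < n\<close>] wv sv
        by (auto simp: g_def E_def fadj_def)
    next
      case False
      define \<tau> where "\<tau> = partner \<sigma>"
      have nb: "\<not> (\<sigma> < 4 * Y \<and> \<sigma> mod 4 = 3)" using sv False by (auto simp: E_def)
      have "\<sigma> mod 4 < 4" "\<sigma> mod 2 < 2" by simp_all
      then consider (a) "\<sigma> < 4 * Y" "\<sigma> mod 4 = 1" | (b) "\<sigma> < 4 * Y" "\<sigma> mod 4 = 2"
        | (c) "4 * Y \<le> \<sigma>" "\<sigma> < 4 * Y + 2 * Z" "\<sigma> mod 2 = 0" | (d) "4 * Y \<le> \<sigma>" "\<sigma> < 4 * Y + 2 * Z" "\<sigma> mod 2 = 1"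
        using False nb unfolding fbase_def by linarith
      then have t: "\<not> base \<tau> \<and> \<not> (\<tau> < 4 * Y \<and> \<tau> mod 4 = 3) \<and> partner \<tau> = \<sigma> \<and>
        (\<tau> = Suc \<sigma> \<and> link \<sigma> \<or> \<sigma> = Suc \<tau> \<and> link \<tau>) \<and> \<tau> < S"
      proof cases
        case a
        then have "\<tau> = Suc \<sigma>" "Suc \<sigma> < 4 * Y" "Suc \<sigma> mod 4 = 2"
          unfolding \<tau>_def partner_def by (simp, presburger, presburger)
        then show ?thesis using a by (simp add: partner_def fbase_def flink_def)
      next
        case b
        then obtain k where k: "\<sigma> = Suc k" by (cases \<sigma>) auto
        then have "\<tau> = k" using b by (simp add: \<tau>_def partner_def)
        moreover have "k < 4 * Y" "k mod 4 = 1" using b k by (simp, presburger)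
        ultimately have "\<sigma> = Suc \<tau>" "\<tau> < 4 * Y" "\<tau> mod 4 = 1" using k by auto
        then show ?thesis using b by (simp add: partner_def fbase_def flink_def)
      next
        case c
        then have "\<tau> = Suc \<sigma>" "Suc \<sigma> < 4 * Y + 2 * Z" "Suc \<sigma> mod 2 = 1"
          unfolding \<tau>_def partner_def by (simp, presburger, presburger)
        then show ?thesis using c by (simp add: partner_def fbase_def flink_def)
      next
        case d
        then obtain k where k: "\<sigma> = Suc k" by (cases \<sigma>) auto
        then have "\<tau> = k" using d by (simp add: \<tau>_def partner_def)
        moreover have "4 * Y \<le> k" "k < 4 * Y + 2 * Z" "k mod 2 = 0" using d k by presburger+
        ultimately have "\<sigma> = Suc \<tau>" "4 * Y \<le> \<tau>" "\<tau> < 4 * Y + 2 * Z" "\<tau> mod 2 = 0" using k by auto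
        then show ?thesis using d by (simp add: partner_def fbase_def flink_def)
      qed
      have gw: "g w = \<tau> * n + v" using False by (simp add: g_def \<tau>_def \<sigma>_def v_def)
      then have gd: "g w div n = \<tau>" "g w mod n = v" using sv by auto
      have "v \<in> E \<tau>" using t sv by (simp add: E_def)
      moreover have "g (g w) = w" using gd t wv by (simp add: g_def)
      moreover have "AF w (g w)" unfolding fadj_def gd using t wv sv by auto
      ultimately show ?thesis using gd gw index_less[of \<tau> v] t sv(2) by auto
    qed
  qed
  moreover have "card ?C = (2 * n + card D) * Y + 2 * n * Z + card D * X"
  proof -
    have a: "card (E (4 * c)) + card (E (4 * c + 1)) + card (E (4 * c + 2)) + card (E (4 * c + 3)) = 2 * n + card D"
      if "c < Y" for c
    proof -
      have "base (4 * c)" "\<not> base (4 * c + 1)" "\<not> base (4 * c + 2)" "\<not> base (4 * c + 3)"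
        "(4 * c + 1) mod 4 = 1" "(4 * c + 2) mod 4 = 2" "(4 * c + 3) mod 4 = 3"
        using that unfolding fbase_def by presburger+
      then show ?thesis using that by (simp add: E_def)
    qed
    have b: "card (E (4 * Y + 2 * c)) + card (E (4 * Y + 2 * c + 1)) = 2 * n" if "c < Z" for c
    proof -
      have "\<not> base (4 * Y + 2 * c)" "\<not> base (4 * Y + 2 * c + 1)"
        using that unfolding fbase_def by presburger+
      then show ?thesis using that by (simp add: E_def)
    qed
    have c: "card (E (4 * Y + 2 * Z + c)) = card D" for c by (simp add: E_def fbase_def)
    note union_of_slices(3)[of E, OF En]
    also have "(\<Sum>c<Y. card (E (4 * c)) + card (E (4 * c + 1)) + card (E (4 * c + 2)) + card (E (4 * c + 3))) = (\<Sum>c<Y. 2 * n + card D)"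
      using a by (intro sum.cong) auto
    also have "(\<Sum>c<Z. card (E (4 * Y + 2 * c)) + card (E (4 * Y + 2 * c + 1))) = (\<Sum>c<Z. 2 * n)"
      using b by (intro sum.cong) auto
    finally show ?thesis unfolding c by (simp add: algebra_simps)
  qed
  ultimately show ?thesis by blast
qed

lemma mvc_copies:
  assumes "\<And>D. cover {..<n} adj D \<Longrightarrow> k \<le> card D" "\<exists>D. cover {..<n} adj D \<and> card D = k"
  shows "mvc (graph_of (S * n) AF) = 2 * n * Y + n * Z + k * X"
proof (rule antisym)
  show "mvc (graph_of (S * n) AF) \<le> 2 * n * Y + n * Z + k * X"
  proof -
    obtain D where "cover {..<n} adj D" "card D = k" using assms(2) by blast
    with cover_upper[OF this(1)] show ?thesis
      unfolding mvc_le_iff[OF simple_fadj[OF simple]] by auto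
  qed
  obtain C where "cover {..<S * n} AF C" "card C \<le> mvc (graph_of (S * n) AF)"
    using mvc_le_iff[OF simple_fadj[OF simple], of "S * n" Y Z n "mvc (graph_of (S * n) AF)"] by blast
  then show "2 * n * Y + n * Z + k * X \<le> mvc (graph_of (S * n) AF)"
    using cover_lower[of C k] assms(1) by simp
qed

lemma min_ed_copies:
  assumes "even s" "\<And>D. cover {..<n} adj D \<Longrightarrow> s \<le> card D + 1"
    "\<exists>D f. cover {..<n} adj D \<and> pmatch adj D f \<and> card D = s"
  shows "min_ed (graph_of (S * n) AF) = (2 * n + s) * Y + 2 * n * Z + s * X"
proof (rule antisym)
  show "min_ed (graph_of (S * n) AF) \<le> (2 * n + s) * Y + 2 * n * Z + s * X"
  proof -
    obtain D f where "cover {..<n} adj D" "pmatch adj D f" "card D = s" using assms(3) by blast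
    with pmatch_upper[OF this(1,2)] show ?thesis
      unfolding min_ed_le_iff[OF simple_fadj[OF simple]] by auto
  qed
  obtain C f where "cover {..<S * n} AF C" "pmatch AF C f" "card C \<le> min_ed (graph_of (S * n) AF)"
    using min_ed_le_iff[OF simple_fadj[OF simple], of "S * n" Y Z n "min_ed (graph_of (S * n) AF)"] by blast
  then show "(2 * n + s) * Y + 2 * n * Z + s * X \<le> min_ed (graph_of (S * n) AF)"
    using pmatch_lower[of C f s] assms(1,2) by simp
qed

end

text \<open>One choice of \<open>X\<close>, \<open>Y\<close>, \<open>Z\<close> has to serve all
  \<open>n\<close> and \<open>s\<close>, so the coefficients must balance separately:
  \<open>q * (Y + X) = p * X\<close> for \<open>s\<close> and
  \<open>2 * q * (Y + Z) = p * (2 * Y + Z)\<close> for \<open>n\<close>. Starting from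
  \<open>X = q * (2 * q - p)\<close>, the first equation gives \<open>Y\<close> and the second
  \<open>Z\<close>. As \<open>p < 2 * q\<close>, \<open>X\<close> is positive and lowering
  \<open>k\<close> by one destroys the inequality.\<close>

lemma ratio_balance:
  fixes p q n s k :: nat
  assumes "0 < q" "q \<le> p" "p < 2 * q" "k = s \<or> Suc k = s"
  defines "Y \<equiv> (p - q) * (2 * q - p)" and "Z \<equiv> 2 * (p - q)\<^sup>2" and "X \<equiv> q * (2 * q - p)"
  shows "q * ((2 * n + s) * Y + 2 * n * Z + s * X) \<le> p * (2 * n * Y + n * Z + k * X) \<longleftrightarrow> k = s"
proof -
  obtain d where d: "p = q + d" using assms(2) le_Suc_ex by blast
  obtain w where w: "2 * q = p + w" "0 < w" using assms(3) less_imp_add_positive by metis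
  have *: "p - q = d" "2 * q - p = w" "q = d + w" using d w by auto
  have X0: "0 < X" using w assms(1) * by (simp add: X_def)
  have "q * ((2 * n + s) * Y + 2 * n * Z + s * X) = p * (2 * n * Y + n * Z + s * X)"
    unfolding X_def Y_def Z_def * d by (simp add: *(3) algebra_simps power2_eq_square)
  moreover have "p * (2 * n * Y + n * Z + s * X) = p * (2 * n * Y + n * Z + k * X) + (if k = s then 0 else p * X)"
    using assms(4) by (auto simp: algebra_simps)
  ultimately show ?thesis using X0 assms(1,2) by auto
qed

subsection \<open>Circuits as graphs\<close>

text \<open>A circuit has \<open>J\<close> gates with four input slots over the alphabet \<open>{..<S}\<close>; the slots of gate \<open>j\<close> are the base
  \<open>S\<close> digits of \<open>asg j\<close>. Slot \<open>l\<close> is free unless its source \<open>src l j\<close> is an earlier gate.\<close>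

definition dig :: "nat \<Rightarrow> nat \<Rightarrow> nat \<Rightarrow> nat" where
  "dig S l a = a div S ^ l mod S"

definition circuit_sat :: "nat \<Rightarrow> nat \<Rightarrow> (nat \<Rightarrow> nat \<Rightarrow> nat) \<Rightarrow> (nat \<Rightarrow> nat \<Rightarrow> nat) \<Rightarrow> (nat \<Rightarrow> nat) \<Rightarrow> bool" where
  "circuit_sat J S src out asg \<longleftrightarrow> (\<forall>j<J. asg j < S ^ 4 \<and>
     (\<forall>l<4. src l j < j \<longrightarrow> dig S l (asg j) = out (src l j) (asg (src l j))))"

text \<open>No pair conflicts with itself, so all its copies can be chosen together. The last two
  clauses compare a slot with the gate it reads, in either direction, which makes the relation
  symmetric.\<close>

definition conflict :: "nat \<Rightarrow> (nat \<Rightarrow> nat \<Rightarrow> nat) \<Rightarrow> (nat \<Rightarrow> nat \<Rightarrow> nat) \<Rightarrow> nat \<Rightarrow> nat \<Rightarrow> nat \<Rightarrow> nat \<Rightarrow> bool" where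
  "conflict S src out j a j' a' \<longleftrightarrow> (j = j' \<and> a \<noteq> a') \<or>
     (\<exists>l<4. src l j < j \<and> src l j = j' \<and> dig S l a \<noteq> out j' a') \<or>
     (\<exists>l<4. src l j' < j' \<and> src l j' = j \<and> dig S l a' \<noteq> out j a)"

definition hard_size :: "nat \<Rightarrow> nat \<Rightarrow> nat" where
  "hard_size J S = (2 * J + 2) * J * S ^ 4"

text \<open>The first \<open>hard_size J S\<close> vertices are \<open>2 * J + 2\<close> copies of all pairs of a gate and an assignment of its slots;
  the copies outweigh the remaining \<open>2 * J\<close> vertices, two for each gate, which are free only if the gate outputs
  \<open>rw j\<close>.\<close>

definition gadj :: "nat \<Rightarrow> nat \<Rightarrow> (nat \<Rightarrow> nat \<Rightarrow> nat) \<Rightarrow> (nat \<Rightarrow> nat \<Rightarrow> nat) \<Rightarrow> (nat \<Rightarrow> nat) \<Rightarrow> nat \<Rightarrow> nat \<Rightarrow> bool" where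
  "gadj J S src out rw v w \<longleftrightarrow>
     (if v < hard_size J S then
        if w < hard_size J S then conflict S src out (v div S ^ 4 mod J) (v mod S ^ 4) (w div S ^ 4 mod J) (w mod S ^ 4)
        else (w - hard_size J S) div 2 = v div S ^ 4 mod J \<and> out (v div S ^ 4 mod J) (v mod S ^ 4) \<noteq> rw (v div S ^ 4 mod J)
      else w < hard_size J S \<and>
        (v - hard_size J S) div 2 = w div S ^ 4 mod J \<and> out (w div S ^ 4 mod J) (w mod S ^ 4) \<noteq> rw (w div S ^ 4 mod J))"

definition rewards :: "nat \<Rightarrow> (nat \<Rightarrow> nat \<Rightarrow> nat) \<Rightarrow> (nat \<Rightarrow> nat) \<Rightarrow> (nat \<Rightarrow> nat) \<Rightarrow> nat" where
  "rewards J out rw asg = card {j. j < J \<and> out j (asg j) = rw j}"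

lemma simple_gadj: "simple_adj (gadj J S src out rw)"
  unfolding simple_adj_def gadj_def conflict_def by auto

text \<open>Each copy of a gate contributes at most one vertex. If every gate is represented in some
  copy, the representatives form a satisfying assignment, and only gates that it rewards can
  contribute reward vertices. If a gate is missing, \<open>2 * J + 2\<close> vertices are lost, more
  than the \<open>2 * J\<close> reward vertices can return.\<close>

lemma gadj_indep_le:
  assumes I: "indep (hard_size J S + 2 * J) (gadj J S src out rw) I" and "0 < J" "0 < S"
    and m: "\<And>asg. circuit_sat J S src out asg \<Longrightarrow> rewards J out rw asg \<le> m"
  shows "card I \<le> (2 * J + 2) * J + 2 * m"
proof -
  let ?H = "hard_size J S" and ?T = "2 * J + 2" and ?D = "S ^ 4"
  have D: "0 < ?D" using \<open>0 < S\<close> by simp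
  define H where "H = {v \<in> I. v < ?H}"
  define So where "So = {v \<in> I. ?H \<le> v}"
  have fin: "finite I" using I finite_subset unfolding indep_def by blast
  have "I = H \<union> So" "H \<inter> So = {}" by (auto simp: H_def So_def)
  then have cI: "card I = card H + card So" using fin by (simp add: card_Un_disjoint)
  have nadj: "\<not> gadj J S src out rw v w" if "v \<in> I" "w \<in> I" for v w
    using I that by (auto simp: indep_def)
  have hard: "\<not> conflict S src out (v div ?D mod J) (v mod ?D) (w div ?D mod J) (w mod ?D)"
    if "v \<in> H" "w \<in> H" for v w
    using nadj[of v w] that by (auto simp: gadj_def H_def)
  have inj: "inj_on (\<lambda>v. v div ?D) H"
  proof (rule inj_onI)
    fix v w assume vw: "v \<in> H" "w \<in> H" "v div ?D = w div ?D"
    then have "v mod ?D = w mod ?D" using hard[OF vw(1,2)] by (auto simp: conflict_def)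
    then show "v = w" using vw(3) by (metis div_mult_mod_eq)
  qed
  have ran: "v div ?D < ?T * J" if "v \<in> H" for v
    using that by (auto simp: H_def hard_size_def less_mult_imp_div_less)
  have soft: "So \<subseteq> {?H..<?H + 2 * J}" using I by (auto simp: So_def indep_def)
  show ?thesis
  proof (cases "\<forall>j<J. \<exists>v \<in> H. v div ?D mod J = j")
    case True
    \<comment> \<open>Representatives may come from different copies, since \<open>conflict\<close>
      does not see the copy.\<close>
    then obtain rep where rep: "\<And>j. j < J \<Longrightarrow> rep j \<in> H \<and> rep j div ?D mod J = j" by metis
    define asg where "asg j = rep j mod ?D" for j
    have sat: "circuit_sat J S src out asg"
      unfolding circuit_sat_def
    proof (intro allI impI conjI)
      fix j assume j: "j < J"
      show "asg j < ?D" using D by (simp add: asg_def)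
      fix l :: nat assume l: "l < 4" "src l j < j"
      have "rep j \<in> H" "rep j div ?D mod J = j" "rep (src l j) \<in> H" "rep (src l j) div ?D mod J = src l j"
        using rep[of j] rep[of "src l j"] j l by auto
      with hard[of "rep j" "rep (src l j)"] l show "dig S l (asg j) = out (src l j) (asg (src l j))"
        unfolding conflict_def asg_def by auto
    qed
    define R where "R = {j. j < J \<and> out j (asg j) = rw j}"
    have "(w - ?H) div 2 \<in> R" if w: "w \<in> So" for w
    proof -
      let ?j = "(w - ?H) div 2"
      have "w - ?H < J * 2" using subsetD[OF soft w] by auto
      then have "?j < J" by (rule less_mult_imp_div_less)
      then have r: "rep ?j \<in> H" "rep ?j div ?D mod J = ?j" using rep by auto
      then have "\<not> gadj J S src out rw (rep ?j) w" using nadj w by (auto simp: H_def So_def)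
      then show ?thesis using r w \<open>?j < J\<close> by (auto simp: gadj_def H_def So_def R_def asg_def)
    qed
    then have "So \<subseteq> (\<lambda>(j, e). ?H + 2 * j + e) ` (R \<times> {0, 1})"
    proof -
      assume *: "\<And>w. w \<in> So \<Longrightarrow> (w - ?H) div 2 \<in> R"
      have "w \<in> (\<lambda>(j, e). ?H + 2 * j + e) ` (R \<times> {0, 1})" if w: "w \<in> So" for w
      proof -
        have "w = ?H + 2 * ((w - ?H) div 2) + (w - ?H) mod 2" using w by (simp add: So_def)
        moreover have "(w - ?H) mod 2 \<in> {0, 1}" by auto
        ultimately show ?thesis using *[OF w] by (intro image_eqI[of _ _ "((w - ?H) div 2, (w - ?H) mod 2)"]) auto
      qed
      then show ?thesis by blast
    qed
    moreover have "finite R" by (simp add: R_def)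
    ultimately have "card So \<le> card (R \<times> {0 :: nat, 1})"
      by (meson card_image_le card_mono finite.emptyI finite.insertI finite_SigmaI finite_imageI le_trans)
    also have "\<dots> = 2 * card R" by (simp add: card_cartesian_product)
    also have "\<dots> \<le> 2 * m" using m[OF sat] by (simp add: rewards_def R_def)
    finally have "card So \<le> 2 * m" .
    moreover have "card H \<le> ?T * J"
      using card_inj_on_le[OF inj, of "{..<?T * J}"] ran by auto
    ultimately show ?thesis using cI by simp
  next
    case False
    then obtain j0 where j0: "j0 < J" "\<And>v. v \<in> H \<Longrightarrow> v div ?D mod J \<noteq> j0" by auto
    \<comment> \<open>The places of the missing gate \<open>j0\<close>, one in each of the
      \<open>2 * J + 2\<close> copies.\<close>
    let ?B = "(\<lambda>t. t * J + j0) ` {..<?T}"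
    have B: "?B \<subseteq> {..<?T * J}"
    proof
      fix y assume "y \<in> ?B"
      then obtain t where t: "t < ?T" "y = t * J + j0" by auto
      then have "y < Suc t * J" using j0 by simp
      also have "\<dots> \<le> ?T * J" using t by (intro mult_le_mono1) simp
      finally show "y \<in> {..<?T * J}" by simp
    qed
    have "card ?B = ?T" using \<open>0 < J\<close> by (subst card_image) (auto simp: inj_on_def)
    then have "card ({..<?T * J} - ?B) = ?T * J - ?T" using B by (subst card_Diff_subset) auto
    moreover have "(\<lambda>v. v div ?D) ` H \<subseteq> {..<?T * J} - ?B"
    proof -
      have "v div ?D \<notin> ?B" if "v \<in> H" for v using j0(2)[OF that] j0(1) by auto
      then show ?thesis using ran by (intro image_subsetI DiffI) (auto simp del: mult_Suc mult_Suc_right add_mult_distrib distrib_right_numeral)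
    qed
    ultimately have "card H \<le> ?T * J - ?T"
      using card_inj_on_le[OF inj, of "{..<?T * J} - ?B"] by auto
    moreover have "card So \<le> 2 * J" using card_mono[OF _ soft] by simp
    moreover have "?T \<le> ?T * J" using \<open>0 < J\<close> by simp
    ultimately show ?thesis using cI by linarith
  qed
qed

lemma gadj_indep_ex:
  assumes sat: "circuit_sat J S src out asg" and "0 < J" "0 < S"
  shows "\<exists>I. indep (hard_size J S + 2 * J) (gadj J S src out rw) I \<and>
    card I = (2 * J + 2) * J + 2 * rewards J out rw asg"
proof -
  let ?H = "hard_size J S" and ?T = "2 * J + 2" and ?D = "S ^ 4"
  have D: "0 < ?D" using \<open>0 < S\<close> by simp
  have asg: "asg (q mod J) < ?D" for q
    using sat \<open>0 < J\<close> by (auto simp: circuit_sat_def)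
  define h where "h q = q * ?D + asg (q mod J)" for q
  have h: "h q div ?D = q" "h q mod ?D = asg (q mod J)" for q
    using asg[of q] D by (auto simp: h_def)
  define R where "R = {j. j < J \<and> out j (asg j) = rw j}"
  define H where "H = h ` {..<?T * J}"
  define So where "So = (\<lambda>(j, e). ?H + 2 * j + e) ` (R \<times> {0 :: nat, 1})"
  have Hl: "v < ?H \<and> v mod ?D = asg (v div ?D mod J)" if v: "v \<in> H" for v
  proof -
    obtain q where q: "q < ?T * J" "v = h q" using v unfolding H_def by blast
    have "v < Suc q * ?D" using asg[of q] by (simp add: q h_def)
    also have "\<dots> \<le> ?T * J * ?D" using q by (intro mult_le_mono1) simp
    finally show ?thesis using h[of q] q by (simp add: hard_size_def)
  qed
  have Sl: "?H \<le> w \<and> w < ?H + 2 * J \<and> (w - ?H) div 2 \<in> R" if w: "w \<in> So" for w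
  proof -
    obtain j e where je: "j \<in> R" "e = 0 \<or> e = 1" "w = ?H + 2 * j + e" using w by (auto simp: So_def)
    then have "(w - ?H) div 2 = j" by auto
    moreover have "j < J" using je by (simp add: R_def)
    ultimately show ?thesis using je by auto
  qed
  have "\<not> gadj J S src out rw v w" if "v \<in> H \<union> So" "w \<in> H \<union> So" for v w
  proof -
    have noc: "\<not> conflict S src out j (asg j) k (asg k)" if "j < J" "k < J" for j k
      using sat that by (auto simp: conflict_def circuit_sat_def)
    have mj: "q mod J < J" for q using \<open>0 < J\<close> by simp
    from that consider "v \<in> H" "w \<in> H" | "v \<in> H" "w \<in> So" | "v \<in> So" "w \<in> H" | "v \<in> So" "w \<in> So" by blast
    then show ?thesis
    proof cases
      case 1
      then show ?thesis using Hl[of v] Hl[of w] noc mj by (simp add: gadj_def)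
    next
      case 2
      then show ?thesis using Hl[of v] Sl[of w] by (auto simp: gadj_def R_def)
    next
      case 3
      then show ?thesis using Hl[of w] Sl[of v] by (auto simp: gadj_def R_def)
    next
      case 4
      then show ?thesis using Sl[of w] Sl[of v] by (auto simp: gadj_def)
    qed
  qed
  then have "indep (?H + 2 * J) (gadj J S src out rw) (H \<union> So)"
    using Hl Sl by (auto simp: indep_def) (meson trans_less_add1)
  moreover have "card (H \<union> So) = ?T * J + 2 * rewards J out rw asg"
  proof -
    have "inj_on h {..<?T * J}" by (rule inj_on_inverseI[of _ "\<lambda>v. v div ?D"]) (simp add: h)
    then have "card H = ?T * J" by (simp add: H_def card_image)
    moreover have "card So = 2 * rewards J out rw asg"
    proof -
      have "inj_on (\<lambda>(j, e). ?H + 2 * j + e) (R \<times> {0 :: nat, 1})"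
        by (auto simp: inj_on_def) presburger+
      then show ?thesis by (simp add: So_def card_image card_cartesian_product rewards_def R_def)
    qed
    moreover have "H \<inter> So = {}" using Hl Sl by fastforce
    moreover have "finite H" "finite So" by (auto simp: H_def So_def R_def)
    ultimately show ?thesis by (simp add: card_Un_disjoint)
  qed
  ultimately show ?thesis by blast
qed

lemma digits_exist:
  assumes "\<forall>l<k. d l < S"
  shows "\<exists>a < S ^ k. \<forall>l<k. dig S l a = d l"
  using assms
proof (induction k arbitrary: d)
  case (Suc k)
  have "\<forall>l<k. d (Suc l) < S" using Suc.prems by simp
  from Suc.IH[OF this] obtain a where a: "a < S ^ k" "\<forall>l<k. dig S l a = d (Suc l)" by blast
  let ?b = "d 0 + S * a"
  have d0: "d 0 < S" using Suc.prems by simp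
  have "dig S l ?b = d l" if "l < Suc k" for l
  proof (cases l)
    case 0
    then show ?thesis using d0 by (simp add: dig_def)
  next
    case (Suc m)
    have "?b div S ^ Suc m = a div S ^ m" using d0 by (simp add: div_mult2_eq)
    then show ?thesis using Suc that a by (simp add: dig_def)
  qed
  moreover have "?b < S ^ Suc k"
  proof -
    have "?b < S * Suc a" using d0 by simp
    also have "\<dots> \<le> S * S ^ k" using a by (intro mult_le_mono2) simp
    finally show ?thesis by simp
  qed
  ultimately show ?case by blast
qed auto

text \<open>Sources precede their gates, so all values are determined in order once \<open>g\<close>
  prescribes the free slots.\<close>

lemma circuit_sat_ex:
  assumes "\<And>j a. out j a < S" "\<And>l j. g l j < S"
  shows "\<exists>asg. circuit_sat J S src out asg \<and> (\<forall>j<J. \<forall>l<4. \<not> src l j < j \<longrightarrow> dig S l (asg j) = g l j)"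
proof (induction J)
  case (Suc J)
  then obtain asg where asg: "circuit_sat J S src out asg" "\<forall>j<J. \<forall>l<4. \<not> src l j < j \<longrightarrow> dig S l (asg j) = g l j"
    by blast
  define d where "d l = (if src l J < J then out (src l J) (asg (src l J)) else g l J)" for l
  have "\<forall>l<4. d l < S" using assms by (simp add: d_def)
  from digits_exist[OF this] obtain a where a: "a < S ^ 4" "\<forall>l<4. dig S l a = d l" by blast
  show ?case
  proof (intro exI[of _ "asg(J := a)"] conjI)
    show "circuit_sat (Suc J) S src out (asg(J := a))"
      using asg(1) a by (auto simp: circuit_sat_def less_Suc_eq d_def)
    show "\<forall>j<Suc J. \<forall>l<4. \<not> src l j < j \<longrightarrow> dig S l ((asg(J := a)) j) = g l j"
      using asg(2) a by (auto simp: less_Suc_eq d_def)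
  qed
qed (auto simp: circuit_sat_def)

subsection \<open>Tableaux of Turing machine computations\<close>

text \<open>Idling in the halting state lets one local rule describe all rows of a tableau, also
  those after the end of the computation.\<close>

definition total_delta :: "tm \<Rightarrow> nat \<Rightarrow> nat list \<Rightarrow> nat \<times> (nat \<times> move) list" where
  "total_delta M q ss = (if q < num_states M then delta M q ss else (q, idle ss))"

lemma tm_step_total:
  "tm_step M (q, ts) = (case total_delta M q (map read_tape ts) of (q', as) \<Rightarrow> (q', map2 act_tape as ts))"
  by (simp add: tm_step_def total_delta_def map2_idle)

text \<open>One code for the cells of all tapes at position \<open>p\<close>; the low bit of an
  entry tells whether that head is here.\<close>

definition cellv :: "config \<Rightarrow> int \<Rightarrow> nat" where
  "cellv c p = list_encode (map (\<lambda>t. 2 * fst t p + of_bool (snd t = p)) (snd c))"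

text \<open>The symbols scanned by the heads at or to the left of \<open>p\<close>: this makes the scanned symbols, which determine
  \<open>globv\<close>, computable from the cells by a local rule going from left to right.\<close>

definition scanv :: "config \<Rightarrow> int \<Rightarrow> nat" where
  "scanv c p = list_encode (map (\<lambda>t. if snd t \<le> p then Suc (read_tape t) else 0) (snd c))"

definition globv :: "config \<Rightarrow> nat" where
  "globv c = list_encode (fst c # map read_tape (snd c))"

definition new_cell :: "nat \<times> move \<Rightarrow> nat \<Rightarrow> nat \<Rightarrow> nat \<Rightarrow> nat" where
  "new_cell a l c r = 2 * (if odd c then fst a else c div 2) +
     of_bool (odd c \<and> snd a = Stay \<or> odd l \<and> snd a = Go_Right \<or> odd r \<and> snd a = Go_Left)"

definition cell_fun :: "tm \<Rightarrow> nat \<Rightarrow> nat \<Rightarrow> nat \<Rightarrow> nat \<Rightarrow> nat" where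
  "cell_fun M L C R G = (let g = list_decode G; as = snd (total_delta M (hd g) (tl g)) in
     list_encode (map (\<lambda>i. new_cell (as ! i) (list_decode L ! i) (list_decode C ! i) (list_decode R ! i))
       [0..<num_tapes M]))"

text \<open>Entry 0 means that no head has been met yet and \<open>Suc a\<close> that symbol
  \<open>a\<close> is scanned; hence the \<open>z - 1\<close> when the scan is finished.\<close>

definition scan_first :: "nat \<Rightarrow> nat" where
  "scan_first C = list_encode (map (\<lambda>c. if odd c then Suc (c div 2) else 0) (list_decode C))"

definition scan_fun :: "nat \<Rightarrow> nat \<Rightarrow> nat" where
  "scan_fun P C = list_encode (map2 (\<lambda>z c. if odd c then Suc (c div 2) else z) (list_decode P) (list_decode C))"

definition glob_first :: "nat \<Rightarrow> nat" where
  "glob_first P = list_encode (0 # map (\<lambda>z. z - 1) (list_decode P))"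

definition glob_fun :: "tm \<Rightarrow> nat \<Rightarrow> nat \<Rightarrow> nat" where
  "glob_fun M P G = (let g = list_decode G in
     list_encode (fst (total_delta M (hd g) (tl g)) # map (\<lambda>z. z - 1) (list_decode P)))"

definition init_cell :: "tm \<Rightarrow> nat \<Rightarrow> nat \<Rightarrow> nat" where
  "init_cell M h s = list_encode ((2 * s + h) # replicate (num_tapes M - 1) h)"

definition blank_cell :: "tm \<Rightarrow> nat" where
  "blank_cell M = list_encode (replicate (num_tapes M) 0)"

definition out_symbol :: "nat \<Rightarrow> nat" where
  "out_symbol C = list_decode C ! 1 div 2"

definition valid_config :: "tm \<Rightarrow> config \<Rightarrow> bool" where
  "valid_config M c \<longleftrightarrow> fst c \<le> num_states M \<and> length (snd c) = num_tapes M \<and>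
     (\<forall>t \<in> set (snd c). \<forall>p. fst t p < num_symbols M)"

lemma total_delta_valid:
  assumes "wf_tm M" "valid_config M (q, ts)" "total_delta M q (map read_tape ts) = (q', as)"
  shows "q' \<le> num_states M" "length as = num_tapes M" "\<forall>a \<in> set as. fst a < num_symbols M"
proof -
  have ss: "length (map read_tape ts) = num_tapes M" "set (map read_tape ts) \<subseteq> {..<num_symbols M}"
    using assms(2) by (auto simp: valid_config_def read_tape_def)
  have "q' \<le> num_states M \<and> length as = num_tapes M \<and> fst ` set as \<subseteq> {..<num_symbols M}"
  proof (cases "q < num_states M")
    case True
    then have "case delta M q (map read_tape ts) of (q', as) \<Rightarrow>
        q' \<le> num_states M \<and> length as = num_tapes M \<and> fst ` set as \<subseteq> {..<num_symbols M}"
      by (intro assms(1)[unfolded wf_tm_def, THEN conjunct2, THEN conjunct2, rule_format] ss)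
    then show ?thesis using assms(3) True by (simp add: total_delta_def)
  next
    case False
    then have "q' = q" "as = idle (map read_tape ts)" using assms(3) by (auto simp: total_delta_def)
    then show ?thesis using assms(2) ss by (auto simp: valid_config_def idle_def)
  qed
  then show "q' \<le> num_states M" "length as = num_tapes M" "\<forall>a \<in> set as. fst a < num_symbols M" by auto
qed

lemma valid_step:
  assumes "wf_tm M" "valid_config M c"
  shows "valid_config M (tm_step M c)"
proof -
  obtain q ts where c: "c = (q, ts)" by (cases c)
  obtain q' as where d: "total_delta M q (map read_tape ts) = (q', as)" by fastforce
  note v = total_delta_valid[OF assms(1) assms(2)[unfolded c] d]
  have "fst (act_tape a t) p < num_symbols M" if "(a, t) \<in> set (zip as ts)" for a t p
    using set_zip_leftD[OF that] set_zip_rightD[OF that] v(3) assms(2)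
    unfolding c valid_config_def act_tape_def by auto
  then show ?thesis
    using v assms(2) by (auto simp: c tm_step_total d valid_config_def)
qed

definition run_config :: "tm \<Rightarrow> bool list \<Rightarrow> nat \<Rightarrow> config" where
  "run_config M z \<tau> = (tm_step M ^^ \<tau>) (init_config M z)"

lemma run_config_Suc: "run_config M z (Suc \<tau>) = tm_step M (run_config M z \<tau>)"
  by (simp add: run_config_def)

lemma tape_content_bound: "tape_content z p < 3"
  by (simp add: tape_content_def)

lemma valid_run: "wf_tm M \<Longrightarrow> valid_config M (run_config M z \<tau>)"
proof (induction \<tau>)
  case 0
  then have "3 \<le> num_symbols M" "2 \<le> num_tapes M" by (auto simp: wf_tm_def)
  then show ?case
    using tape_content_bound[of z] tape_content_bound[of "[]"]
    by (auto simp: run_config_def init_config_def valid_config_def intro: less_le_trans)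
next
  case (Suc \<tau>)
  then show ?case by (simp add: run_config_Suc valid_step)
qed

text \<open>A head moves at most one cell per step. The blank region outside the window is what
  allows a finite tableau.\<close>

lemma run_window:
  assumes "wf_tm M"
  shows "\<forall>t \<in> set (snd (run_config M z \<tau>)). \<bar>snd t\<bar> \<le> int \<tau> \<and>
    (\<forall>p. p < - int \<tau> \<or> int \<tau> + int (length z) \<le> p \<longrightarrow> fst t p = 0)"
proof (induction \<tau>)
  case 0
  show ?case by (auto simp: run_config_def init_config_def tape_content_def)
next
  case (Suc \<tau>)
  obtain q ts where c: "run_config M z \<tau> = (q, ts)" by fastforce
  obtain q' as where d: "total_delta M q (map read_tape ts) = (q', as)" by fastforce
  have "\<bar>snd (act_tape a t)\<bar> \<le> int (Suc \<tau>) \<and>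
    (\<forall>p. p < - int (Suc \<tau>) \<or> int (Suc \<tau>) + int (length z) \<le> p \<longrightarrow> fst (act_tape a t) p = 0)"
    if "(a, t) \<in> set (zip as ts)" for a t
  proof -
    have t: "\<bar>snd t\<bar> \<le> int \<tau>" "\<forall>p. p < - int \<tau> \<or> int \<tau> + int (length z) \<le> p \<longrightarrow> fst t p = 0"
      using Suc.IH c set_zip_rightD[OF that] by auto
    then show ?thesis by (cases "snd a") (auto simp: act_tape_def)
  qed
  then show ?case by (auto simp: run_config_Suc c tm_step_total d)
qed

text \<open>A head enters a cell only from one of its two neighbours, and \<open>globv\<close> holds
  all that the transition depends on.\<close>

lemma cellv_step:
  assumes "wf_tm M" "valid_config M c"
  shows "cellv (tm_step M c) p = cell_fun M (cellv c (p - 1)) (cellv c p) (cellv c (p + 1)) (globv c)"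
proof -
  obtain q ts where c: "c = (q, ts)" by (cases c)
  obtain q' as where d: "total_delta M q (map read_tape ts) = (q', as)" by fastforce
  note v = total_delta_valid[OF assms(1) assms(2)[unfolded c] d]
  have len: "length ts = num_tapes M" using assms(2) by (simp add: c valid_config_def)
  have "2 * fst (act_tape a t) p + of_bool (snd (act_tape a t) = p) =
     new_cell a (2 * fst t (p - 1) + of_bool (snd t = p - 1)) (2 * fst t p + of_bool (snd t = p))
       (2 * fst t (p + 1) + of_bool (snd t = p + 1))" for a t
    by (cases "snd a") (auto simp: new_cell_def act_tape_def)
  then have "map (\<lambda>t. 2 * fst t p + of_bool (snd t = p)) (map2 act_tape as ts) =
     map (\<lambda>i. new_cell (as ! i) (map (\<lambda>t. 2 * fst t (p - 1) + of_bool (snd t = p - 1)) ts ! i)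
       (map (\<lambda>t. 2 * fst t p + of_bool (snd t = p)) ts ! i)
       (map (\<lambda>t. 2 * fst t (p + 1) + of_bool (snd t = p + 1)) ts ! i)) [0..<num_tapes M]"
    using len v by (intro nth_equalityI) simp_all
  then show ?thesis
    unfolding cellv_def globv_def cell_fun_def c tm_step_total d by (simp add: d)
qed

lemma scanv_first:
  assumes "\<And>t. t \<in> set (snd c) \<Longrightarrow> p \<le> snd t"
  shows "scanv c p = scan_first (cellv c p)"
proof -
  have "(if snd t \<le> p then Suc (read_tape t) else 0) =
     (let c = 2 * fst t p + of_bool (snd t = p) in if odd c then Suc (c div 2) else 0)" if "t \<in> set (snd c)" for t
    using assms[OF that] by (auto simp: read_tape_def)
  then show ?thesis
    unfolding scanv_def scan_first_def cellv_def by (auto simp: Let_def intro!: arg_cong[of _ _ list_encode] map_cong)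
qed

lemma scanv_next: "scanv c (p + 1) = scan_fun (scanv c p) (cellv c (p + 1))"
  unfolding scanv_def scan_fun_def cellv_def
  by (intro arg_cong[of _ _ list_encode] nth_equalityI) (auto simp: read_tape_def)

lemma scan_decode:
  assumes "\<And>t. t \<in> set (snd c) \<Longrightarrow> snd t \<le> p"
  shows "map (\<lambda>z. z - 1) (list_decode (scanv c p)) = map read_tape (snd c)"
  using assms by (auto simp: scanv_def)

lemma globv_step:
  assumes "\<And>t. t \<in> set (snd (tm_step M c)) \<Longrightarrow> snd t \<le> p"
  shows "globv (tm_step M c) = glob_fun M (scanv (tm_step M c) p) (globv c)"
proof -
  obtain q ts where c: "c = (q, ts)" by (cases c)
  have "fst (tm_step M c) = fst (total_delta M q (map read_tape ts))"
    by (simp add: c tm_step_total split: prod.splits)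
  then show ?thesis
    using scan_decode[OF assms] by (simp add: glob_fun_def globv_def c)
qed

text \<open>Tapes, symbols and states of a fixed machine allow only finitely many codes, so the
  alphabet of the circuit does not grow with the input.\<close>

lemma codes_bounded:
  "\<exists>S. \<forall>c. valid_config M c \<longrightarrow> (\<forall>p. cellv c p < S \<and> scanv c p < S) \<and> globv c < S"
proof -
  define b where "b = 2 * num_symbols M + num_states M + 2"
  define L where "L = {xs. set xs \<subseteq> {..b} \<and> length xs \<le> num_tapes M + 1}"
  have "finite L" unfolding L_def by (rule finite_lists_length_le) simp
  then obtain S where S: "\<forall>y \<in> list_encode ` L. y < S"
    by (metis finite_imageI finite_nat_set_iff_bounded)
  have "(\<forall>p. cellv c p < S \<and> scanv c p < S) \<and> globv c < S" if v: "valid_config M c" for c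
  proof -
    have sym: "2 * fst t p + 1 \<le> b" "Suc (fst t p) \<le> b" "fst t p \<le> b" if "t \<in> set (snd c)" for t p
    proof -
      have "fst t p < num_symbols M" using v that by (auto simp: valid_config_def)
      then show "2 * fst t p + 1 \<le> b" "Suc (fst t p) \<le> b" "fst t p \<le> b" by (auto simp: b_def)
    qed
    have len: "length (snd c) = num_tapes M" "fst c \<le> b" using v by (auto simp: valid_config_def b_def)
    have "map (\<lambda>t. 2 * fst t p + of_bool (snd t = p)) (snd c) \<in> L" for p
      using sym(1)[of _ p] len by (fastforce simp: L_def)
    moreover have "map (\<lambda>t. if snd t \<le> p then Suc (read_tape t) else 0) (snd c) \<in> L" for p
      using sym(2) len by (auto simp: L_def read_tape_def)
    moreover have "fst c # map read_tape (snd c) \<in> L"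
      using sym(3) len by (auto simp: L_def read_tape_def)
    ultimately show ?thesis using S unfolding cellv_def scanv_def globv_def by blast
  qed
  then show ?thesis by blast
qed

text \<open>Stated for arbitrary arrays that obey the local rules, so that the circuit later only
  has to be checked rule by rule. Column \<open>Suc T\<close> is position 0 of the tapes; with more
  than \<open>2 * T\<close> positions to its right, nothing reaches the outer columns within
  \<open>T\<close> steps. \<open>cl\<close> stands for a truncation that fixes true codes.\<close>

lemma tableau_correct:
  fixes cv sv :: "nat \<Rightarrow> nat \<Rightarrow> nat" and gv :: "nat \<Rightarrow> nat" and w :: "nat \<Rightarrow> nat" and T A :: nat
  assumes wf: "wf_tm M" and S: "\<And>c. valid_config M c \<Longrightarrow> (\<forall>p. cellv c p < S \<and> scanv c p < S) \<and> globv c < S"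
    and z: "length z \<le> T" and A: "3 * T + 9 \<le> A" and w: "\<And>i. i + Suc T < A \<Longrightarrow> w i = tape_content z (int i)"
    and cl: "\<And>y. y < S \<Longrightarrow> cl y = y"
    and left: "\<And>\<tau>. \<tau> \<le> T \<Longrightarrow> cv \<tau> 0 = cl (blank_cell M)"
    and right: "\<And>\<tau>. \<tau> \<le> T \<Longrightarrow> cv \<tau> (A - 1) = cl (blank_cell M)"
    and c0: "\<And>i. 0 < i \<Longrightarrow> i < Suc T \<Longrightarrow> cv 0 i = cl (blank_cell M)"
    and c1: "cv 0 (Suc T) = cl (init_cell M 1 (w 0))"
    and c2: "\<And>i. 0 < i \<Longrightarrow> Suc T + i < A - 1 \<Longrightarrow> cv 0 (Suc T + i) = cl (init_cell M 0 (w i))"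
    and cS: "\<And>\<tau> i. \<tau> < T \<Longrightarrow> Suc i < A - 1 \<Longrightarrow>
      cv (Suc \<tau>) (Suc i) = cl (cell_fun M (cv \<tau> i) (cv \<tau> (Suc i)) (cv \<tau> (Suc (Suc i))) (gv \<tau>))"
    and s0: "\<And>\<tau>. \<tau> \<le> T \<Longrightarrow> sv \<tau> 0 = cl (scan_first (cv \<tau> 0))"
    and sS: "\<And>\<tau> i. \<tau> \<le> T \<Longrightarrow> Suc i < A \<Longrightarrow> sv \<tau> (Suc i) = cl (scan_fun (sv \<tau> i) (cv \<tau> (Suc i)))"
    and g0: "gv 0 = cl (glob_first (sv 0 (A - 1)))"
    and gS: "\<And>\<tau>. \<tau> < T \<Longrightarrow> gv (Suc \<tau>) = cl (glob_fun M (sv (Suc \<tau>) (A - 1)) (gv \<tau>))"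
    and "\<tau> \<le> T" "i < A"
  shows "cv \<tau> i = cellv (run_config M z \<tau>) (int i - int (Suc T))"
proof -
  let ?c = "run_config M z" and ?p = "\<lambda>i. int i - int (Suc T)"
  have B: "cl (cellv (?c \<tau>) p) = cellv (?c \<tau>) p" "cl (scanv (?c \<tau>) p) = scanv (?c \<tau>) p" "cl (globv (?c \<tau>)) = globv (?c \<tau>)"
    for \<tau> p using S[OF valid_run[OF wf]] cl by auto
  have win: "\<bar>snd t\<bar> \<le> int \<tau>" "p < - int \<tau> \<or> int \<tau> + int (length z) \<le> p \<Longrightarrow> fst t p = 0"
    if "t \<in> set (snd (?c \<tau>))" for t \<tau> p using run_window[OF wf, of z \<tau>] that by auto
  have out: "cellv (?c \<tau>) p = blank_cell M" if "\<tau> \<le> T" "p < - int T \<or> int T + int T < p" for \<tau> p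
  proof -
    have len: "length (snd (?c \<tau>)) = num_tapes M" using valid_run[OF wf] by (auto simp: valid_config_def)
    have "2 * fst t p + of_bool (snd t = p) = 0" if "t \<in> set (snd (?c \<tau>))" for t
      using win(1)[OF that] win(2)[OF that, of p] \<open>\<tau> \<le> T\<close> \<open>p < - int T \<or> int T + int T < p\<close> z by auto
    then have "map (\<lambda>t. 2 * fst t p + of_bool (snd t = p)) (snd (?c \<tau>)) = replicate (num_tapes M) 0"
      using len by (intro nth_equalityI) auto
    then show ?thesis by (simp add: cellv_def blank_cell_def)
  qed
  have init: "cellv (?c 0) p = (if 0 \<le> p then init_cell M (of_bool (p = 0)) (tape_content z p) else blank_cell M)" for p
  proof -
    have "0 < num_tapes M" using wf by (simp add: wf_tm_def)
    then obtain k where k: "num_tapes M = Suc k" by (cases "num_tapes M") auto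
    have "map (\<lambda>t. 2 * fst t p + of_bool (snd t = p)) (snd (?c 0)) =
       (2 * tape_content z p + of_bool (p = 0)) # replicate k (of_bool (p = 0))"
      by (auto simp: run_config_def init_config_def k tape_content_def)
    moreover have "p < 0 \<Longrightarrow> tape_content z p = 0" by (simp add: tape_content_def)
    ultimately show ?thesis by (auto simp: cellv_def init_cell_def blank_cell_def k)
  qed
  have scan: "sv \<tau> i = scanv (?c \<tau>) (?p i)" if "\<tau> \<le> T" "\<And>i. i < A \<Longrightarrow> cv \<tau> i = cellv (?c \<tau>) (?p i)" "i < A" for \<tau> i
    using that(3)
  proof (induction i)
    case 0
    have "?p 0 \<le> snd t" if "t \<in> set (snd (?c \<tau>))" for t using win(1)[OF that] \<open>\<tau> \<le> T\<close> by auto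
    then have "scanv (?c \<tau>) (?p 0) = scan_first (cellv (?c \<tau>) (?p 0))" by (rule scanv_first)
    then show ?case using s0[OF that(1)] that(2)[of 0] B(2)[of \<tau> "?p 0"] A by simp
  next
    case (Suc i)
    have "?p (Suc i) = ?p i + 1" by simp
    then have "scanv (?c \<tau>) (?p (Suc i)) = scan_fun (scanv (?c \<tau>) (?p i)) (cellv (?c \<tau>) (?p (Suc i)))"
      using scanv_next[of "?c \<tau>" "?p i"] by simp
    then show ?case using sS[OF that(1) Suc.prems] that(2)[OF Suc.prems] Suc B(2)[of \<tau> "?p (Suc i)"] by simp
  qed
  have last: "snd t \<le> ?p (A - 1)" if "t \<in> set (snd (?c \<tau>))" "\<tau> \<le> T" for t \<tau>
    using win(1)[OF that(1)] that(2) A by auto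
  \<comment> \<open>The induction carries \<open>gv\<close> along: the cells of the next row need
    the global symbol, which comes from the last scan entry of this row.\<close>
  have "(\<forall>i<A. cv \<tau> i = cellv (?c \<tau>) (?p i)) \<and> gv \<tau> = globv (?c \<tau>)" if "\<tau> \<le> T" for \<tau>
    using that
  proof (induction \<tau>)
    case 0
    have cv: "cv 0 i = cellv (?c 0) (?p i)" if iA: "i < A" for i
    proof -
      consider "i = 0" | "i = A - 1" | "0 < i" "i < Suc T" | "i = Suc T" | "Suc T < i" "i < A - 1"
        using iA by linarith
      then show ?thesis
      proof cases
        case 1
        then show ?thesis using left[of 0] out[of 0 "?p i"] B(1)[of 0 "?p i"] by simp
      next
        case 2
        then show ?thesis using right[of 0] out[of 0 "?p i"] B(1)[of 0 "?p i"] A by simp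
      next
        case 3
        then show ?thesis using c0[of i] init[of "?p i"] B(1)[of 0 "?p i"] by simp
      next
        case 4
        then show ?thesis using c1 init[of "?p i"] B(1)[of 0 "?p i"] w[of 0] A by simp
      next
        case 5
        then obtain k where k: "i = Suc T + k" "0 < k" using less_imp_add_positive by blast
        then have "?p i = int k" by simp
        then show ?thesis using c2[of k] 5 k init[of "?p i"] B(1)[of 0 "?p i"] w[of k] by simp
      qed
    qed
    have "sv 0 (A - 1) = scanv (?c 0) (?p (A - 1))" using scan[of 0 "A - 1"] cv A by simp
    moreover have "glob_first (scanv (?c 0) (?p (A - 1))) = globv (?c 0)"
      using scan_decode[of "?c 0" "?p (A - 1)"] last[of _ 0]
      by (simp add: glob_first_def globv_def run_config_def init_config_def)
    ultimately show ?case using cv g0 B(3)[of 0] by simp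
  next
    case (Suc \<tau>)
    then have IH: "\<And>i. i < A \<Longrightarrow> cv \<tau> i = cellv (?c \<tau>) (?p i)" "gv \<tau> = globv (?c \<tau>)" by auto
    have cv: "cv (Suc \<tau>) i = cellv (?c (Suc \<tau>)) (?p i)" if iA: "i < A" for i
    proof -
      consider "i = 0" | "i = A - 1" | k where "i = Suc k" "Suc k < A - 1"
        using iA by (cases i) (auto, linarith)
      then show ?thesis
      proof cases
        case 1
        then show ?thesis using left[OF Suc.prems] out[OF Suc.prems, of "?p i"] B(1)[of "Suc \<tau>" "?p i"] by simp
      next
        case 2
        then show ?thesis using right[OF Suc.prems] out[OF Suc.prems, of "?p i"] B(1)[of "Suc \<tau>" "?p i"] A by simp
      next
        case 3
        have p: "?p (Suc k) - 1 = ?p k" "?p (Suc k) + 1 = ?p (Suc (Suc k))" by auto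
        have "cellv (?c (Suc \<tau>)) (?p i) = cell_fun M (cellv (?c \<tau>) (?p k)) (cellv (?c \<tau>) (?p (Suc k)))
           (cellv (?c \<tau>) (?p (Suc (Suc k)))) (globv (?c \<tau>))"
          unfolding run_config_Suc 3(1) cellv_step[OF wf valid_run[OF wf]] p ..
        then show ?thesis using cS[of \<tau> k] IH 3 Suc.prems B(1)[of "Suc \<tau>" "?p i"] by simp
      qed
    qed
    have "sv (Suc \<tau>) (A - 1) = scanv (?c (Suc \<tau>)) (?p (A - 1))" using scan[OF Suc.prems cv, of "A - 1"] A by simp
    moreover have "glob_fun M (scanv (?c (Suc \<tau>)) (?p (A - 1))) (globv (?c \<tau>)) = globv (?c (Suc \<tau>))"
      using globv_step[of M "?c \<tau>" "?p (A - 1)"] last[of _ "Suc \<tau>"] Suc.prems by (simp add: run_config_Suc)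
    ultimately show ?case using cv gS[of \<tau>] Suc.prems IH B(3)[of "Suc \<tau>"] by simp
  qed
  then show ?thesis using assms by blast
qed

lemma out_symbol_cellv:
  assumes "wf_tm M"
  shows "out_symbol (cellv (run_config M z \<tau>) p) = fst (snd (run_config M z \<tau>) ! 1) p"
proof -
  have "1 < length (snd (run_config M z \<tau>))"
    using valid_run[OF assms, of z \<tau>] assms by (auto simp: valid_config_def wf_tm_def)
  then show ?thesis by (simp add: out_symbol_def cellv_def)
qed

lemma computes_within_output:
  assumes "computes_within M z y t" "t \<le> \<tau>"
  shows "fst (snd (run_config M z \<tau>) ! 1) = tape_content y"
  using computes_within_mono[OF assms] by (auto simp: computes_within_def run_config_def split: prod.splits)

text \<open>Cells outside the window of the run are blank. This bounds the number and the lengths of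
  the queries.\<close>

lemma computes_within_length:
  assumes "wf_tm M" "computes_within M z y t"
  shows "length y \<le> t + length z"
proof (rule ccontr)
  assume "\<not> length y \<le> t + length z"
  then have "tape_content y (int (t + length z)) \<noteq> 0" by (simp add: tape_content_def)
  moreover have "1 < length (snd (run_config M z t))"
    using valid_run[OF assms(1), of z t] assms(1) by (auto simp: valid_config_def wf_tm_def)
  then have "fst (snd (run_config M z t) ! 1) (int (t + length z)) = 0"
    using run_window[OF assms(1), of z t] by auto
  ultimately show False using computes_within_output[OF assms(2) order_refl] by simp
qed

subsection \<open>A circuit for truth-table reductions\<close>

lemma sum_lessThan_add: "(\<Sum>u<(a :: nat) + b. f u) = (\<Sum>u<a. f u) + (\<Sum>u<b. f (a + u) :: nat)"
  by (induction b) (auto simp: add.assoc)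

lemma length_encode_string [simp]: "length (encode_string x) = 2 * length x + 2"
  by (induction x) (auto simp: encode_string_def)

lemma encode_string_Cons: "encode_string (b # x) = b # b # encode_string x"
  by (simp add: encode_string_def)

lemma nth_encode_string:
  "i < 2 * length x + 2 \<Longrightarrow>
   encode_string x ! i = (if i < 2 * length x then x ! (i div 2) else i = 2 * length x + 1)"
proof (induction x arbitrary: i)
  case Nil
  then have "i = 0 \<or> i = 1" by auto
  then show ?case by (auto simp: encode_string_def)
next
  case (Cons b x)
  consider "i = 0" | "i = 1" | k where "i = k + 2" by (metis One_nat_def Suc_1 add.commute add_Suc_right not0_implies_Suc plus_1_eq_Suc)
  then show ?case
  proof cases
    case 3
    then have "encode_string x ! k = (if k < 2 * length x then x ! (k div 2) else k = 2 * length x + 1)"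
      using Cons by auto
    then show ?thesis using 3 by (auto simp: encode_string_Cons)
  qed (auto simp: encode_string_Cons)
qed

lemma tape_content_nat:
  "tape_content x (int i) = (if i < length x then if x ! i then 2 else 1 else 0)"
  by (simp add: tape_content_def)

lemma tape_content_append:
  "tape_content (x @ y) (int i) = (if i < length x then tape_content x (int i) else tape_content y (int (i - length x)))"
  by (auto simp: tape_content_nat nth_append simp del: of_nat_diff)

lemma tape_content_encode_string:
  "tape_content (encode_string x) (int i) = (if i < 2 * length x then tape_content x (int (i div 2))
     else if i = 2 * length x then 1 else if i = 2 * length x + 1 then 2 else 0)"
  by (auto simp: tape_content_nat nth_encode_string)

text \<open>Positions in a coded list are counted in pairs of bits; a coded string is terminated by the pair 01.\<close>

definition pair_start :: "bool list list \<Rightarrow> nat \<Rightarrow> nat" where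
  "pair_start qs k = (\<Sum>j<k. length (qs ! j) + 1)"

lemma pair_start_Suc [simp]: "pair_start qs (Suc k) = pair_start qs k + (length (qs ! k) + 1)"
  by (simp add: pair_start_def)

lemma pair_start_mono: "k \<le> k' \<Longrightarrow> pair_start qs k \<le> pair_start qs k'"
  unfolding pair_start_def by (intro sum_mono2) auto

lemma pair_start_less: "k < k' \<Longrightarrow> pair_start qs k + length (qs ! k) < pair_start qs k'"
  using pair_start_mono[of "Suc k" k' qs] by simp

lemma pair_start_inj: "pair_start qs k = pair_start qs k' \<Longrightarrow> k = k'"
  using pair_start_less[of k k' qs] pair_start_less[of k' k qs] by (cases k k' rule: linorder_cases) auto

lemma length_encode_list: "length (encode_list qs) = 2 * pair_start qs (length qs)"
proof (induction qs rule: rev_induct)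
  case (snoc q qs)
  have "pair_start (qs @ [q]) (length qs) = pair_start qs (length qs)"
    unfolding pair_start_def by (intro sum.cong) (auto simp: nth_append)
  then show ?case using snoc by (simp add: encode_list_def)
qed (simp add: encode_list_def pair_start_def)

lemma tape_content_encode_list:
  assumes "k < length qs" "i < 2 * length (qs ! k) + 2"
  shows "tape_content (encode_list qs) (int (2 * pair_start qs k + i)) = tape_content (encode_string (qs ! k)) (int i)"
proof -
  have "encode_list qs = encode_list (take k qs) @ encode_string (qs ! k) @ encode_list (drop (Suc k) qs)"
    by (subst id_take_nth_drop[OF assms(1)]) (simp add: encode_list_def)
  moreover have "length (encode_list (take k qs)) = 2 * pair_start qs k"
  proof -
    have "pair_start (take k qs) k = pair_start qs k"
      unfolding pair_start_def using assms(1) by (intro sum.cong) auto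
    then show ?thesis using assms(1) by (simp add: length_encode_list)
  qed
  ultimately show ?thesis
    using assms(2) by (simp add: tape_content_append del: of_nat_add of_nat_mult)
qed

definition term_at :: "bool list list \<Rightarrow> nat \<Rightarrow> bool" where
  "term_at qs u \<longleftrightarrow> tape_content (encode_list qs) (int (2 * u)) = 1 \<and> tape_content (encode_list qs) (int (2 * u + 1)) = 2"

definition start_at :: "bool list list \<Rightarrow> nat \<Rightarrow> bool" where
  "start_at qs s \<longleftrightarrow> (s = 0 \<or> term_at qs (s - 1)) \<and> tape_content (encode_list qs) (int (2 * s)) \<noteq> 0"

text \<open>Where the queries begin is known only during the computation, so every start
  \<open>s\<close> and length \<open>l\<close> is a candidate; this test, made of local conditions,
  singles out the actual queries.\<close>

definition active :: "bool list list \<Rightarrow> nat \<Rightarrow> nat \<Rightarrow> bool" where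
  "active qs s l \<longleftrightarrow> start_at qs s \<and> (\<forall>k<l. \<not> term_at qs (s + k)) \<and> term_at qs (s + l)"

lemma term_at_block:
  assumes "k < length qs" "j \<le> length (qs ! k)"
  shows "term_at qs (pair_start qs k + j) \<longleftrightarrow> j = length (qs ! k)"
proof -
  have "2 * (pair_start qs k + j) = 2 * pair_start qs k + 2 * j" by simp
  then have "tape_content (encode_list qs) (int (2 * (pair_start qs k + j))) = tape_content (encode_string (qs ! k)) (int (2 * j))"
    using tape_content_encode_list[OF assms(1), of "2 * j"] assms(2) by simp
  moreover have "2 * (pair_start qs k + j) + 1 = 2 * pair_start qs k + (2 * j + 1)" by simp
  then have "tape_content (encode_list qs) (int (2 * (pair_start qs k + j) + 1)) = tape_content (encode_string (qs ! k)) (int (2 * j + 1))"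
    using tape_content_encode_list[OF assms(1), of "2 * j + 1"] assms(2) by simp
  ultimately have *: "term_at qs (pair_start qs k + j) \<longleftrightarrow> tape_content (encode_string (qs ! k)) (int (2 * j)) = 1 \<and>
      tape_content (encode_string (qs ! k)) (int (2 * j + 1)) = 2"
    by (simp only: term_at_def)
  show ?thesis
  proof (cases "j = length (qs ! k)")
    case True
    then show ?thesis unfolding * tape_content_encode_string by simp
  next
    case False
    then have "2 * j < 2 * length (qs ! k)" "2 * j + 1 < 2 * length (qs ! k)" "(2 * j + 1) div 2 = j" "2 * j div 2 = j"
      using assms(2) by auto
    then show ?thesis unfolding * tape_content_encode_string using False by simp
  qed
qed

lemma pair_index_ex:
  assumes "u < pair_start qs m"
  shows "\<exists>k<m. \<exists>j \<le> length (qs ! k). u = pair_start qs k + j"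
  using assms
proof (induction m)
  case (Suc m)
  show ?case
  proof (cases "u < pair_start qs m")
    case True
    then show ?thesis using Suc.IH less_SucI by blast
  next
    case False
    then have "u = pair_start qs m + (u - pair_start qs m)" "u - pair_start qs m \<le> length (qs ! m)"
      using Suc.prems by auto
    then show ?thesis by blast
  qed
qed (simp add: pair_start_def)

lemma active_iff: "active qs s l \<longleftrightarrow> (\<exists>k<length qs. s = pair_start qs k \<and> l = length (qs ! k))"
proof
  assume act: "active qs s l"
  then have "tape_content (encode_list qs) (int (2 * s)) \<noteq> 0" by (simp add: active_def start_at_def)
  then have "s < pair_start qs (length qs)"
    using length_encode_list[of qs] by (auto simp: tape_content_nat simp del: of_nat_mult split: if_splits)
  then obtain k j where kj: "k < length qs" "j \<le> length (qs ! k)" "s = pair_start qs k + j"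
    using pair_index_ex by blast
  \<comment> \<open>Inside a block, the preceding pair belongs to the same string and is no
    terminator.\<close>
  have "j = 0"
  proof (rule ccontr)
    assume "j \<noteq> 0"
    then have "s - 1 = pair_start qs k + (j - 1)" "s \<noteq> 0" using kj by auto
    then have "term_at qs (pair_start qs k + (j - 1))" using act by (auto simp: active_def start_at_def)
    then have "j - 1 = length (qs ! k)" using term_at_block[OF kj(1), of "j - 1"] kj(2) by simp
    then show False using kj(2) \<open>j \<noteq> 0\<close> by linarith
  qed
  moreover have "l = length (qs ! k)"
  proof (cases "l \<le> length (qs ! k)")
    case True
    then show ?thesis using act term_at_block[OF kj(1) True] kj \<open>j = 0\<close> by (auto simp: active_def)
  next
    case False
    then show ?thesis using act term_at_block[OF kj(1) order_refl] kj \<open>j = 0\<close> by (auto simp: active_def)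
  qed
  ultimately show "\<exists>k<length qs. s = pair_start qs k \<and> l = length (qs ! k)" using kj by auto
next
  assume "\<exists>k<length qs. s = pair_start qs k \<and> l = length (qs ! k)"
  then obtain k where k: "k < length qs" "s = pair_start qs k" "l = length (qs ! k)" by blast
  have "s < pair_start qs (length qs)" using k pair_start_less[of k "length qs" qs] by simp
  then have "tape_content (encode_list qs) (int (2 * s)) \<noteq> 0"
    by (simp add: tape_content_nat length_encode_list del: of_nat_mult)
  moreover have "s = 0 \<or> term_at qs (s - 1)"
  proof (cases k)
    case 0
    then show ?thesis using k by (simp add: pair_start_def)
  next
    case (Suc k')
    then have "s - 1 = pair_start qs k' + length (qs ! k')" using k by simp
    then show ?thesis using term_at_block[of k' qs "length (qs ! k')"] k Suc by simp
  qed
  moreover have "\<forall>j<l. \<not> term_at qs (s + j)" using term_at_block[OF k(1)] k by auto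
  moreover have "term_at qs (s + l)" using term_at_block[OF k(1)] k by auto
  ultimately show "active qs s l" by (simp add: active_def start_at_def)
qed

text \<open>The index of a query is the number of terminators before its start; this puts candidates
  back into the order of the answer list.\<close>

lemma rank_start:
  assumes "k \<le> length qs"
  shows "(\<Sum>u<pair_start qs k. of_bool (term_at qs u)) = k"
  using assms
proof (induction k)
  case (Suc k)
  have "(\<Sum>u<length (qs ! k) + 1. of_bool (term_at qs (pair_start qs k + u))) = (1 :: nat)"
    using term_at_block[of k qs] Suc.prems by simp
  then show ?case
    using Suc unfolding pair_start_Suc sum_lessThan_add by simp
qed (simp add: pair_start_def)

lemma nat_poly_mono: "a \<le> b \<Longrightarrow> poly p a \<le> poly p (b :: nat)"
  by (induction p) (auto intro: add_mono mult_mono)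

definition sel :: "nat \<Rightarrow> nat \<Rightarrow> nat \<Rightarrow> nat \<Rightarrow> nat \<Rightarrow> nat \<Rightarrow> nat" where
  "sel c a0 a1 a2 a3 k = (if c = 0 then a0 else if c = 1 then a1 else if c = 2 then a2 else if c = 3 then a3 else k)"

lemma sel_simps [simp]:
  "sel 0 a0 a1 a2 a3 k = a0" "sel (Suc 0) a0 a1 a2 a3 k = a1" "sel 1 a0 a1 a2 a3 k = a1" "sel 2 a0 a1 a2 a3 k = a2"
  "sel 3 a0 a1 a2 a3 k = a3" "sel 4 a0 a1 a2 a3 k = k"
  by (auto simp: sel_def)

definition symat :: "bool list \<Rightarrow> nat \<Rightarrow> nat" where
  "symat x i = (if i < length x then Suc (bit_at x i) else 0)"

lemma symat_tape: "symat x i = tape_content x (int i)"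
  by (simp add: symat_def tape_content_nat bit_at_def)

text \<open>The eight rules of a tableau; kind \<open>16 + 8 * m + c\<close> of a gate stands for
  rule \<open>c\<close> of machine \<open>m\<close>.\<close>

definition run_tab :: "tm \<Rightarrow> nat \<Rightarrow> (nat \<Rightarrow> nat) \<Rightarrow> nat" where
  "run_tab M c a = (if c = 0 then init_cell M 0 (a 0) else if c = 1 then init_cell M 1 (a 0)
     else if c = 2 then blank_cell M else if c = 3 then cell_fun M (a 0) (a 1) (a 2) (a 3)
     else if c = 4 then scan_first (a 0) else if c = 5 then scan_fun (a 0) (a 1)
     else if c = 6 then glob_first (a 0) else glob_fun M (a 0) (a 1))"

text \<open>Certificates of any length up to \<open>P\<close> are guessed symbol by symbol; the
  guess is a string as soon as no symbol follows a blank.\<close>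

lemma tape_of_cells:
  fixes c :: "nat \<Rightarrow> nat"
  assumes "\<And>i. c i < 3" "\<And>i. c i = 0 \<Longrightarrow> c (Suc i) = 0" "\<And>i. P \<le> i \<Longrightarrow> c i = 0"
  shows "\<exists>y. length y \<le> P \<and> (\<forall>i. c i = tape_content y (int i))"
proof -
  define n where "n = (LEAST i. c i = 0)"
  have n: "c n = 0" unfolding n_def by (rule LeastI[of _ P]) (simp add: assms(3))
  have "n \<le> P" unfolding n_def by (rule Least_le) (simp add: assms(3))
  have lo: "c i \<noteq> 0" if "i < n" for i using that not_less_Least unfolding n_def by blast
  have hi: "c (n + i) = 0" for i by (induction i) (auto simp: n assms(2))
  define y where "y = map (\<lambda>i. c i = 2) [0..<n]"
  have "c i = tape_content y (int i)" for i
  proof (cases "i < n")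
    case True
    then show ?thesis using lo[OF True] assms(1)[of i] by (auto simp: tape_content_nat y_def)
  next
    case False
    then show ?thesis using hi[of "i - n"] by (simp add: tape_content_nat y_def)
  qed
  moreover have "length y \<le> P" using \<open>n \<le> P\<close> by (simp add: y_def)
  ultimately show ?thesis by blast
qed

locale tt_reduction =
  fixes MQ MR MD :: tm and pQ pR pD pB :: "nat poly" and Q :: "bool list \<Rightarrow> bool list list"
    and R D B A :: "bool list set" and S :: nat
  assumes wfQ: "wf_tm MQ" and wfR: "wf_tm MR" and wfD: "wf_tm MD"
    and cQ: "\<And>x. computes_within MQ x (encode_list (Q x)) (poly pQ (length x))"
    and cR: "\<And>x. computes_within MR x [x \<in> R] (poly pR (length x))"
    and cD: "\<And>x. computes_within MD x [x \<in> D] (poly pD (length x))"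
    and B_iff: "\<And>x. x \<in> B \<longleftrightarrow> (\<exists>y. length y \<le> poly pB (length x) \<and> encode_pair x y \<in> R)"
    and A_iff: "\<And>x. x \<in> A \<longleftrightarrow> encode_pair x (map (\<lambda>q. q \<in> B) (Q x)) \<in> D"
    and S3: "3 \<le> S"
    and SQ: "\<And>c. valid_config MQ c \<Longrightarrow> (\<forall>p. cellv c p < S \<and> scanv c p < S) \<and> globv c < S"
    and SR: "\<And>c. valid_config MR c \<Longrightarrow> (\<forall>p. cellv c p < S \<and> scanv c p < S) \<and> globv c < S"
    and SD: "\<And>c. valid_config MD c \<Longrightarrow> (\<forall>p. cellv c p < S \<and> scanv c p < S) \<and> globv c < S"
begin

text \<open>\<open>U x\<close> bounds the number and the lengths of the queries, \<open>W x\<close> and \<open>V x\<close> the inputs of \<open>MR\<close> and \<open>MD\<close>, and \<open>T x\<close>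
  all running times.\<close>

definition U :: "bool list \<Rightarrow> nat" where "U x = Suc (poly pQ (length x) + length x)"
definition W :: "bool list \<Rightarrow> nat" where "W x = 2 * U x + 2 + poly pB (U x)"
definition V :: "bool list \<Rightarrow> nat" where "V x = 2 * length x + 2 + U x"
definition T :: "bool list \<Rightarrow> nat" where
  "T x = 4 * U x + W x + V x + poly pQ (length x) + poly pR (W x) + poly pD (V x)"
text \<open>\<open>K x\<close> is the width of a tableau and also the radix of gate addresses, large
  enough for the \<open>3 * T x + 3\<close> rows; \<open>J x\<close> counts the addresses of twelve
  blocks with four further digits.\<close>

definition K :: "bool list \<Rightarrow> nat" where "K x = 3 * T x + 9"
definition J :: "bool list \<Rightarrow> nat" where "J x = 12 * K x ^ 4"

text \<open>The most significant digit comes first, so gates are ordered lexicographically by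
  address; this is how sources are seen to precede their gates.\<close>

definition gt :: "bool list \<Rightarrow> nat \<Rightarrow> nat \<Rightarrow> nat \<Rightarrow> nat \<Rightarrow> nat \<Rightarrow> nat" where
  "gt x b s l t i = (((b * K x + s) * K x + l) * K x + t) * K x + i"

text \<open>A machine step takes three rows, consisting of the codes \<open>cellv\<close>, \<open>scanv\<close> and \<open>globv\<close>.\<close>

definition run_spec :: "bool list \<Rightarrow> nat \<Rightarrow> nat \<Rightarrow> nat \<Rightarrow> nat \<Rightarrow> nat \<Rightarrow> nat \<Rightarrow> nat \<Rightarrow> nat" where
  "run_spec x c m b s l t i =
    (if t mod 3 = 0 then
       if i = 0 \<or> K x \<le> Suc i then sel c (J x) (J x) (J x) (J x) (18 + 8 * m)
       else if t = 0 then
         if i < Suc (T x) then sel c (J x) (J x) (J x) (J x) (18 + 8 * m)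
         else sel c (gt x (b - 1) s l 0 (i - Suc (T x))) (J x) (J x) (J x) (16 + 8 * m + (if i = Suc (T x) then 1 else 0))
       else sel c (gt x b s l (t - 3) (i - 1)) (gt x b s l (t - 3) i) (gt x b s l (t - 3) (Suc i)) (gt x b s l (t - 1) 0)
         (19 + 8 * m)
     else if t mod 3 = 1 then
       if i = 0 then sel c (gt x b s l (t - 1) 0) (J x) (J x) (J x) (20 + 8 * m)
       else sel c (gt x b s l t (i - 1)) (gt x b s l (t - 1) i) (J x) (J x) (21 + 8 * m)
     else if t = 2 then sel c (gt x b s l (t - 1) (K x - 1)) (J x) (J x) (J x) (22 + 8 * m)
     else sel c (gt x b s l (t - 1) (K x - 1)) (gt x b s l (t - 3) 0) (J x) (J x) (23 + 8 * m))"

definition konst :: "bool list \<Rightarrow> nat \<Rightarrow> nat \<Rightarrow> nat" where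
  "konst x c k = sel c (J x) (J x) (J x) (J x) k"

abbreviation owire :: "bool list \<Rightarrow> nat \<Rightarrow> nat" where "owire x i \<equiv> gt x 2 0 0 0 i"

text \<open>Gates are addressed by a block \<open>b\<close>, a query candidate (first pair \<open>s\<close> and length \<open>l\<close> of the
  query inside the coded query list), a row \<open>t\<close> and a column \<open>i\<close>. The blocks are: 0 the input, 1 the run of
  \<open>MQ\<close>, 2 its output, 3 the query delimiters, 4 the ranks of the queries, 5 the inputs of \<open>MR\<close> with guessed
  certificates, 6 the runs of \<open>MR\<close>, 7 the answers, 8 the answers sorted by rank, 9 the input of \<open>MD\<close>, 10 its
  run, 11 its output. Argument \<open>c\<close> selects one of the four sources of a gate, or its kind if \<open>c = 4\<close>; the
  source \<open>J x\<close> stands for a free slot.\<close>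

definition spec :: "bool list \<Rightarrow> nat \<Rightarrow> nat \<Rightarrow> nat \<Rightarrow> nat \<Rightarrow> nat \<Rightarrow> nat \<Rightarrow> nat" where
  "spec x c b s l t i =
    (if b = 0 then konst x c (symat x i)
     else if b = 1 then run_spec x c 0 b s l t i
     else if b = 2 then
       if i + Suc (T x) < K x then sel c (gt x 1 0 0 (3 * T x) (Suc (T x) + i)) (J x) (J x) (J x) 6 else konst x c 0
     else if b = 3 then
       if s < U x \<and> l < U x then
         if l = 0 then
           if s = 0 then sel c (owire x 0) (J x) (J x) (J x) 8
           else sel c (owire x (2 * (s - 1))) (owire x (2 * (s - 1) + 1)) (owire x (2 * s)) (J x) 7
         else sel c (gt x 3 s (l - 1) 0 0) (owire x (2 * (s + (l - 1)))) (owire x (2 * (s + (l - 1)) + 1)) (J x) 9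
       else konst x c 0
     else if b = 4 then
       if t < U x then
         if t = 0 then konst x c (if i = 0 then 1 else 0)
         else if i = 0 then
           sel c (owire x (2 * (t - 1))) (owire x (2 * (t - 1) + 1)) (gt x 4 0 0 (t - 1) 0) (J x) 11
         else sel c (owire x (2 * (t - 1))) (owire x (2 * (t - 1) + 1)) (gt x 4 0 0 (t - 1) i) (gt x 4 0 0 (t - 1) (i - 1)) 10
       else konst x c 0
     else if b = 5 then
       if s < U x \<and> l < U x then
         if i < 2 * l + 2 then sel c (owire x (2 * s + i)) (J x) (J x) (J x) 5
         else if i < 2 * l + 2 + poly pB l then
           if i = 2 * l + 2 then sel c (J x) (J x) (J x) (J x) 3
           else sel c (J x) (gt x 5 s l 0 (i - 1)) (J x) (J x) 4
         else konst x c 0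
       else konst x c 0
     else if b = 6 then run_spec x c 1 b s l t i
     else if b = 7 then
       if s < U x \<and> l < U x \<and> t = 0 \<and> i = 0 then
         sel c (gt x 3 s l 0 0) (owire x (2 * (s + l))) (owire x (2 * (s + l) + 1)) (gt x 6 s l (3 * T x) (Suc (T x))) 12
       else konst x c 0
     else if b = 8 then
       if s < U x \<and> l < U x then
         if s = 0 \<and> l = 0 then sel c (J x) (gt x 7 s l 0 0) (gt x 4 0 0 s i) (J x) 14
         else sel c (if l = 0 then gt x 8 (s - 1) (U x - 1) 0 i else gt x 8 s (l - 1) 0 i)
           (gt x 7 s l 0 0) (gt x 4 0 0 s i) (J x) 13
       else konst x c 0
     else if b = 9 then
       if i < 2 * length x then konst x c (symat x (i div 2))
       else if i = 2 * length x then konst x c 1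
       else if i = 2 * length x + 1 then konst x c 2
       else sel c (gt x 8 (U x - 1) (U x - 1) 0 (i - (2 * length x + 2))) (J x) (J x) (J x) 5
     else if b = 10 then run_spec x c 2 b s l t i
     else if b = 11 then
       if s = 0 \<and> l = 0 \<and> t = 0 \<and> i = 0 then sel c (gt x 10 0 0 (3 * T x) (Suc (T x))) (J x) (J x) (J x) 15
       else konst x c 0
     else konst x c 0)"

definition src :: "bool list \<Rightarrow> nat \<Rightarrow> nat \<Rightarrow> nat" where
  "src x c j = spec x c (j div K x ^ 4) (j div K x ^ 3 mod K x) (j div K x ^ 2 mod K x) (j div K x mod K x) (j mod K x)"

definition mach :: "nat \<Rightarrow> tm" where
  "mach m = (if m = 0 then MQ else if m = 1 then MR else MD)"

text \<open>Kinds 0 to 2 are constants, 3 and 4 guess a certificate symbol, 5 copies, 6 reads an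
  output tape, 7 to 9 test candidates, 10 and 11 update ranks, 12 gives a verdict (2 for yes, 1 for
  no, 0 if there is no query), 13 and 14 sort the verdicts, 15 reads the decision. From 16 on there
  are eight kinds for each of the three machines.\<close>

definition kind_fun :: "nat \<Rightarrow> (nat \<Rightarrow> nat) \<Rightarrow> nat" where
  "kind_fun k a =
    (if k < 3 then k
     else if k = 3 then a 0 mod 3
     else if k = 4 then if a 1 = 0 then 0 else a 0 mod 3
     else if k = 5 then a 0
     else if k = 6 then out_symbol (a 0)
     else if k = 7 then of_bool (a 0 = 1 \<and> a 1 = 2 \<and> a 2 \<noteq> 0)
     else if k = 8 then of_bool (a 0 \<noteq> 0)
     else if k = 9 then of_bool (a 0 = 1 \<and> \<not> (a 1 = 1 \<and> a 2 = 2))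
     else if k = 10 then if a 0 = 1 \<and> a 1 = 2 then a 3 else a 2
     else if k = 11 then if a 0 = 1 \<and> a 1 = 2 then 0 else a 2
     else if k = 12 then if a 0 = 1 \<and> a 1 = 1 \<and> a 2 = 2 then if out_symbol (a 3) = 2 then 2 else 1 else 0
     else if k = 13 then if a 1 \<noteq> 0 \<and> a 2 = 1 then a 1 else a 0
     else if k = 14 then if a 1 \<noteq> 0 \<and> a 2 = 1 then a 1 else 0
     else if k = 15 then of_bool (out_symbol (a 0) = 2)
     else run_tab (mach ((k - 16) div 8)) ((k - 16) mod 8) a)"

definition clip :: "nat \<Rightarrow> nat" where "clip y = (if y < S then y else 0)"

text \<open>Kind and assignment share one number below the constant \<open>40 * S ^ 4\<close>, so
  that the gate function is a finite table and \<open>pexp_table\<close> applies, whatever the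
  machines compute.\<close>

definition table :: "nat \<Rightarrow> nat" where
  "table m = (if m < 40 * S ^ 4 then clip (kind_fun (m div S ^ 4) (\<lambda>l. dig S l (m mod S ^ 4))) else 0)"

definition out :: "bool list \<Rightarrow> nat \<Rightarrow> nat \<Rightarrow> nat" where
  "out x j a = table (src x 4 j * S ^ 4 + a)"

lemma clip_less: "clip y < S"
  using S3 by (simp add: clip_def)

lemma clip_id: "y < S \<Longrightarrow> clip y = y"
  by (simp add: clip_def)

lemma out_less: "out x j a < S"
  using S3 clip_less by (simp add: out_def table_def)

lemma K_pos: "0 < K x" by (simp add: K_def)

lemma gt_less:
  assumes "s < K x" "l < K x" "t < K x" "i < K x"
    "b < b' \<or> b = b' \<and> (s < s' \<or> s = s' \<and> (l < l' \<or> l = l' \<and> (t < t' \<or> t = t' \<and> i < i')))"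
  shows "gt x b s l t i < gt x b' s' l' t' i'"
proof -
  have *: "p * K x + r < p' * K x + r'" if "p < p'" "r < K x" for p p' r r'
  proof -
    have "p * K x + r < Suc p * K x" using that by simp
    also have "\<dots> \<le> p' * K x" using that by (intro mult_le_mono1) simp
    finally show ?thesis by simp
  qed
  have 1: "b * K x + s < b' * K x + s' \<or> b = b' \<and> s = s' \<and> (l < l' \<or> l = l' \<and> (t < t' \<or> t = t' \<and> i < i'))"
    using assms *[of b b' s s'] by auto
  have 2: "(b * K x + s) * K x + l < (b' * K x + s') * K x + l' \<or>
      b = b' \<and> s = s' \<and> l = l' \<and> (t < t' \<or> t = t' \<and> i < i')"
    using 1 assms(2) *[of "b * K x + s" "b' * K x + s'" l l'] by auto
  have 3: "((b * K x + s) * K x + l) * K x + t < ((b' * K x + s') * K x + l') * K x + t' \<or>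
      b = b' \<and> s = s' \<and> l = l' \<and> t = t' \<and> i < i'"
    using 2 assms(3) *[of "(b * K x + s) * K x + l" "(b' * K x + s') * K x + l'" t t'] by auto
  then show ?thesis
    using assms(4) *[of "((b * K x + s) * K x + l) * K x + t" "((b' * K x + s') * K x + l') * K x + t'" i i']
    unfolding gt_def by auto
qed

lemma gt_decode:
  assumes "s < K x" "l < K x" "t < K x" "i < K x"
  shows "gt x b s l t i div K x ^ 4 = b" "gt x b s l t i div K x ^ 3 mod K x = s"
    "gt x b s l t i div K x ^ 2 mod K x = l" "gt x b s l t i div K x mod K x = t" "gt x b s l t i mod K x = i"
proof -
  have 1: "gt x b s l t i div K x = ((b * K x + s) * K x + l) * K x + t" using assms by (simp add: gt_def)
  have p: "j div K x ^ 2 = j div K x div K x" "j div K x ^ 3 = j div K x div K x div K x"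
    "j div K x ^ 4 = j div K x div K x div K x div K x" for j
    by (simp_all add: eval_nat_numeral div_mult2_eq)
  show "gt x b s l t i div K x ^ 4 = b" "gt x b s l t i div K x ^ 3 mod K x = s"
    "gt x b s l t i div K x ^ 2 mod K x = l" "gt x b s l t i div K x mod K x = t" "gt x b s l t i mod K x = i"
    unfolding p 1 using assms by (simp_all add: gt_def)
qed

lemma gt_encode: "gt x (j div K x ^ 4) (j div K x ^ 3 mod K x) (j div K x ^ 2 mod K x) (j div K x mod K x) (j mod K x) = j"
proof -
  have p: "j div K x ^ 2 = j div K x div K x" "j div K x ^ 3 = j div K x div K x div K x"
    "j div K x ^ 4 = j div K x div K x div K x div K x"
    by (simp_all add: eval_nat_numeral div_mult2_eq)
  show ?thesis unfolding p gt_def by simp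
qed

lemma gt_less_J: "b < 12 \<Longrightarrow> s < K x \<Longrightarrow> l < K x \<Longrightarrow> t < K x \<Longrightarrow> i < K x \<Longrightarrow> gt x b s l t i < J x"
proof -
  assume *: "b < 12" "s < K x" "l < K x" "t < K x" "i < K x"
  have "gt x 12 0 0 0 0 = J x" by (simp add: gt_def J_def power4_eq_xxxx)
  then show ?thesis using gt_less[OF *(2-5), of b 12 0 0 0 0] * by simp
qed

lemma symat_le: "symat x i < 40"
  by (simp add: symat_def bit_at_def)

lemma if_lessI: "a < (n :: nat) \<Longrightarrow> b < n \<Longrightarrow> (if P then a else b) < n"
  by simp

lemma spec_kind_less: "spec x 4 b s l t i < 40"
  unfolding spec_def run_spec_def konst_def sel_simps
  by (intro if_lessI symat_le; simp)

lemma spec_run: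
  "spec x c 1 s l t i = run_spec x c 0 1 s l t i" "spec x c 6 s l t i = run_spec x c 1 6 s l t i"
  "spec x c 10 s l t i = run_spec x c 2 10 s l t i"
  by (simp_all add: spec_def)

lemma bounds:
  "4 * U x \<le> T x" "W x \<le> T x" "V x \<le> T x" "poly pQ (length x) \<le> T x" "poly pR (W x) \<le> T x" "poly pD (V x) \<le> T x"
  "length x \<le> T x" "K x = 3 * T x + 9" "U x < K x" "0 < U x"
  by (auto simp: T_def K_def U_def V_def)

section \<open>Values of the gates in a satisfying assignment\<close>

definition val :: "bool list \<Rightarrow> (nat \<Rightarrow> nat) \<Rightarrow> nat \<Rightarrow> nat" where
  "val x asg j = out x j (asg j)"

context
  fixes x :: "bool list" and asg :: "nat \<Rightarrow> nat"
  assumes sat: "circuit_sat (J x) S (src x) (out x) asg"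
begin

abbreviation "v b s l t i \<equiv> val x asg (gt x b s l t i)"
abbreviation "slot b s l t i c \<equiv> dig S c (asg (gt x b s l t i))"

lemma gate:
  assumes "b < 12" "s < K x" "l < K x" "t < K x" "i < K x"
  shows "v b s l t i = clip (kind_fun (spec x 4 b s l t i) (slot b s l t i))"
proof -
  have "asg (gt x b s l t i) < S ^ 4" using sat gt_less_J[OF assms] by (simp add: circuit_sat_def)
  moreover have "src x 4 (gt x b s l t i) = spec x 4 b s l t i"
    unfolding src_def gt_decode[OF assms(2-5)] ..
  moreover have "spec x 4 b s l t i * S ^ 4 + asg (gt x b s l t i) < 40 * S ^ 4"
  proof -
    have "spec x 4 b s l t i * S ^ 4 + asg (gt x b s l t i) < Suc (spec x 4 b s l t i) * S ^ 4"
      using calculation(1) by simp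
    also have "\<dots> \<le> 40 * S ^ 4" using spec_kind_less[of x b s l t i] by (intro mult_le_mono1) simp
    finally show ?thesis .
  qed
  moreover have "S \<noteq> 0" using S3 by simp
  ultimately show ?thesis unfolding val_def out_def table_def by simp
qed

lemma slot_eq:
  assumes "b < 12" "s < K x" "l < K x" "t < K x" "i < K x" "c < 4" "spec x c b s l t i = j" "j < gt x b s l t i"
  shows "slot b s l t i c = val x asg j"
proof -
  have "src x c (gt x b s l t i) = j"
    unfolding src_def gt_decode[OF assms(2-5)] by (rule assms(7))
  then show ?thesis
    using sat gt_less_J[OF assms(1-5)] assms(6,8) by (auto simp: circuit_sat_def val_def)
qed

lemma slot_gt:
  assumes "b < 12" "s < K x" "l < K x" "t < K x" "i < K x" "c < 4" "spec x c b s l t i = gt x b' s' l' t' i'"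
    "s' < K x" "l' < K x" "t' < K x" "i' < K x"
    "b' < b \<or> b' = b \<and> (s' < s \<or> s' = s \<and> (l' < l \<or> l' = l \<and> (t' < t \<or> t' = t \<and> i' < i)))"
  shows "slot b s l t i c = v b' s' l' t' i'"
  by (rule slot_eq[OF assms(1-7) gt_less[OF assms(8-12)]])

text \<open>Rows \<open>3 * \<tau>\<close>, \<open>3 * \<tau> + 1\<close> and
  \<open>3 * \<tau> + 2\<close> hold the cells, the scans and the global symbol after
  \<open>\<tau>\<close> steps, so this is \<open>tableau_correct\<close> once each gate is seen to
  read the sources of its rule. The input comes from row 0 of block \<open>b - 1\<close>.\<close>

lemma run_block:
  assumes b: "b = 1 \<and> m = 0 \<or> b = 6 \<and> m = 1 \<or> b = 10 \<and> m = 2" and sl: "s < K x" "l < K x"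
    and w: "\<And>i. i + Suc (T x) < K x \<Longrightarrow> v (b - 1) s l 0 i = tape_content z (int i)" and z: "length z \<le> T x"
    and i: "i < K x"
  shows "v b s l (3 * T x) i = cellv (run_config (mach m) z (T x)) (int i - int (Suc (T x)))"
proof -
  have spec: "spec x c b s l t i = run_spec x c m b s l t i" for c t i using b spec_run by auto
  have b12: "b < 12" "0 < b" "m < 3" using b by auto
  have Keq: "K x = 3 * T x + 9" by (simp add: K_def)
  have dm: "Suc (Suc (8 * m)) mod 8 = 2" "Suc (Suc (8 * m)) div 8 = m" "Suc (8 * m) mod 8 = 1" "Suc (8 * m) div 8 = m"
    by presburger+
  have kind': "kind_fun (18 + 8 * m) a = blank_cell (mach m)"
     "kind_fun (16 + 8 * m) a = init_cell (mach m) 0 (a 0)" "kind_fun (17 + 8 * m) a = init_cell (mach m) 1 (a 0)"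
     "kind_fun (19 + 8 * m) a = cell_fun (mach m) (a 0) (a 1) (a 2) (a 3)"
     "kind_fun (20 + 8 * m) a = scan_first (a 0)" "kind_fun (21 + 8 * m) a = scan_fun (a 0) (a 1)"
     "kind_fun (22 + 8 * m) a = glob_first (a 0)" "kind_fun (23 + 8 * m) a = glob_fun (mach m) (a 0) (a 1)" for a
    using dm by (simp_all add: kind_fun_def run_tab_def)
  note g = gate[OF b12(1) sl] and sl_eq = slot_eq[OF b12(1) sl]
  have wf: "wf_tm (mach m)" using wfQ wfR wfD by (simp add: mach_def)
  have Sb: "\<And>c. valid_config (mach m) c \<Longrightarrow> (\<forall>p. cellv c p < S \<and> scanv c p < S) \<and> globv c < S"
    using SQ SR SD by (auto simp: mach_def split: if_splits)
  have "v b s l (3 * \<tau>) i = cellv (run_config (mach m) z \<tau>) (int i - int (Suc (T x)))" if "\<tau> \<le> T x" for \<tau>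
  proof (rule tableau_correct[where cv = "\<lambda>\<tau> i. v b s l (3 * \<tau>) i" and sv = "\<lambda>\<tau> i. v b s l (3 * \<tau> + 1) i"
        and gv = "\<lambda>\<tau>. v b s l (3 * \<tau> + 2) 0" and cl = clip and A = "K x" and T = "T x" and M = "mach m" and z = z
        and w = "\<lambda>i. v (b - 1) s l 0 i", OF wf Sb z _ w])
    show "3 * T x + 9 \<le> K x" by (simp add: K_def)
    show "clip y = y" if "y < S" for y using that by (rule clip_id)
    show "v b s l (3 * \<tau>) 0 = clip (blank_cell (mach m))" if "\<tau> \<le> T x" for \<tau>
      using g[of "3 * \<tau>" 0] that by (simp add: spec run_spec_def kind' Keq)
    show "v b s l (3 * \<tau>) (K x - 1) = clip (blank_cell (mach m))" if "\<tau> \<le> T x" for \<tau>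
      using g[of "3 * \<tau>" "K x - 1"] that by (simp add: spec run_spec_def kind' Keq)
    show "v b s l (3 * 0) i = clip (blank_cell (mach m))" if "0 < i" "i < Suc (T x)" for i
      using g[of 0 i] that by (simp add: spec run_spec_def kind' Keq)
    show "v b s l (3 * 0) (Suc (T x)) = clip (init_cell (mach m) 1 (v (b - 1) s l 0 0))"
    proof -
      have "slot b s l 0 (Suc (T x)) 0 = v (b - 1) s l 0 0"
        using b12 sl by (intro sl_eq gt_less) (auto simp: spec run_spec_def Keq)
      then show ?thesis using g[of 0 "Suc (T x)"] by (simp add: spec run_spec_def kind' Keq)
    qed
    show "v b s l (3 * 0) (Suc (T x) + i) = clip (init_cell (mach m) 0 (v (b - 1) s l 0 i))"
      if "0 < i" "Suc (T x) + i < K x - 1" for i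
    proof -
      have "slot b s l 0 (Suc (T x) + i) 0 = v (b - 1) s l 0 i"
        using b12 sl that by (intro sl_eq gt_less) (auto simp: spec run_spec_def Keq)
      then show ?thesis using g[of 0 "Suc (T x) + i"] that by (simp add: spec run_spec_def kind' Keq)
    qed
    show "v b s l (3 * Suc \<tau>) (Suc i) = clip (cell_fun (mach m) (v b s l (3 * \<tau>) i) (v b s l (3 * \<tau>) (Suc i))
        (v b s l (3 * \<tau>) (Suc (Suc i))) (v b s l (3 * \<tau> + 2) 0))" if ti: "\<tau> < T x" "Suc i < K x - 1" for \<tau> i
    proof -
      have c: "3 * Suc \<tau> < K x" "Suc i < K x" "\<not> K x \<le> Suc (Suc i)" using ti by (auto simp: Keq)
      have sp: "spec x c b s l (3 * Suc \<tau>) (Suc i) = sel c (gt x b s l (3 * \<tau>) i) (gt x b s l (3 * \<tau>) (Suc i))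
         (gt x b s l (3 * \<tau>) (Suc (Suc i))) (gt x b s l (3 * \<tau> + 2) 0) (19 + 8 * m)" for c
        using c by (simp add: spec run_spec_def)
      have "slot b s l (3 * Suc \<tau>) (Suc i) 0 = v b s l (3 * \<tau>) i" "slot b s l (3 * Suc \<tau>) (Suc i) 1 = v b s l (3 * \<tau>) (Suc i)"
        "slot b s l (3 * Suc \<tau>) (Suc i) 2 = v b s l (3 * \<tau>) (Suc (Suc i))" "slot b s l (3 * Suc \<tau>) (Suc i) 3 = v b s l (3 * \<tau> + 2) 0"
        by (rule slot_gt; use c ti b12 sl sp[of 0] sp[of 1] sp[of 2] sp[of 3] in simp)+
      then show ?thesis using g[OF c(1,2)] by (simp only: sp sel_simps kind')
    qed
    show "v b s l (3 * \<tau> + 1) 0 = clip (scan_first (v b s l (3 * \<tau>) 0))" if "\<tau> \<le> T x" for \<tau>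
    proof -
      have c: "3 * \<tau> + 1 < K x" "0 < K x" using that by (auto simp: Keq)
      have sp: "spec x c b s l (3 * \<tau> + 1) 0 = sel c (gt x b s l (3 * \<tau>) 0) (J x) (J x) (J x) (20 + 8 * m)" for c
        by (simp add: spec run_spec_def mod_Suc)
      have "slot b s l (3 * \<tau> + 1) 0 0 = v b s l (3 * \<tau>) 0"
        by (rule slot_gt; use c b12 sl sp[of 0] sp[of 1] sp[of 2] sp[of 3] in simp)
      then show ?thesis using g[OF c] by (simp only: sp sel_simps kind')
    qed
    show "v b s l (3 * \<tau> + 1) (Suc i) = clip (scan_fun (v b s l (3 * \<tau> + 1) i) (v b s l (3 * \<tau>) (Suc i)))"
      if "\<tau> \<le> T x" "Suc i < K x" for \<tau> i
    proof -
      have c: "3 * \<tau> + 1 < K x" "Suc i < K x" using that by (auto simp: Keq)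
      have sp: "spec x c b s l (3 * \<tau> + 1) (Suc i) = sel c (gt x b s l (3 * \<tau> + 1) i) (gt x b s l (3 * \<tau>) (Suc i)) (J x) (J x) (21 + 8 * m)" for c
        by (simp add: spec run_spec_def mod_Suc)
      have "slot b s l (3 * \<tau> + 1) (Suc i) 0 = v b s l (3 * \<tau> + 1) i" "slot b s l (3 * \<tau> + 1) (Suc i) 1 = v b s l (3 * \<tau>) (Suc i)"
        by (rule slot_gt; use c b12 sl sp[of 0] sp[of 1] sp[of 2] sp[of 3] in simp)+
      then show ?thesis using g[OF c] by (simp only: sp sel_simps kind')
    qed
    show "v b s l (3 * 0 + 2) 0 = clip (glob_first (v b s l (3 * 0 + 1) (K x - 1)))"
    proof -
      have c: "3 * 0 + 2 < K x" "0 < K x" by (auto simp: Keq)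
      have sp: "spec x c b s l (3 * 0 + 2) 0 = sel c (gt x b s l (3 * 0 + 1) (K x - 1)) (J x) (J x) (J x) (22 + 8 * m)" for c
        by (simp add: spec run_spec_def)
      have "slot b s l (3 * 0 + 2) 0 0 = v b s l (3 * 0 + 1) (K x - 1)"
        by (rule slot_gt; use c b12 sl sp[of 0] sp[of 1] sp[of 2] sp[of 3] in \<open>simp add: Keq\<close>)
      then show ?thesis using g[OF c] by (simp only: sp sel_simps kind')
    qed
    show "v b s l (3 * Suc \<tau> + 2) 0 = clip (glob_fun (mach m) (v b s l (3 * Suc \<tau> + 1) (K x - 1)) (v b s l (3 * \<tau> + 2) 0))"
      if "\<tau> < T x" for \<tau>
    proof -
      have c: "3 * Suc \<tau> + 2 < K x" "0 < K x" using that by (auto simp: Keq)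
      have "(3 * Suc \<tau> + 2) mod 3 = 2" "3 * Suc \<tau> + 2 \<noteq> 2" "3 * Suc \<tau> + 2 - 1 = 3 * Suc \<tau> + 1" "3 * Suc \<tau> + 2 - 3 = 3 * \<tau> + 2"
        by presburger+
      then have sp: "spec x c b s l (3 * Suc \<tau> + 2) 0 = sel c (gt x b s l (3 * Suc \<tau> + 1) (K x - 1)) (gt x b s l (3 * \<tau> + 2) 0) (J x) (J x) (23 + 8 * m)" for c
        by (simp only: spec run_spec_def) simp
      have "slot b s l (3 * Suc \<tau> + 2) 0 0 = v b s l (3 * Suc \<tau> + 1) (K x - 1)" "slot b s l (3 * Suc \<tau> + 2) 0 1 = v b s l (3 * \<tau> + 2) 0"
        by (rule slot_gt; use that c b12 sl sp[of 0] sp[of 1] sp[of 2] sp[of 3] in \<open>simp add: Keq\<close>)+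
      then show ?thesis using g[OF c] by (simp only: sp sel_simps kind')
    qed
  qed (use that i in auto)
  then show ?thesis by simp
qed


section \<open>The blocks of the circuit one by one\<close>

lemmas bnd = bounds[of x]

abbreviation "st \<equiv> pair_start (Q x)"
abbreviation "ql k \<equiv> length (Q x ! k)"
abbreviation "tp i \<equiv> tape_content (encode_list (Q x)) (int i)"

lemma query_bound:
  assumes "k < length (Q x)"
  shows "st k + ql k < U x" "st k < U x" "ql k < U x"
proof -
  have "2 * st (length (Q x)) < U x"
    using computes_within_length[OF wfQ cQ, of x] by (simp add: length_encode_list U_def)
  then show "st k + ql k < U x" using pair_start_less[OF assms, of "Q x"] by linarith
  then show "st k < U x" "ql k < U x" by auto
qed

lemma query_count: "length (Q x) < U x"
proof -
  have "k \<le> st k" for k by (induction k) auto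
  moreover have "2 * st (length (Q x)) < U x"
    using computes_within_length[OF wfQ cQ, of x] by (simp add: length_encode_list U_def)
  ultimately show ?thesis by (metis le_less_trans mult_2 trans_le_add1)
qed

lemma kind_const: "k < 3 \<Longrightarrow> clip (kind_fun k a) = k"
  using S3 by (simp add: kind_fun_def clip_def)

lemma clip3: "y < 3 \<Longrightarrow> clip y = y"
  using S3 by (simp add: clip_def)

lemma v_input:
  assumes "s < K x" "l < K x" "i < K x"
  shows "v 0 s l 0 i = tape_content x (int i)"
proof -
  have "spec x 4 0 s l 0 i = tape_content x (int i)" by (simp add: spec_def konst_def symat_tape)
  then show ?thesis
    using gate[of 0 s l 0 i] assms kind_const[OF tape_content_bound] K_pos by simp
qed

lemma v_out:
  assumes "i + Suc (T x) < K x"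
  shows "v 2 0 0 0 i = tp i"
proof -
  have i: "i < K x" "Suc (T x) + i < K x" "3 * T x < K x" using assms by (auto simp: K_def)
  have "slot 2 0 0 0 i 0 = v 1 0 0 (3 * T x) (Suc (T x) + i)"
    using i K_pos assms by (rule_tac slot_gt) (auto simp: spec_def)
  also have "\<dots> = cellv (run_config (mach 0) x (T x)) (int (Suc (T x) + i) - int (Suc (T x)))"
    using i K_pos bnd(7) by (intro run_block) (auto simp: v_input)
  also have "\<dots> = cellv (run_config MQ x (T x)) (int i)" by (simp add: mach_def)
  finally have "out_symbol (slot 2 0 0 0 i 0) = tp i"
    using out_symbol_cellv[OF wfQ] computes_within_output[OF cQ bnd(4)] by simp
  moreover have "spec x 4 2 0 0 0 i = 6" using assms by (simp add: spec_def)
  ultimately show ?thesis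
    using gate[of 2 0 0 0 i] i K_pos clip3[OF tape_content_bound] by (simp add: kind_fun_def)
qed

lemma v_out_pair:
  assumes "u < 2 * U x"
  shows "v 2 0 0 0 (2 * u) = tp (2 * u)" "v 2 0 0 0 (2 * u + 1) = tp (2 * u + 1)" "2 * u + 1 < K x" "2 * u < K x"
  using assms bnd(1) by (auto intro!: v_out simp: K_def simp del: of_nat_mult of_nat_add of_nat_Suc add_Suc_right)

lemma UK: "a < U x \<Longrightarrow> a < K x" "0 < K x" "3 * T x < K x" "Suc (T x) < K x"
  using bnd(9) by (auto simp: K_def)

text \<open>The terminator at \<open>s + l\<close> is left to the verdict gate, so that the gate for
  \<open>l\<close> can serve as a source of the gate for \<open>Suc l\<close>.\<close>

lemma v_act:
  assumes "s < U x" "l < U x"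
  shows "v 3 s l 0 0 = of_bool (start_at (Q x) s \<and> (\<forall>k<l. \<not> term_at (Q x) (s + k)))"
  using assms(2)
proof (induction l)
  case 0
  show ?case
  proof (cases "s = 0")
    case True
    have o: "v 2 0 0 0 0 = tp 0" using v_out_pair(1)[of 0] bnd(10) by simp
    have "slot 3 s 0 0 0 0 = v 2 0 0 0 0"
      using UK True bnd(10) by (rule_tac slot_gt) (auto simp: spec_def)
    moreover have "spec x 4 3 s 0 0 0 = 8" using True bnd(10) by (simp add: spec_def)
    ultimately show ?thesis
      using gate[of 3 s 0 0 0] True UK o clip3 by (simp add: kind_fun_def start_at_def)
  next
    case False
    have sp: "spec x c 3 s 0 0 0 = sel c (owire x (2 * (s - 1))) (owire x (2 * (s - 1) + 1)) (owire x (2 * s)) (J x) 7" for c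
      using False assms(1) bnd(10) by (simp add: spec_def)
    have o: "v 2 0 0 0 (2 * (s - 1)) = tp (2 * (s - 1))" "v 2 0 0 0 (2 * (s - 1) + 1) = tp (2 * (s - 1) + 1)"
      "v 2 0 0 0 (2 * s) = tp (2 * s)" "2 * (s - 1) + 1 < K x" "2 * (s - 1) < K x" "2 * s < K x"
      using v_out_pair[of "s - 1"] v_out_pair[of s] assms(1) by (auto simp del: of_nat_mult of_nat_add of_nat_Suc)
    have "slot 3 s 0 0 0 0 = tp (2 * (s - 1))" "slot 3 s 0 0 0 1 = tp (2 * (s - 1) + 1)" "slot 3 s 0 0 0 2 = tp (2 * s)"
      unfolding o(1-3)[symmetric] by (rule slot_gt; use  assms(1) o(4-6) sp[of 0] sp[of 1] sp[of 2] sp[of 3] in \<open>simp add: UK\<close>)+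
    then show ?thesis
      using gate[of 3 s 0 0 0] False UK assms(1) clip3
      unfolding sp start_at_def term_at_def by (simp add: kind_fun_def del: of_nat_mult of_nat_add of_nat_Suc)
  qed
next
  case (Suc l)
  have sp: "spec x c 3 s (Suc l) 0 0 = sel c (gt x 3 s l 0 0) (owire x (2 * (s + l))) (owire x (2 * (s + l) + 1)) (J x) 9" for c
    using Suc.prems assms(1) by (simp add: spec_def)
  note o = v_out_pair[of "s + l"]
  have sl: "s + l < 2 * U x" using Suc.prems assms(1) by simp
  have "slot 3 s (Suc l) 0 0 0 = v 3 s l 0 0" "slot 3 s (Suc l) 0 0 1 = tp (2 * (s + l))"
    "slot 3 s (Suc l) 0 0 2 = tp (2 * (s + l) + 1)"
    unfolding o(1,2)[OF sl, symmetric]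
    by (rule slot_gt; use  assms(1) Suc.prems o(3,4)[OF sl] sp[of 0] sp[of 1] sp[of 2] sp[of 3] in \<open>simp add: UK\<close>)+
  then show ?case
    using gate[of 3 s "Suc l" 0 0] UK assms(1) Suc clip3
    unfolding sp term_at_def by (auto simp: kind_fun_def less_Suc_eq simp del: of_nat_mult of_nat_add of_nat_Suc)
qed

text \<open>The count is kept in one-hot form over the columns, because a single gate has a bounded
  alphabet; a terminator shifts the row by one.\<close>

lemma v_rank:
  assumes "u < U x" "i < K x"
  shows "v 4 0 0 u i = of_bool ((\<Sum>k<u. of_bool (term_at (Q x) k)) = i)"
  using assms
proof (induction u arbitrary: i)
  case 0
  have "spec x 4 4 0 0 0 i = (if i = 0 then 1 else 0)" using bnd(10) by (simp add: spec_def konst_def)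
  then show ?case
    using gate[of 4 0 0 0 i] UK 0 kind_const by auto
next
  case (Suc u)
  note o = v_out_pair[of u]
  have u: "u < 2 * U x" "u < U x" using Suc.prems by auto
  have uK: "u < K x" "Suc u < K x" using UK Suc.prems by auto
  show ?case
  proof (cases i)
    case 0
    have sp: "spec x c 4 0 0 (Suc u) i = sel c (owire x (2 * u)) (owire x (2 * u + 1)) (gt x 4 0 0 u 0) (J x) 11" for c
      using Suc.prems 0 by (simp add: spec_def)
    have "slot 4 0 0 (Suc u) i 0 = tp (2 * u)" "slot 4 0 0 (Suc u) i 1 = tp (2 * u + 1)" "slot 4 0 0 (Suc u) i 2 = v 4 0 0 u 0"
      unfolding o(1,2)[OF u(1), symmetric]
      by (rule slot_gt; use  uK Suc.prems o(3,4)[OF u(1)] sp[of 0] sp[of 1] sp[of 2] sp[of 3] in \<open>simp add: UK\<close>)+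
    then show ?thesis
      using gate[of 4 0 0 "Suc u" i] UK uK Suc.prems Suc.IH[OF u(2), of 0] clip3 0
      unfolding sp term_at_def by (auto simp: kind_fun_def simp del: of_nat_mult of_nat_add of_nat_Suc sum_eq_0_iff)
  next
    case (Suc i')
    have sp: "spec x c 4 0 0 (Suc u) i = sel c (owire x (2 * u)) (owire x (2 * u + 1)) (gt x 4 0 0 u i) (gt x 4 0 0 u i') 10" for c
      using Suc.prems Suc by (simp add: spec_def)
    have i': "i' < K x" using Suc.prems Suc by simp
    have "slot 4 0 0 (Suc u) i 0 = tp (2 * u)" "slot 4 0 0 (Suc u) i 1 = tp (2 * u + 1)" "slot 4 0 0 (Suc u) i 2 = v 4 0 0 u i"
      "slot 4 0 0 (Suc u) i 3 = v 4 0 0 u i'"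
      unfolding o(1,2)[OF u(1), symmetric]
      by (rule slot_gt; use  uK i' Suc.prems o(3,4)[OF u(1)] sp[of 0] sp[of 1] sp[of 2] sp[of 3] in \<open>simp add: UK\<close>)+
    then show ?thesis
      using gate[of 4 0 0 "Suc u" i] UK uK Suc.prems Suc.IH[OF u(2), of i] Suc.IH[OF u(2), of i'] clip3 Suc i'
      unfolding sp term_at_def by (auto simp: kind_fun_def simp del: of_nat_mult of_nat_add of_nat_Suc)
  qed
qed

lemma v_answer:
  assumes "s < U x" "l < U x"
  shows "v 7 s l 0 0 = (if active (Q x) s l then if out_symbol (v 6 s l (3 * T x) (Suc (T x))) = 2 then 2 else 1 else 0)"
proof -
  have sp: "spec x c 7 s l 0 0 = sel c (gt x 3 s l 0 0) (owire x (2 * (s + l))) (owire x (2 * (s + l) + 1)) (gt x 6 s l (3 * T x) (Suc (T x))) 12" for c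
    using assms by (simp add: spec_def)
  have sl: "s + l < 2 * U x" using assms by simp
  note o = v_out_pair[OF sl]
  have "slot 7 s l 0 0 0 = v 3 s l 0 0" "slot 7 s l 0 0 1 = tp (2 * (s + l))" "slot 7 s l 0 0 2 = tp (2 * (s + l) + 1)"
    "slot 7 s l 0 0 3 = v 6 s l (3 * T x) (Suc (T x))"
    unfolding o(1,2)[symmetric]
    by (rule slot_gt; use  assms o(3,4) sp[of 0] sp[of 1] sp[of 2] sp[of 3] in \<open>simp add: UK\<close>)+
  then show ?thesis
    using gate[of 7 s l 0 0] UK assms v_act[OF assms] clip3
    unfolding sp active_def term_at_def by (auto simp: kind_fun_def simp del: of_nat_mult of_nat_add of_nat_Suc)
qed

lemma wire_bound: "l < U x \<Longrightarrow> 2 * l + 2 + poly pB l < K x"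
  using nat_poly_mono[of l "U x" pB] bnd(2) by (simp add: W_def K_def)

lemma v_wire_query:
  assumes "s < U x" "l < U x" "i < 2 * l + 2"
  shows "v 5 s l 0 i = tp (2 * s + i)"
proof -
  have b: "2 * s + i + Suc (T x) < K x" using assms bnd(1) by (simp add: K_def)
  have sp: "spec x c 5 s l 0 i = sel c (owire x (2 * s + i)) (J x) (J x) (J x) 5" for c
    using assms by (simp add: spec_def)
  have "slot 5 s l 0 i 0 = v 2 0 0 0 (2 * s + i)"
    by (rule slot_gt; use  assms b sp[of 0] sp[of 1] sp[of 2] sp[of 3] in \<open>simp add: UK\<close>)
  then show ?thesis
    using gate[of 5 s l 0 i] UK assms b v_out[OF b] clip3[OF tape_content_bound]
    unfolding sp by (simp add: kind_fun_def del: of_nat_mult of_nat_add)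
qed

lemma v_wire_free:
  assumes "s < U x" "l < U x"
  shows "0 < poly pB l \<Longrightarrow> v 5 s l 0 (2 * l + 2) = slot 5 s l 0 (2 * l + 2) 0 mod 3"
    "Suc i < poly pB l \<Longrightarrow> v 5 s l 0 (2 * l + 2 + Suc i) =
       (if v 5 s l 0 (2 * l + 2 + i) = 0 then 0 else slot 5 s l 0 (2 * l + 2 + Suc i) 0 mod 3)"
    "poly pB l \<le> i \<Longrightarrow> 2 * l + 2 + i < K x \<Longrightarrow> v 5 s l 0 (2 * l + 2 + i) = 0"
proof -
  note wb = wire_bound[OF assms(2)]
  show "v 5 s l 0 (2 * l + 2) = slot 5 s l 0 (2 * l + 2) 0 mod 3" if "0 < poly pB l"
  proof -
    have "spec x 4 5 s l 0 (2 * l + 2) = 3" using assms that by (simp add: spec_def)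
    then show ?thesis using gate[of 5 s l 0 "2 * l + 2"] UK assms wb clip3 by (simp add: kind_fun_def)
  qed
  show "v 5 s l 0 (2 * l + 2 + Suc i) = (if v 5 s l 0 (2 * l + 2 + i) = 0 then 0 else slot 5 s l 0 (2 * l + 2 + Suc i) 0 mod 3)"
    if "Suc i < poly pB l"
  proof -
    have sp: "spec x c 5 s l 0 (2 * l + 2 + Suc i) = sel c (J x) (gt x 5 s l 0 (2 * l + 2 + i)) (J x) (J x) 4" for c
      using assms that by (simp add: spec_def)
    have "slot 5 s l 0 (2 * l + 2 + Suc i) 1 = v 5 s l 0 (2 * l + 2 + i)"
      by (rule slot_gt; use  assms that wb sp[of 0] sp[of 1] sp[of 2] sp[of 3] in \<open>simp add: UK\<close>)
    then show ?thesis
      using gate[of 5 s l 0 "2 * l + 2 + Suc i"] UK assms that wb clip3 unfolding sp by (simp add: kind_fun_def)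
  qed
  show "v 5 s l 0 (2 * l + 2 + i) = 0" if "poly pB l \<le> i" "2 * l + 2 + i < K x"
  proof -
    have "spec x 4 5 s l 0 (2 * l + 2 + i) = 0" using assms that by (simp add: spec_def konst_def)
    then show ?thesis using gate[of 5 s l 0 "2 * l + 2 + i"] UK assms that kind_const by simp
  qed
qed

lemma wires_of_certificate:
  assumes k: "k < length (Q x)" and y: "\<And>i. 2 * ql k + 2 + i < K x \<Longrightarrow> v 5 (st k) (ql k) 0 (2 * ql k + 2 + i) = tape_content y (int i)"
    and i: "i < K x"
  shows "v 5 (st k) (ql k) 0 i = tape_content (encode_pair (Q x ! k) y) (int i)"
proof (cases "i < 2 * ql k + 2")
  case True
  then show ?thesis
    using v_wire_query[OF query_bound(2,3)[OF k] True] tape_content_encode_list[OF k True]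
    by (simp add: encode_pair_def tape_content_append del: of_nat_mult of_nat_add)
next
  case False
  then have "i = 2 * ql k + 2 + (i - (2 * ql k + 2))" by simp
  then show ?thesis using y[of "i - (2 * ql k + 2)"] i False
    by (simp add: encode_pair_def tape_content_append del: of_nat_diff)
qed

text \<open>Whatever the free slots contain, their gates reduce it modulo 3 and let nothing follow a
  blank, so every satisfying assignment feeds a genuine certificate to the run.\<close>

lemma certificate_ex:
  assumes k: "k < length (Q x)"
  shows "\<exists>y. length y \<le> poly pB (ql k) \<and> (\<forall>i<K x. v 5 (st k) (ql k) 0 i = tape_content (encode_pair (Q x ! k) y) (int i))"
proof -
  note qb = query_bound(2,3)[OF k]
  define c where "c i = (if i < poly pB (ql k) then v 5 (st k) (ql k) 0 (2 * ql k + 2 + i) else 0)" for i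
  have "c i < 3" for i
    using v_wire_free(1)[OF qb] v_wire_free(2)[OF qb, of "i - 1"] by (cases i) (auto simp: c_def)
  moreover have "c (Suc i) = 0" if "c i = 0" for i
    using v_wire_free(2)[OF qb, of i] that by (auto simp: c_def split: if_splits)
  moreover have "c i = 0" if "poly pB (ql k) \<le> i" for i using that by (simp add: c_def)
  ultimately obtain y where y: "length y \<le> poly pB (ql k)" "\<forall>i. c i = tape_content y (int i)"
    using tape_of_cells[of c "poly pB (ql k)"] by blast
  have "v 5 (st k) (ql k) 0 (2 * ql k + 2 + i) = tape_content y (int i)" if "2 * ql k + 2 + i < K x" for i
    using y(2)[rule_format, of i] v_wire_free(3)[OF qb, of i] that by (auto simp: c_def split: if_splits)
  then show ?thesis using wires_of_certificate[OF k] y(1) by blast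
qed

lemma v_verdict:
  assumes k: "k < length (Q x)" and y: "length y \<le> poly pB (ql k)"
    "\<And>i. i < K x \<Longrightarrow> v 5 (st k) (ql k) 0 i = tape_content (encode_pair (Q x ! k) y) (int i)"
  shows "v 7 (st k) (ql k) 0 0 = (if encode_pair (Q x ! k) y \<in> R then 2 else 1)"
proof -
  let ?z = "encode_pair (Q x ! k) y"
  note qb = query_bound(2,3)[OF k]
  have lz: "length ?z \<le> W x"
    using y(1) qb nat_poly_mono[of "ql k" "U x" pB] by (simp add: encode_pair_def W_def)
  have "v 6 (st k) (ql k) (3 * T x) (Suc (T x)) = cellv (run_config (mach 1) ?z (T x)) (int (Suc (T x)) - int (Suc (T x)))"
    using UK qb y(2) lz bnd(2) by (intro run_block) auto
  also have "\<dots> = cellv (run_config MR ?z (T x)) 0" by (simp add: mach_def)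
  finally have "out_symbol (v 6 (st k) (ql k) (3 * T x) (Suc (T x))) = tape_content [?z \<in> R] 0"
    using out_symbol_cellv[OF wfR] computes_within_output[OF cR, of ?z "T x"] nat_poly_mono[OF lz, of pR] bnd(5) by simp
  moreover have "active (Q x) (st k) (ql k)" using k active_iff by blast
  ultimately show ?thesis using v_answer[OF qb] by (simp add: tape_content_def)
qed

lemma v_answer_nonzero: "k < length (Q x) \<Longrightarrow> v 7 (st k) (ql k) 0 0 = 1 \<or> v 7 (st k) (ql k) 0 0 = 2"
  using certificate_ex[of k] v_verdict[of k] by (auto split: if_splits)

text \<open>The sweep visits the candidates in lexicographic order and overwrites entry
  \<open>i\<close> only at an active candidate of rank \<open>i\<close>, that is, at the single
  candidate belonging to query \<open>i\<close>.\<close>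

lemma v_sorted_step:
  assumes sl: "s < U x" "l < U x" and i: "i < K x"
    and pv: "pv = (if i < length (Q x) \<and> (st i < s \<or> st i = s \<and> ql i < l) then v 7 (st i) (ql i) 0 0 else 0)"
    and v8: "v 8 s l 0 i = (if v 7 s l 0 0 \<noteq> 0 \<and> v 4 0 0 s i = 1 then v 7 s l 0 0 else pv)"
  shows "v 8 s l 0 i = (if i < length (Q x) \<and> (st i < s \<or> st i = s \<and> ql i \<le> l) then v 7 (st i) (ql i) 0 0 else 0)"
proof (cases "i < length (Q x) \<and> s = st i \<and> l = ql i")
  case True
  then have "v 4 0 0 s i = 1" using v_rank[OF sl(1) i] rank_start[of i "Q x"] by simp
  moreover have "v 7 s l 0 0 \<noteq> 0" using v_answer_nonzero[of i] True by auto
  ultimately show ?thesis using v8 True by simp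
next
  case False
  have "\<not> (v 7 s l 0 0 \<noteq> 0 \<and> v 4 0 0 s i = 1)"
  proof
    assume *: "v 7 s l 0 0 \<noteq> 0 \<and> v 4 0 0 s i = 1"
    then have "active (Q x) s l" using v_answer[OF sl] by (auto split: if_splits)
    then obtain k where k: "k < length (Q x)" "s = st k" "l = ql k" using active_iff by blast
    then have "k = i" using * v_rank[OF sl(1) i] rank_start[of k "Q x"] by (auto simp: of_bool_def split: if_splits)
    then show False using False k by simp
  qed
  then show ?thesis using v8 pv False by auto
qed

lemma v_sorted:
  assumes "s < U x" "l < U x" "i < K x"
  shows "v 8 s l 0 i = (if i < length (Q x) \<and> (st i < s \<or> st i = s \<and> ql i \<le> l) then v 7 (st i) (ql i) 0 0 else 0)"
  using assms
proof (induction s arbitrary: l)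
  case 0
  note i = 0(3)
  from 0(2) show ?case
  proof (induction l)
    case 0
    have sp: "spec x c 8 0 0 0 i = sel c (J x) (gt x 7 0 0 0 0) (gt x 4 0 0 0 i) (J x) 14" for c
      using bnd(10) by (simp add: spec_def)
    have "slot 8 0 0 0 i 1 = v 7 0 0 0 0" "slot 8 0 0 0 i 2 = v 4 0 0 0 i"
      by (rule slot_gt; use  i sp[of 0] sp[of 1] sp[of 2] sp[of 3] in \<open>simp add: UK\<close>)+
    moreover have "v 7 0 0 0 0 < 3" using v_answer[of 0 0] bnd(10) by simp
    ultimately have "v 8 0 0 0 i = (if v 7 0 0 0 0 \<noteq> 0 \<and> v 4 0 0 0 i = 1 then v 7 0 0 0 0 else 0)"
      using gate[of 8 0 0 0 i] UK i clip3 unfolding sp by (simp add: kind_fun_def)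
    then show ?case using v_sorted_step[of 0 0 i 0] bnd(10) i by simp
  next
    case (Suc l)
    have sp: "spec x c 8 0 (Suc l) 0 i = sel c (gt x 8 0 l 0 i) (gt x 7 0 (Suc l) 0 0) (gt x 4 0 0 0 i) (J x) 13" for c
      using Suc.prems bnd(10) by (simp add: spec_def)
    have "slot 8 0 (Suc l) 0 i 0 = v 8 0 l 0 i" "slot 8 0 (Suc l) 0 i 1 = v 7 0 (Suc l) 0 0" "slot 8 0 (Suc l) 0 i 2 = v 4 0 0 0 i"
      by (rule slot_gt; use  Suc.prems i sp[of 0] sp[of 1] sp[of 2] sp[of 3] in \<open>simp add: UK\<close>)+
    moreover have "v 7 0 (Suc l) 0 0 < 3" using v_answer[of 0 "Suc l"] bnd(10) Suc.prems by simp
    ultimately have "v 8 0 (Suc l) 0 i = (if v 7 0 (Suc l) 0 0 \<noteq> 0 \<and> v 4 0 0 0 i = 1 then v 7 0 (Suc l) 0 0 else v 8 0 l 0 i)"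
      using gate[of 8 0 "Suc l" 0 i] UK Suc.prems i clip3 clip_id[of "v 8 0 l 0 i"] out_less unfolding sp by (simp add: kind_fun_def val_def)
    then show ?case using Suc bnd(10) i by (intro v_sorted_step) (auto simp: less_Suc_eq_le)
  qed
next
  case (Suc s)
  note i = Suc(4) and s = Suc(2)
  from Suc(3) show ?case
  proof (induction l)
    case 0
    have sp: "spec x c 8 (Suc s) 0 0 i = sel c (gt x 8 s (U x - 1) 0 i) (gt x 7 (Suc s) 0 0 0) (gt x 4 0 0 (Suc s) i) (J x) 13" for c
      using s bnd(10) by (simp add: spec_def)
    have "slot 8 (Suc s) 0 0 i 0 = v 8 s (U x - 1) 0 i" "slot 8 (Suc s) 0 0 i 1 = v 7 (Suc s) 0 0 0" "slot 8 (Suc s) 0 0 i 2 = v 4 0 0 (Suc s) i"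
      by (rule slot_gt; use  s i bnd(9) sp[of 0] sp[of 1] sp[of 2] sp[of 3] in \<open>simp add: UK\<close>)+
    moreover have "v 7 (Suc s) 0 0 0 < 3" using v_answer[of "Suc s" 0] bnd(10) s by simp
    ultimately have *: "v 8 (Suc s) 0 0 i = (if v 7 (Suc s) 0 0 0 \<noteq> 0 \<and> v 4 0 0 (Suc s) i = 1 then v 7 (Suc s) 0 0 0 else v 8 s (U x - 1) 0 i)"
      using gate[of 8 "Suc s" 0 0 i] UK s i clip3 clip_id[of "v 8 s (U x - 1) 0 i"] out_less unfolding sp by (simp add: kind_fun_def val_def)
    \<comment> \<open>Queries are shorter than \<open>U x\<close>, so \<open>l = U x - 1\<close>
      finishes the candidates that start at \<open>s\<close>.\<close>
    have "v 8 s (U x - 1) 0 i = (if i < length (Q x) \<and> (st i < Suc s \<or> st i = Suc s \<and> ql i < 0) then v 7 (st i) (ql i) 0 0 else 0)"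
      using Suc.IH[of "U x - 1"] s i bnd(10) query_bound(3)[of i] by (auto simp: less_Suc_eq)
    then show ?case using * s bnd(10) i by (intro v_sorted_step) auto
  next
    case (Suc l)
    have sp: "spec x c 8 (Suc s) (Suc l) 0 i = sel c (gt x 8 (Suc s) l 0 i) (gt x 7 (Suc s) (Suc l) 0 0) (gt x 4 0 0 (Suc s) i) (J x) 13" for c
      using Suc.prems s by (simp add: spec_def)
    have "slot 8 (Suc s) (Suc l) 0 i 0 = v 8 (Suc s) l 0 i" "slot 8 (Suc s) (Suc l) 0 i 1 = v 7 (Suc s) (Suc l) 0 0"
      "slot 8 (Suc s) (Suc l) 0 i 2 = v 4 0 0 (Suc s) i"
      by (rule slot_gt; use  Suc.prems s i sp[of 0] sp[of 1] sp[of 2] sp[of 3] in \<open>simp add: UK\<close>)+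
    moreover have "v 7 (Suc s) (Suc l) 0 0 < 3" using v_answer[of "Suc s" "Suc l"] s Suc.prems by simp
    ultimately have "v 8 (Suc s) (Suc l) 0 i = (if v 7 (Suc s) (Suc l) 0 0 \<noteq> 0 \<and> v 4 0 0 (Suc s) i = 1 then v 7 (Suc s) (Suc l) 0 0 else v 8 (Suc s) l 0 i)"
      using gate[of 8 "Suc s" "Suc l" 0 i] UK Suc.prems s i clip3 clip_id[of "v 8 (Suc s) l 0 i"] out_less unfolding sp by (simp add: kind_fun_def val_def)
    then show ?case using Suc s i by (intro v_sorted_step) (auto simp: less_Suc_eq_le)
  qed
qed

definition yes :: "nat \<Rightarrow> bool" where
  "yes k \<longleftrightarrow> v 7 (st k) (ql k) 0 0 = 2"

text \<open>Verdicts 1 and 2 are the tape symbols of the two bits, and entries beyond the last query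
  are 0, so the sorted row already is a tape with the answer list.\<close>

lemma v_decision_input:
  assumes "i + Suc (T x) < K x"
  shows "v 9 0 0 0 i = tape_content (encode_pair x (map yes [0..<length (Q x)])) (int i)"
proof -
  have i: "i < K x" using assms by simp
  have g: "v 9 0 0 0 i = clip (kind_fun (spec x 4 9 0 0 0 i) (slot 9 0 0 0 i))"
    using gate[of 9 0 0 0 i] UK(2) i by simp
  consider "i < 2 * length x" | "i = 2 * length x" | "i = 2 * length x + 1" | "2 * length x + 2 \<le> i" by linarith
  then show ?thesis
  proof cases
    case 1
    then have "spec x 4 9 0 0 0 i = tape_content x (int (i div 2))" by (simp add: spec_def konst_def symat_tape)
    then show ?thesis using g kind_const[OF tape_content_bound] 1
      by (simp add: encode_pair_def tape_content_append tape_content_encode_string)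
  next
    case 2
    then have "spec x 4 9 0 0 0 i = 1" by (simp add: spec_def konst_def)
    then show ?thesis using g kind_const 2
      by (simp add: encode_pair_def tape_content_append tape_content_encode_string del: of_nat_mult of_nat_add)
  next
    case 3
    then have "spec x 4 9 0 0 0 i = 2" by (simp add: spec_def konst_def)
    then show ?thesis using g kind_const 3
      by (simp add: encode_pair_def tape_content_append tape_content_encode_string del: of_nat_mult of_nat_add of_nat_Suc)
  next
    case 4
    let ?i = "i - (2 * length x + 2)"
    have sp: "spec x c 9 0 0 0 i = sel c (gt x 8 (U x - 1) (U x - 1) 0 ?i) (J x) (J x) (J x) 5" for c
      using 4 by (simp add: spec_def)
    have U1: "U x - 1 < U x" "U x - 1 < K x" "?i < K x" using bnd(9,10) i by auto
    have "slot 9 0 0 0 i 0 = v 8 (U x - 1) (U x - 1) 0 ?i"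
      by (rule slot_gt; use  i U1 sp[of 0] sp[of 1] sp[of 2] sp[of 3] in \<open>simp add: UK\<close>)
    moreover have "clip (v 8 (U x - 1) (U x - 1) 0 ?i) = v 8 (U x - 1) (U x - 1) 0 ?i"
      using out_less by (intro clip_id) (simp add: val_def)
    ultimately have "v 9 0 0 0 i = v 8 (U x - 1) (U x - 1) 0 ?i"
      using g unfolding sp by (simp add: kind_fun_def)
    also have "\<dots> = (if ?i < length (Q x) then v 7 (st ?i) (ql ?i) 0 0 else 0)"
      using v_sorted[OF U1(1,1,3)] query_bound[of ?i] by auto
    also have "\<dots> = tape_content (map yes [0..<length (Q x)]) (int ?i)"
      using v_answer_nonzero[of ?i] by (auto simp: tape_content_nat yes_def simp del: of_nat_diff)
    finally show ?thesis using 4 by (simp add: encode_pair_def tape_content_append del: of_nat_diff)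
  qed
qed

lemma v_decision:
  "v 11 0 0 0 0 = of_bool (encode_pair x (map yes [0..<length (Q x)]) \<in> D)"
proof -
  let ?z = "encode_pair x (map yes [0..<length (Q x)])"
  have lz: "length ?z \<le> V x" using query_count by (simp add: encode_pair_def V_def)
  have sp: "spec x c 11 0 0 0 0 = sel c (gt x 10 0 0 (3 * T x) (Suc (T x))) (J x) (J x) (J x) 15" for c
    by (simp add: spec_def)
  have "slot 11 0 0 0 0 0 = v 10 0 0 (3 * T x) (Suc (T x))"
    by (rule slot_gt; use  sp[of 0] sp[of 1] sp[of 2] sp[of 3] in \<open>simp add: UK\<close>)
  also have "\<dots> = cellv (run_config (mach 2) ?z (T x)) (int (Suc (T x)) - int (Suc (T x)))"
    using UK v_decision_input lz bnd(3) by (intro run_block) auto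
  also have "\<dots> = cellv (run_config MD ?z (T x)) 0" by (simp add: mach_def)
  finally have "out_symbol (slot 11 0 0 0 0 0) = tape_content [?z \<in> D] 0"
    using out_symbol_cellv[OF wfD] computes_within_output[OF cD, of ?z "T x"] nat_poly_mono[OF lz, of pD] bnd(6) by simp
  then show ?thesis
    using gate[of 11 0 0 0 0] UK clip3 unfolding sp by (simp add: kind_fun_def tape_content_def)
qed

end

subsection \<open>Hardness\<close>

text \<open>No gate ever outputs \<open>S\<close>, so outside blocks 7 and 11 nothing is rewarded;
  \<open>f\<close> decides whether acceptance counts.\<close>

definition rw :: "bool list \<Rightarrow> bool \<Rightarrow> nat \<Rightarrow> nat" where
  "rw x f j = (if j div K x ^ 4 = 7 then 2 else if j div K x ^ 4 = 11 \<and> f then 1 else S)"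

lemma J_decode:
  assumes "j < J x"
  obtains b s l t i where "j = gt x b s l t i" "b < 12" "s < K x" "l < K x" "t < K x" "i < K x" "j div K x ^ 4 = b"
proof -
  have "j div K x ^ 4 < 12" using assms by (simp add: J_def less_mult_imp_div_less)
  then show ?thesis
    by (intro that[OF gt_encode[of x j, symmetric]]) (auto simp: K_pos)
qed

lemma rewards_eq:
  assumes sat: "circuit_sat (J x) S (src x) (out x) asg"
  shows "rewards (J x) (out x) (rw x f) asg = card {k. k < length (Q x) \<and> yes x asg k} +
    of_bool (f \<and> encode_pair x (map (yes x asg) [0..<length (Q x)]) \<in> D)"
proof -
  let ?m = "length (Q x)" and ?g = "\<lambda>k. gt x 7 (st x k) (ql x k) 0 0"
  let ?d = "f \<and> encode_pair x (map (yes x asg) [0..<?m]) \<in> D"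
  let ?Y = "{k. k < ?m \<and> yes x asg k}" and ?E = "if ?d then {gt x 11 0 0 0 0} else {}"
  have qK: "st x k < K x" "ql x k < K x" if "k < ?m" for k
    using query_bound[OF sat that] UK[OF sat] by auto
  have K0: "0 < K x" by (rule K_pos)
  have eq: "{j. j < J x \<and> out x j (asg j) = rw x f j} = ?g ` ?Y \<union> ?E"
  proof (intro equalityI subsetI)
    fix j assume "j \<in> {j. j < J x \<and> out x j (asg j) = rw x f j}"
    then have j: "j < J x" "val x asg j = rw x f j" by (auto simp: val_def)
    from j(1) obtain b s l t i where c: "j = gt x b s l t i" "b < 12" "s < K x" "l < K x" "t < K x" "i < K x" "j div K x ^ 4 = b"
      by (rule J_decode)
    have nS: "val x asg j \<noteq> S" using out_less[of x j "asg j"] by (simp add: val_def)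
    note g = gate[OF sat c(2-6)]
    consider "b = 7" | "b = 11" "f" using j(2) nS c(7) by (auto simp: rw_def split: if_splits)
    then show "j \<in> ?g ` ?Y \<union> ?E"
    proof cases
      case 1
      have v2: "v x asg 7 s l t i = 2" using j(2) c 1 by (simp add: rw_def)
      have ok: "s < U x \<and> l < U x \<and> t = 0 \<and> i = 0"
      proof (rule ccontr)
        assume "\<not> ?thesis"
        then have "spec x 4 7 s l t i = 0" by (auto simp: spec_def konst_def)
        then show False using g v2 1 kind_const[OF sat, of 0] by simp
      qed
      then have "active (Q x) s l" using v_answer[OF sat, of s l] v2 by (auto split: if_splits)
      then obtain k where k: "k < ?m" "s = st x k" "l = ql x k" using active_iff by blast
      then have "k \<in> ?Y" using v2 ok by (simp add: yes_def[OF sat])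
      then show ?thesis using c(1) 1 ok k by auto
    next
      case 2
      have v1: "v x asg 11 s l t i = 1" using j(2) c 2 by (simp add: rw_def)
      have ok: "s = 0 \<and> l = 0 \<and> t = 0 \<and> i = 0"
      proof (rule ccontr)
        assume "\<not> ?thesis"
        then have "spec x 4 11 s l t i = 0" by (auto simp: spec_def konst_def)
        then show False using g v1 2 kind_const[OF sat, of 0] by simp
      qed
      then have "of_bool (encode_pair x (map (yes x asg) [0..<?m]) \<in> D) = (1 :: nat)"
        using v1 v_decision[OF sat] by metis
      then have "?d" using 2 by (cases "encode_pair x (map (yes x asg) [0..<?m]) \<in> D") simp_all
      then show ?thesis using c(1) 2 ok by auto
    qed
  next
    fix j assume "j \<in> ?g ` ?Y \<union> ?E"
    then consider k where "k < ?m" "yes x asg k" "j = ?g k" | "?d" "j = gt x 11 0 0 0 0" by (auto split: if_splits)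
    then show "j \<in> {j. j < J x \<and> out x j (asg j) = rw x f j}"
    proof cases
      case 1
      then have "j < J x" "j div K x ^ 4 = 7" using qK K0 by (auto intro: gt_less_J simp: gt_decode)
      then show ?thesis using 1 by (auto simp: rw_def yes_def[OF sat] val_def)
    next
      case 2
      then have "j < J x" "j div K x ^ 4 = 11" using K0 by (auto intro: gt_less_J simp: gt_decode)
      then show ?thesis using 2 v_decision[OF sat] by (auto simp: rw_def val_def)
    qed
  qed
  have inj: "inj_on ?g ?Y"
  proof (rule inj_onI)
    fix k k' assume k: "k \<in> ?Y" "k' \<in> ?Y" "?g k = ?g k'"
    then have "st x k = st x k'"
      using gt_decode(2)[of "st x k" x "ql x k" 0 0 7] gt_decode(2)[of "st x k'" x "ql x k'" 0 0 7] qK K0 by simp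
    then show "k = k'" by (rule pair_start_inj)
  qed
  have disj: "gt x 11 0 0 0 0 \<notin> ?g ` ?Y"
  proof
    assume "gt x 11 0 0 0 0 \<in> ?g ` ?Y"
    then obtain k where "k < ?m" "gt x 11 0 0 0 0 = ?g k" by auto
    then show False using gt_decode(1)[of 0 x 0 0 0 11] gt_decode(1)[of "st x k" x "ql x k" 0 0 7] qK K0 by simp
  qed
  have "card (?g ` ?Y \<union> ?E) = card ?Y + of_bool ?d"
    using inj disj by (auto simp: card_image)
  then show ?thesis unfolding rewards_def eq .
qed

lemma yes_sound:
  assumes sat: "circuit_sat (J x) S (src x) (out x) asg" and k: "k < length (Q x)" "yes x asg k"
  shows "Q x ! k \<in> B"
proof -
  obtain y where y: "length y \<le> poly pB (ql x k)"
    "\<And>i. i < K x \<Longrightarrow> v x asg 5 (st x k) (ql x k) 0 i = tape_content (encode_pair (Q x ! k) y) (int i)"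
    using certificate_ex[OF sat k(1)] by blast
  then show ?thesis
    using v_verdict[OF sat k(1) y] k(2) B_iff by (auto simp: yes_def[OF sat] split: if_splits)
qed

lemma yes_complete_ex:
  "\<exists>asg. circuit_sat (J x) S (src x) (out x) asg \<and> (\<forall>k<length (Q x). yes x asg k \<longleftrightarrow> Q x ! k \<in> B)"
proof -
  define Y where "Y k = (if Q x ! k \<in> B then SOME y. length y \<le> poly pB (ql x k) \<and> encode_pair (Q x ! k) y \<in> R else [])" for k
  have Y: "length (Y k) \<le> poly pB (ql x k) \<and> encode_pair (Q x ! k) (Y k) \<in> R" if "Q x ! k \<in> B" for k
    using someI_ex[OF that[unfolded B_iff]] that by (simp add: Y_def)
  have Ylen: "length (Y k) \<le> poly pB (ql x k)" for k using Y[of k] by (cases "Q x ! k \<in> B") (auto simp: Y_def)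
  have YR: "encode_pair (Q x ! k) (Y k) \<in> R \<longleftrightarrow> Q x ! k \<in> B" for k using Y[of k] Ylen[of k] B_iff by blast
  \<comment> \<open>The address of a free slot tells the query by its start, which is unique, and
    the place in the certificate by its column, counted from the end of the coded query.\<close>
  define g where "g c j = (let k = (SOME k. st x k = j div K x ^ 3 mod K x) in
     tape_content (Y k) (int (j mod K x) - int (2 * ql x k + 2)))" for c j :: nat
  have "g c j < S" for c j using tape_content_bound S3 unfolding g_def Let_def by (meson less_le_trans)
  then obtain asg where sat: "circuit_sat (J x) S (src x) (out x) asg"
    and free: "\<And>j l. j < J x \<Longrightarrow> l < 4 \<Longrightarrow> \<not> src x l j < j \<Longrightarrow> dig S l (asg j) = g l j"
    using circuit_sat_ex[of "out x" S g "J x" "src x"] out_less by blast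
  have "yes x asg k \<longleftrightarrow> Q x ! k \<in> B" if k: "k < length (Q x)" for k
  proof -
    note qb = query_bound(2,3)[OF sat k] and UKs = UK[OF sat]
    note wb = wire_bound[OF sat qb(2)]
    have slot: "slot x asg 5 (st x k) (ql x k) 0 (2 * ql x k + 2 + i) 0 = tape_content (Y k) (int i)"
      if i: "i < poly pB (ql x k)" for i
    proof -
      let ?j = "gt x 5 (st x k) (ql x k) 0 (2 * ql x k + 2 + i)"
      have c: "st x k < K x" "ql x k < K x" "0 < K x" "2 * ql x k + 2 + i < K x" using qb UKs wb i by auto
      have jJ: "?j < J x" using c by (intro gt_less_J) auto
      have "spec x 0 5 (st x k) (ql x k) 0 (2 * ql x k + 2 + i) = J x"
        using qb i by (simp add: spec_def)
      then have "src x 0 ?j = J x" unfolding src_def gt_decode[OF c] .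
      then have "dig S 0 (asg ?j) = g 0 ?j" using free[OF jJ, of 0] jJ by simp
      moreover have "(SOME k'. st x k' = st x k) = k"
        by (rule some_equality) (auto intro: pair_start_inj)
      ultimately show ?thesis unfolding g_def gt_decode[OF c] Let_def by simp
    qed
    have low: "v x asg 5 (st x k) (ql x k) 0 (2 * ql x k + 2 + i) = tape_content (Y k) (int i)" if "i < poly pB (ql x k)" for i
      using that
    proof (induction i)
      case 0
      then show ?case using v_wire_free(1)[OF sat qb] slot[of 0] tape_content_bound[of "Y k" 0] by simp
    next
      case (Suc i)
      then have IH: "v x asg 5 (st x k) (ql x k) 0 (2 * ql x k + 2 + i) = tape_content (Y k) (int i)" by simp
      have "tape_content (Y k) (int i) = 0 \<Longrightarrow> tape_content (Y k) (int (Suc i)) = 0"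
        by (auto simp: tape_content_nat simp del: of_nat_Suc split: if_splits)
      then show ?case
        using v_wire_free(2)[OF sat qb Suc.prems] slot[OF Suc.prems] tape_content_bound[of "Y k" "int (Suc i)"]
        unfolding IH by auto
    qed
    have "v x asg 5 (st x k) (ql x k) 0 (2 * ql x k + 2 + i) = tape_content (Y k) (int i)" if "2 * ql x k + 2 + i < K x" for i
    proof (cases "i < poly pB (ql x k)")
      case False
      then have "tape_content (Y k) (int i) = 0" using Ylen[of k] by (simp add: tape_content_nat)
      then show ?thesis using v_wire_free(3)[OF sat qb, of i] False that by simp
    qed (rule low)
    then have "v x asg 7 (st x k) (ql x k) 0 0 = (if encode_pair (Q x ! k) (Y k) \<in> R then 2 else 1)"
      using wires_of_certificate[OF sat k] by (intro v_verdict[OF sat k Ylen]) blast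
    then show ?thesis using YR[of k] by (simp add: yes_def[OF sat])
  qed
  then show ?thesis using sat by blast
qed

definition yes_count :: "bool list \<Rightarrow> nat" where
  "yes_count x = card {k. k < length (Q x) \<and> Q x ! k \<in> B}"

text \<open>Every yes is certified. If a true yes is missing, this costs at least as much as
  acceptance can gain; if none is missing, the decider works on the true answers and accepts only if
  \<open>x \<in> A\<close>.\<close>

lemma rewards_le:
  assumes sat: "circuit_sat (J x) S (src x) (out x) asg"
  shows "rewards (J x) (out x) (rw x f) asg \<le> yes_count x + of_bool (f \<and> x \<in> A)"
proof -
  let ?Y = "{k. k < length (Q x) \<and> yes x asg k}" and ?Z = "{k. k < length (Q x) \<and> Q x ! k \<in> B}"
  have sub: "?Y \<subseteq> ?Z" using yes_sound[OF sat] by auto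
  show ?thesis
  proof (cases "?Y = ?Z")
    case True
    then have "map (yes x asg) [0..<length (Q x)] = map (\<lambda>q. q \<in> B) (Q x)"
      by (intro nth_equalityI) auto
    then show ?thesis using rewards_eq[OF sat, of f] True A_iff[of x] by (simp add: yes_count_def)
  next
    case False
    then have "card ?Y < card ?Z" using sub by (intro psubset_card_mono) auto
    then show ?thesis using rewards_eq[OF sat, of f] by (simp add: yes_count_def)
  qed
qed

lemma rewards_attained:
  "\<exists>asg. circuit_sat (J x) S (src x) (out x) asg \<and>
     rewards (J x) (out x) (rw x f) asg = yes_count x + of_bool (f \<and> x \<in> A)"
proof -
  obtain asg where sat: "circuit_sat (J x) S (src x) (out x) asg"
    and y: "\<And>k. k < length (Q x) \<Longrightarrow> yes x asg k \<longleftrightarrow> Q x ! k \<in> B"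
    using yes_complete_ex[of x] by blast
  have "map (yes x asg) [0..<length (Q x)] = map (\<lambda>q. q \<in> B) (Q x)"
    using y by (intro nth_equalityI) auto
  moreover have "{k. k < length (Q x) \<and> yes x asg k} = {k. k < length (Q x) \<and> Q x ! k \<in> B}" using y by auto
  ultimately show ?thesis using rewards_eq[OF sat, of f] A_iff[of x] sat by (auto simp: yes_count_def)
qed

definition N :: "bool list \<Rightarrow> nat" where "N x = hard_size (J x) S + 2 * J x"

definition adjG :: "bool list \<Rightarrow> bool \<Rightarrow> nat \<Rightarrow> nat \<Rightarrow> bool" where
  "adjG x f = gadj (J x) S (src x) (out x) (rw x f)"

definition adjK :: "bool list \<Rightarrow> nat \<Rightarrow> nat \<Rightarrow> bool" where
  "adjK x = kadj (N x) (adjG x True) (adjG x False)"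

text \<open>The factor 2 is that of the reward vertices: both values are even and differ by 0 or 2,
  so \<open>alpha x False + 1\<close> never equals \<open>alpha x True\<close> and the larger of
  them reveals whether \<open>x \<in> A\<close>.\<close>

definition alpha :: "bool list \<Rightarrow> bool \<Rightarrow> nat" where
  "alpha x f = (2 * J x + 2) * J x + 2 * (yes_count x + of_bool (f \<and> x \<in> A))"

lemma J_pos: "0 < J x" by (simp add: J_def K_pos)

lemma S_pos: "0 < S" using S3 by simp

lemma alpha_upper: "indep (N x) (adjG x f) I \<Longrightarrow> card I \<le> alpha x f"
  unfolding adjG_def N_def alpha_def
  by (rule gadj_indep_le[OF _ J_pos S_pos rewards_le])

lemma alpha_attained: "\<exists>I. indep (N x) (adjG x f) I \<and> card I = alpha x f"
proof -
  obtain asg where asg: "circuit_sat (J x) S (src x) (out x) asg"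
    "rewards (J x) (out x) (rw x f) asg = yes_count x + of_bool (f \<and> x \<in> A)"
    using rewards_attained by blast
  show ?thesis
    using gadj_indep_ex[OF asg(1) J_pos S_pos, of "rw x f"] unfolding adjG_def N_def alpha_def asg(2) .
qed

text \<open>Leaves a vertex of the first graph outside the independent set, which
  \<open>kadj_pmatch_first\<close> needs as partner of the extra vertex.\<close>

lemma alpha_less: "alpha x f < N x"
proof -
  obtain asg where "rewards (J x) (out x) (rw x f) asg = yes_count x + of_bool (f \<and> x \<in> A)"
    using rewards_attained by blast
  moreover have "rewards (J x) (out x) (rw x f) asg \<le> card {..<J x}"
    unfolding rewards_def by (intro card_mono) auto
  ultimately have "alpha x f \<le> (2 * J x + 2) * J x + 2 * J x" by (simp add: alpha_def)
  moreover have "1 < S ^ 4" using S3 by (intro one_less_power) auto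
  then have "(2 * J x + 2) * J x * 1 < (2 * J x + 2) * J x * S ^ 4"
    using J_pos[of x] by (intro mult_strict_left_mono) auto
  ultimately show ?thesis unfolding N_def hard_size_def by linarith
qed

lemma alpha_even: "even (alpha x f)" by (simp add: alpha_def)

lemma alpha_pos: "1 \<le> alpha x f" using J_pos[of x] by (simp add: alpha_def)

lemma alpha_relation: "alpha x True = alpha x False + 2 * of_bool (x \<in> A)"
  by (simp add: alpha_def)

lemma simple_adjG: "simple_adj (adjG x f)"
  unfolding adjG_def by (rule simple_gadj)

lemma simple_adjK: "simple_adj (adjK x)"
  unfolding adjK_def by (intro simple_kadj simple_adjG)

text \<open>\<open>s\<close> is the size of the cheapest matched cover. A minimum cover misses
  \<open>max (alpha x True) (alpha x False + 1)\<close> vertices, so its size \<open>k\<close> is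
  \<open>s\<close> for \<open>x \<in> A\<close> and \<open>s - 1\<close> otherwise, and
  \<open>ratio_balance\<close> detects the difference.\<close>

lemma reduction_correct:
  fixes p q :: nat and x :: "bool list"
  assumes pq: "0 < q" "q \<le> p" "p < 2 * q"
  defines "Y \<equiv> (p - q) * (2 * q - p)" and "Z \<equiv> 2 * (p - q)\<^sup>2" and "X \<equiv> q * (2 * q - p)"
  defines "G \<equiv> graph_of ((4 * Y + 2 * Z + X) * (4 * N x + 2)) (fadj Y Z (4 * N x + 2) (adjK x))"
  shows "q * min_ed G \<le> p * mvc G \<longleftrightarrow> x \<in> A"
proof -
  let ?n = "4 * N x + 2"
  define s where "s = ?n - alpha x True"
  define k where "k = (if x \<in> A then s else s - 1)"
  have an: "alpha x True < ?n" "alpha x False < ?n" using alpha_less[of x True] alpha_less[of x False] by auto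
  have s: "s + alpha x True = ?n" "even s" "0 < s" using an alpha_even[of x True] by (auto simp: s_def)
  interpret copies Y Z X ?n "adjK x" by standard (auto simp: simple_adjK)
  have ge: "?n \<le> card C + max (alpha x True) (alpha x False + 1)" if "cover {..<?n} (adjK x) C" for C
    using that unfolding adjK_def by (rule kadj_cover_ge[rotated 3]) (auto simp: alpha_upper alpha_pos[unfolded One_nat_def])
  have s1: "s \<le> card C + 1" if "cover {..<?n} (adjK x) C" for C
    using ge[OF that] s(1) alpha_relation[of x] by auto
  have kge: "k \<le> card C" if "cover {..<?n} (adjK x) C" for C
    using ge[OF that] s(1) alpha_relation[of x] by (auto simp: k_def)
  obtain I where I: "indep (N x) (adjG x True) I" "card I = alpha x True" using alpha_attained by blast
  obtain I' where I': "indep (N x) (adjG x False) I'" "card I' = alpha x False" using alpha_attained by blast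
  obtain C f where Cf: "cover {..<?n} (adjK x) C" "pmatch (adjK x) C f" "card C + alpha x True = ?n"
    using kadj_pmatch_first[OF simple_adjG[of x True] simple_adjG[of x False] I(1)] I(2) alpha_even alpha_less
    unfolding adjK_def by auto
  then have Cs: "card C = s" using s by simp
  have kex: "\<exists>D. cover {..<?n} (adjK x) D \<and> card D = k"
  proof (cases "x \<in> A")
    case True
    then show ?thesis using Cf Cs by (auto simp: k_def)
  next
    case False
    obtain D where "cover {..<?n} (adjK x) D" "card D + (alpha x False + 1) = ?n"
      using kadj_cover_second[OF simple_adjG[of x True] simple_adjG[of x False] I'(1)] I'(2) unfolding adjK_def by auto
    then show ?thesis using False s alpha_relation[of x] by (intro exI[of _ D]) (auto simp: k_def)
  qed
  have "min_ed G = (2 * ?n + s) * Y + 2 * ?n * Z + s * X"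
    unfolding G_def using Cf Cs by (intro min_ed_copies s s1) blast+
  moreover have "mvc G = 2 * ?n * Y + ?n * Z + k * X"
    unfolding G_def by (intro mvc_copies kge kex)
  moreover have "k = s \<or> Suc k = s" using s(3) by (auto simp: k_def)
  then have "q * ((2 * ?n + s) * Y + 2 * ?n * Z + s * X) \<le> p * (2 * ?n * Y + ?n * Z + k * X) \<longleftrightarrow> k = s"
    unfolding Y_def Z_def X_def by (rule ratio_balance[OF pq])
  moreover have "k = s \<longleftrightarrow> x \<in> A" using s(3) by (auto simp: k_def)
  ultimately show ?thesis by simp
qed

section \<open>The constructed graph is computable in polynomial time\<close>

lemma pexp_sizes:
  "pexp (\<lambda>x e. U x)" "pexp (\<lambda>x e. W x)" "pexp (\<lambda>x e. V x)" "pexp (\<lambda>x e. T x)" "pexp (\<lambda>x e. K x)" "pexp (\<lambda>x e. J x)"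
  "pexp (\<lambda>x e. N x)"
  unfolding N_def hard_size_def J_def K_def T_def V_def W_def U_def by (intro pexp_intros)+

lemma pexp_gt:
  assumes "pexp b" "pexp s" "pexp l" "pexp t" "pexp i"
  shows "pexp (\<lambda>x e. gt x (b x e) (s x e) (l x e) (t x e) (i x e))"
  unfolding gt_def by (intro pexp_intros pexp_sizes assms)

lemma pexp_sel:
  assumes "pexp c" "pexp a0" "pexp a1" "pexp a2" "pexp a3" "pexp k"
  shows "pexp (\<lambda>x e. sel (c x e) (a0 x e) (a1 x e) (a2 x e) (a3 x e) (k x e))"
  unfolding sel_def by (intro pexp_intros assms)

lemma pexp_symat: "pexp i \<Longrightarrow> pexp (\<lambda>x e. symat x (i x e))"
  unfolding symat_def by (intro pexp_intros)

lemma pexp_konst: "pexp c \<Longrightarrow> pexp k \<Longrightarrow> pexp (\<lambda>x e. konst x (c x e) (k x e))"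
  unfolding konst_def by (intro pexp_sel pexp_sizes)

lemma pexp_run_spec:
  assumes "pexp c" "pexp b" "pexp s" "pexp l" "pexp t" "pexp i"
  shows "pexp (\<lambda>x e. run_spec x (c x e) m (b x e) (s x e) (l x e) (t x e) (i x e))"
  unfolding run_spec_def by (intro pexp_sel pexp_gt pexp_sizes assms pexp_intros)

lemma pexp_spec:
  assumes "pexp c" "pexp b" "pexp s" "pexp l" "pexp t" "pexp i"
  shows "pexp (\<lambda>x e. spec x (c x e) (b x e) (s x e) (l x e) (t x e) (i x e))"
  unfolding spec_def by (intro pexp_sel pexp_gt pexp_konst pexp_symat pexp_run_spec pexp_sizes assms pexp_intros)

lemma pexp_src:
  assumes "pexp c" "pexp j"
  shows "pexp (\<lambda>x e. src x (c x e) (j x e))"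
  unfolding src_def by (intro pexp_spec pexp_sizes assms pexp_intros)

lemma pexp_out:
  assumes "pexp j" "pexp a"
  shows "pexp (\<lambda>x e. out x (j x e) (a x e))"
  unfolding out_def table_def by (intro pexp_table pexp_src pexp_intros assms)

lemma pexp_dig: "pexp a \<Longrightarrow> pexp (\<lambda>x e. dig S l (a x e))"
  unfolding dig_def by (intro pexp_intros)

lemma ex_less4: "(\<exists>l<4. P l) \<longleftrightarrow> P 0 \<or> P 1 \<or> P 2 \<or> P (3 :: nat)"
proof -
  have "l < 4 \<longleftrightarrow> l = 0 \<or> l = 1 \<or> l = 2 \<or> l = (3 :: nat)" for l by auto
  then show ?thesis by auto
qed

lemma pexp_conflict:
  assumes "pexp j" "pexp a" "pexp j'" "pexp a'"
  shows "pexp (\<lambda>x e. of_bool (conflict S (src x) (out x) (j x e) (a x e) (j' x e) (a' x e)))"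
  unfolding conflict_def ex_less4 by (intro pexp_intros pexp_src pexp_out pexp_dig assms)

lemma pexp_rw: "pexp j \<Longrightarrow> pexp (\<lambda>x e. rw x f (j x e))"
  unfolding rw_def by (intro pexp_intros pexp_sizes)

lemma pexp_of_bool_if:
  "pexp (\<lambda>x e. of_bool (P x e)) \<Longrightarrow> pexp (\<lambda>x e. of_bool (F x e)) \<Longrightarrow> pexp (\<lambda>x e. of_bool (G x e)) \<Longrightarrow>
   pexp (\<lambda>x e. of_bool (if P x e then F x e else G x e))"
  by (rule pexp_cong[OF pexp_if[of P "\<lambda>x e. of_bool (F x e)" "\<lambda>x e. of_bool (G x e)"]]) auto

lemma pexp_adjG:
  assumes "pexp u" "pexp w"
  shows "pexp (\<lambda>x e. of_bool (adjG x f (u x e) (w x e)))"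
  unfolding adjG_def gadj_def hard_size_def
  by (intro pexp_of_bool_if pexp_intros pexp_conflict pexp_out pexp_rw pexp_sizes assms)

lemma pexp_adjK:
  assumes "pexp u" "pexp w"
  shows "pexp (\<lambda>x e. of_bool (adjK x (u x e) (w x e)))"
  unfolding adjK_def kadj_def by (intro pexp_of_bool_if pexp_intros pexp_adjG pexp_sizes assms)

lemma pexp_fadj:
  assumes "pexp u" "pexp w"
  shows "pexp (\<lambda>x e. of_bool (fadj Y Z (4 * N x + 2) (adjK x) (u x e) (w x e)))"
  unfolding fadj_def fbase_def flink_def by (intro pexp_intros pexp_adjK pexp_sizes assms)

end

section \<open>Graphs as strings\<close>

lemma concat_map_upt:
  "concat (map (\<lambda>i. map (f i) [0..<m]) [0..<n]) = map (\<lambda>k. f (k div m) (k mod m)) [0..<n * m]"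
proof (induction n)
  case (Suc n)
  have "[0..<Suc n * m] = [0..<n * m] @ map (\<lambda>j. n * m + j) [0..<m]"
    using upt_add_eq_append[of 0 "n * m" m] map_add_upt[of "n * m" m] by (simp add: add.commute)
  then have "map (\<lambda>k. f (k div m) (k mod m)) [0..<Suc n * m] =
      map (\<lambda>k. f (k div m) (k mod m)) [0..<n * m] @ map (\<lambda>j. f ((n * m + j) div m) ((n * m + j) mod m)) [0..<m]"
    by (simp del: mult_Suc)
  moreover have "map (\<lambda>j. f ((n * m + j) div m) ((n * m + j) mod m)) [0..<m] = map (f n) [0..<m]"
    by (intro map_cong) auto
  ultimately show ?case using Suc by (simp del: mult_Suc)
qed simp

lemma encode_graph_of:
  assumes "simple_adj adj"
  shows "encode_graph (graph_of n adj) = map (\<lambda>k. adj (k div n) (k mod n)) [0..<n * n]"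
proof -
  have "encode_graph (graph_of n adj) = concat (map (\<lambda>i. map (adj i) [0..<n]) [0..<n])"
    using graph_of_edge[OF assms, of _ _ n]
    by (auto simp: encode_graph_def graph_of_def intro!: arg_cong[of _ _ concat])
  then show ?thesis by (simp add: concat_map_upt)
qed

definition madj :: "bool list \<Rightarrow> nat \<Rightarrow> nat \<Rightarrow> nat \<Rightarrow> bool" where
  "madj x n i j \<longleftrightarrow> i < n \<and> j < n \<and> x ! (i * n + j)"

lemma mat_index_less: "i < n \<Longrightarrow> j < n \<Longrightarrow> i * n + j < n * (n :: nat)"
proof -
  assume "i < n" "j < n"
  then have "i * n + j < Suc i * n" by simp
  also have "\<dots> \<le> n * n" using \<open>i < n\<close> by (intro mult_le_mono1) simp
  finally show ?thesis .
qed

text \<open>The length of a string fixes the order of the graph, and any symmetric matrix with empty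
  diagonal is a code; so membership can be read off the string itself.\<close>

lemma S_ED_iff:
  "x \<in> S_ED r \<longleftrightarrow> (\<exists>n. 0 < n \<and> length x = n * n \<and> simple_adj (madj x n) \<and>
     of_nat (min_ed (graph_of n (madj x n))) \<le> r * of_nat (mvc (graph_of n (madj x n))))"
proof
  assume "x \<in> S_ED r"
  then obtain G where G: "x = encode_graph G" "is_graph G" "fst G = {0..<card (fst G)}"
    "of_nat (min_ed G) \<le> r * of_nat (mvc G)" by (auto simp: S_ED_def)
  obtain E n where GE: "G = ({0..<n}, E)" using G(3) by (metis prod.collapse)
  have n: "0 < n" and E: "\<And>e. e \<in> E \<Longrightarrow> e \<subseteq> {0..<n} \<and> card e = 2"
    using G(2) by (auto simp: GE is_graph_def)
  have x: "x = map (\<lambda>k. {k div n, k mod n} \<in> E) [0..<n * n]"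
    using G(1) concat_map_upt[of "\<lambda>i j. {i, j} \<in> E" n n] by (simp add: GE encode_graph_def)
  have m: "madj x n i j \<longleftrightarrow> {i, j} \<in> E" for i j
  proof (cases "i < n \<and> j < n")
    case True
    then show ?thesis using mat_index_less[of i n j] by (auto simp: madj_def x)
  next
    case False
    then show ?thesis using E[of "{i, j}"] by (auto simp: madj_def)
  qed
  have simple: "simple_adj (madj x n)"
    unfolding simple_adj_def m using E by (force simp: insert_commute)
  have "graph_of n (madj x n) = G"
  proof -
    have "e \<in> {{u, w} |u w. u < n \<and> w < n \<and> {u, w} \<in> E} \<longleftrightarrow> e \<in> E" for e
    proof
      assume e: "e \<in> E"
      then obtain u w where "e = {u, w}" using E[OF e] by (auto simp: card_2_iff)
      then show "e \<in> {{u, w} |u w. u < n \<and> w < n \<and> {u, w} \<in> E}" using e E[OF e] by force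
    qed auto
    then show ?thesis unfolding graph_of_def m GE by blast
  qed
  then show "\<exists>n. 0 < n \<and> length x = n * n \<and> simple_adj (madj x n) \<and>
     of_nat (min_ed (graph_of n (madj x n))) \<le> r * of_nat (mvc (graph_of n (madj x n)))"
    using n simple G(4) x by (intro exI[of _ n]) auto
next
  assume "\<exists>n. 0 < n \<and> length x = n * n \<and> simple_adj (madj x n) \<and>
     of_nat (min_ed (graph_of n (madj x n))) \<le> r * of_nat (mvc (graph_of n (madj x n)))"
  then obtain n where n: "0 < n" "length x = n * n" "simple_adj (madj x n)"
    "of_nat (min_ed (graph_of n (madj x n))) \<le> r * of_nat (mvc (graph_of n (madj x n)))" by blast
  have "x = map (\<lambda>k. madj x n (k div n) (k mod n)) [0..<n * n]"
    using n by (intro nth_equalityI) (auto simp: madj_def less_mult_imp_div_less)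
  then have "x = encode_graph (graph_of n (madj x n))"
    using encode_graph_of[OF n(3), of n] by simp
  moreover have "is_graph (graph_of n (madj x n))"
    using graph_of_card_edge[OF n(3), of _ n] n(1) by (auto simp: is_graph_def graph_of_def)
  moreover have "fst (graph_of n (madj x n)) = {0..<card (fst (graph_of n (madj x n)))}"
    by (simp add: graph_of_def)
  ultimately show "x \<in> S_ED r" using n(4) unfolding S_ED_def by blast
qed

lemma encode_graph_in_S_ED:
  assumes "simple_adj adj" "0 < n"
  shows "encode_graph (graph_of n adj) \<in> S_ED r \<longleftrightarrow> of_nat (min_ed (graph_of n adj)) \<le> r * of_nat (mvc (graph_of n adj))"
proof -
  define x where "x = encode_graph (graph_of n adj)"
  have len: "length x = n * n" by (simp add: x_def encode_graph_of[OF assms(1)])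
  have m: "madj x n i j \<longleftrightarrow> i < n \<and> j < n \<and> adj i j" for i j
    using mat_index_less[of i n j] by (auto simp: madj_def x_def encode_graph_of[OF assms(1)])
  have "graph_of n (madj x n) = graph_of n adj" unfolding graph_of_def m by auto
  moreover have "simple_adj (madj x n)" using assms(1) unfolding simple_adj_def m by auto
  moreover have "n' = n" if "length x = n' * n'" for n'
    using that len by (metis power2_eq_square power2_eq_iff_nonneg zero_le)
  ultimately have "x \<in> S_ED r \<longleftrightarrow> of_nat (min_ed (graph_of n adj)) \<le> r * of_nat (mvc (graph_of n adj))"
    unfolding S_ED_iff using len assms(2) by metis
  then show ?thesis by (simp add: x_def)
qed

lemma ratio_nat:
  fixes r :: rat
  assumes "1 \<le> r" "r < 2"
  shows "\<exists>p q :: nat. 0 < q \<and> q \<le> p \<and> p < 2 * q \<and>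
    (\<forall>a b :: nat. of_nat a \<le> r * of_nat b \<longleftrightarrow> q * a \<le> p * b)"
proof -
  obtain a b where ab: "quotient_of r = (a, b)" by fastforce
  have b: "0 < b" using quotient_of_denom_pos[OF ab] .
  have r: "r = of_int a / of_int b" using quotient_of_div[OF ab] .
  have ab1: "b \<le> a" "a < 2 * b"
  proof -
    have "of_int b \<le> (of_int a :: rat)" using assms(1) b unfolding r by (simp add: field_simps)
    then show "b \<le> a" by simp
    have "(of_int a :: rat) < of_int (2 * b)" using assms(2) b unfolding r by (simp add: field_simps)
    then show "a < 2 * b" by (simp only: of_int_less_iff)
  qed
  define p q where "p = nat a" and "q = nat b"
  have pq: "a = int p" "b = int q" using b ab1 by (auto simp: p_def q_def)
  have r': "r = of_nat p / of_nat q" using r by (simp add: pq)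
  have q0: "0 < q" using b by (simp add: q_def)
  show ?thesis
  proof (intro exI conjI allI)
    show "q \<le> p" "p < 2 * q" using ab1 by (auto simp: pq)
    fix c d :: nat
    have "of_nat c \<le> r * of_nat d \<longleftrightarrow> of_nat (q * c) \<le> (of_nat (p * d) :: rat)"
      using q0 unfolding r' by (simp add: field_simps)
    then show "of_nat c \<le> r * of_nat d \<longleftrightarrow> q * c \<le> p * d" by (simp only: of_nat_le_iff)
  qed (rule q0)
qed

theorem S_ED_hard:
  assumes r: "1 \<le> r" "r < 2" and "A \<in> class_P_NP_par"
  shows "A \<le>\<^sub>m S_ED r"
proof -
  obtain B where B: "B \<in> class_NP" "A \<le>\<^sub>t\<^sub>t B" using assms(3) by (auto simp: class_P_NP_par_def)
  obtain Q D where QD: "polytime_computable (\<lambda>x. encode_list (Q x))" "D \<in> class_P"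
    "\<And>x. x \<in> A \<longleftrightarrow> encode_pair x (map (\<lambda>q. q \<in> B) (Q x)) \<in> D"
    using B(2) unfolding tt_reducible_def by blast
  obtain R pB where R: "R \<in> class_P" "\<And>x. x \<in> B \<longleftrightarrow> (\<exists>y. length y \<le> poly pB (length x) \<and> encode_pair x y \<in> R)"
    using B(1) unfolding class_NP_def by blast
  obtain MQ pQ where MQ: "wf_tm MQ" "\<And>x. computes_within MQ x (encode_list (Q x)) (poly pQ (length x))"
    using QD(1) unfolding polytime_computable_def by blast
  obtain MR pR where MR: "wf_tm MR" "\<And>x. computes_within MR x [x \<in> R] (poly pR (length x))"
    using R(1) unfolding class_P_def polytime_computable_def by blast
  obtain MD pD where MD: "wf_tm MD" "\<And>x. computes_within MD x [x \<in> D] (poly pD (length x))"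
    using QD(2) unfolding class_P_def polytime_computable_def by blast
  obtain S1 where S1: "\<And>c. valid_config MQ c \<Longrightarrow> (\<forall>p. cellv c p < S1 \<and> scanv c p < S1) \<and> globv c < S1"
    using codes_bounded[of MQ] by metis
  obtain S2 where S2: "\<And>c. valid_config MR c \<Longrightarrow> (\<forall>p. cellv c p < S2 \<and> scanv c p < S2) \<and> globv c < S2"
    using codes_bounded[of MR] by metis
  obtain S3 where S3: "\<And>c. valid_config MD c \<Longrightarrow> (\<forall>p. cellv c p < S3 \<and> scanv c p < S3) \<and> globv c < S3"
    using codes_bounded[of MD] by metis
  \<comment> \<open>One alphabet for all three machines; the additional 3 makes room for the tape
    symbols 0, 1 and 2.\<close>
  interpret tt_reduction MQ MR MD pQ pR pD pB Q R D B A "S1 + S2 + S3 + 3"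
  proof (unfold_locales, goal_cases)
    case (10 c)
    then show ?case using S1[OF 10] by (auto intro: trans_less_add1 trans_less_add2)
  next
    case (11 c)
    then show ?case using S2[OF 11] by (auto intro: trans_less_add1 trans_less_add2)
  next
    case (12 c)
    then show ?case using S3[OF 12] by (auto intro: trans_less_add1 trans_less_add2)
  qed (fact MQ MR MD R QD | simp)+
  obtain p q :: nat where pq: "0 < q" "q \<le> p" "p < 2 * q"
    and ratio: "\<forall>a b :: nat. of_nat a \<le> r * of_nat b \<longleftrightarrow> q * a \<le> p * b"
    using ratio_nat[OF r] by blast
  define Y Z X where "Y = (p - q) * (2 * q - p)" and "Z = 2 * (p - q)\<^sup>2" and "X = q * (2 * q - p)"
  define L where "L x = (4 * Y + 2 * Z + X) * (4 * N x + 2)" for x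
  define adj where "adj x = fadj Y Z (4 * N x + 2) (adjK x)" for x
  have simple: "simple_adj (adj x)" for x unfolding adj_def by (intro simple_fadj simple_adjK)
  have L0: "0 < L x" for x using pq by (simp add: L_def X_def)
  have "polytime_computable (\<lambda>x. encode_graph (graph_of (L x) (adj x)))"
  proof (rule polytime_computable_pexp)
    show "pexp (\<lambda>x e. L x * L x)" unfolding L_def by (intro pexp_intros pexp_sizes)
    show "pexp (\<lambda>x e. of_bool (adj x (hd0 e div L x) (hd0 e mod L x)))"
      unfolding adj_def L_def by (intro pexp_fadj pexp_intros pexp_sizes)
    show "encode_graph (graph_of (L x) (adj x)) = map (\<lambda>k. adj x (k div L x) (k mod L x)) [0..<L x * L x]" for x
      by (rule encode_graph_of[OF simple])
  qed
  moreover have "x \<in> A \<longleftrightarrow> encode_graph (graph_of (L x) (adj x)) \<in> S_ED r" for x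
    unfolding encode_graph_in_S_ED[OF simple L0] ratio[rule_format]
    using reduction_correct[OF pq(1-3), of x] unfolding L_def adj_def Y_def Z_def X_def by blast
  ultimately show ?thesis unfolding many_one_reducible_def by blast
qed

subsection \<open>Membership\<close>

text \<open>The length of the first component of a coded pair: the number of pairs of bits before the first pair 01.\<close>

definition zlen :: "bool list \<Rightarrow> nat" where
  "zlen w = (\<Sum>k<length w. of_bool (\<forall>i<Suc k. \<not> (bit_at w (2 * i) = 0 \<and> bit_at w (2 * i + 1) = 1)))"

definition isqrt :: "nat \<Rightarrow> nat" where
  "isqrt m = (\<Sum>k<m. of_bool (Suc k * Suc k \<le> m))"

lemma card_eq_sum_of_bool: "card {i. i < (n :: nat) \<and> P i} = (\<Sum>i<n. of_bool (P i))"
proof -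
  have "(\<Sum>i<n. of_bool (P i)) = card ({..<n} \<inter> {i. P i})" by (simp add: of_bool_def sum.If_cases)
  also have "{..<n} \<inter> {i. P i} = {i. i < n \<and> P i}" by auto
  finally show ?thesis by simp
qed

lemma isqrt_square: "isqrt (n * n) = n"
proof -
  have "Suc k * Suc k \<le> n * n \<longleftrightarrow> k < n" for k
    using mult_le_mono[of "Suc k" n "Suc k" n] mult_strict_mono'[of n "Suc k" n "Suc k"] by (metis Suc_le_eq not_le zero_le)
  then have "isqrt (n * n) = (\<Sum>k<n * n. of_bool (k < n))" by (simp add: isqrt_def)
  also have "\<dots> = card ({..<n * n} \<inter> {k. k < n})" by (simp add: of_bool_def sum.If_cases)
  also have "{..<n * n} \<inter> {k. k < n} = {..<n}" by (cases n) (auto intro: less_le_trans)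
  finally show ?thesis by simp
qed

lemma bit_at_append: "bit_at (x @ y) i = (if i < length x then bit_at x i else bit_at y (i - length x))"
  by (auto simp: bit_at_def nth_append)

lemma bit_at_encode_string:
  "i < length x \<Longrightarrow> bit_at (encode_string x) (2 * i) = bit_at x i"
  "i < length x \<Longrightarrow> bit_at (encode_string x) (2 * i + 1) = bit_at x i"
  by (simp_all add: bit_at_def nth_encode_string)

lemma bit_at_pair:
  "i < length z \<Longrightarrow> bit_at (encode_pair z y) (2 * i) = bit_at z i"
  "bit_at (encode_pair z y) (2 * length z + 2 + i) = bit_at y i"
  by (simp_all add: encode_pair_def bit_at_append bit_at_encode_string)

lemma zlen_pair: "zlen (encode_pair z y) = length z"
proof -
  let ?w = "encode_pair z y"
  have t: "\<not> (bit_at ?w (2 * i) = 0 \<and> bit_at ?w (2 * i + 1) = 1)" if "i < length z" for i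
    using that bit_at_encode_string[of i z] by (auto simp: encode_pair_def bit_at_append)
  have e: "bit_at ?w (2 * length z) = 0 \<and> bit_at ?w (2 * length z + 1) = 1"
    by (simp add: encode_pair_def bit_at_append) (simp add: bit_at_def nth_encode_string)
  have "(\<forall>i<Suc k. \<not> (bit_at ?w (2 * i) = 0 \<and> bit_at ?w (2 * i + 1) = 1)) \<longleftrightarrow> k < length z" for k
    using t e by (metis less_Suc_eq less_trans_Suc not_less_eq)
  then have "zlen ?w = (\<Sum>k<length ?w. of_bool (k < length z))" by (simp add: zlen_def)
  also have "\<dots> = card ({..<length ?w} \<inter> {k. k < length z})" by (simp add: of_bool_def sum.If_cases)
  also have "{..<length ?w} \<inter> {k. k < length z} = {..<length z}" by (auto simp: encode_pair_def)
  finally show ?thesis by simp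
qed

text \<open>The query number \<open>c\<close>, in unary, precedes \<open>x\<close>. Query \<open>2 * j\<close> asks for a cover of size at most \<open>j\<close>, query
  \<open>2 * j + 1\<close> for an ED output of size at most \<open>p / q * j\<close>.\<close>

definition query :: "bool list \<Rightarrow> nat \<Rightarrow> bool list" where
  "query x c = map (\<lambda>k. k < c) [0..<2 * length x + 2] @ x"

definition queries :: "bool list \<Rightarrow> bool list list" where
  "queries x = map (query x) [0..<2 * length x + 2]"

lemma length_query [simp]: "length (query x c) = 3 * length x + 2"
  by (simp add: query_def)

text \<open>The query number is padded to a fixed length, so all coded queries are equally long and
  the list is a matrix with rows of this length; a bit is found by division with remainder.\<close>

definition qblock :: "bool list \<Rightarrow> nat" where
  "qblock x = 2 * (3 * length x + 2) + 2"

definition query_bit :: "bool list \<Rightarrow> nat \<Rightarrow> nat \<Rightarrow> bool" where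
  "query_bit x c i = (if i < 2 * (3 * length x + 2) then
      (if i div 2 < 2 * length x + 2 then i div 2 < c else bit_at x (i div 2 - (2 * length x + 2)) = 1)
    else i = 2 * (3 * length x + 2) + 1)"

lemma encode_queries:
  "encode_list (queries x) = map (\<lambda>k. query_bit x (k div qblock x) (k mod qblock x)) [0..<(2 * length x + 2) * qblock x]"
proof -
  have "encode_string (query x c) = map (query_bit x c) [0..<qblock x]" for c
  proof (intro nth_equalityI)
    fix i assume "i < length (encode_string (query x c))"
    then have i: "i < 2 * (3 * length x + 2) + 2" by simp
    show "encode_string (query x c) ! i = map (query_bit x c) [0..<qblock x] ! i"
    proof (cases "i < 2 * (3 * length x + 2)")
      case True
      then have "i div 2 < 3 * length x + 2" by (simp add: less_mult_imp_div_less)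
      then show ?thesis
        using i True nth_encode_string[of i "query x c"]
        by (simp add: query_bit_def qblock_def bit_at_def query_def nth_append del: upt_Suc)
    next
      case False
      then show ?thesis
        using i nth_encode_string[of i "query x c"] by (simp add: query_bit_def qblock_def del: upt_Suc)
    qed
  qed (simp add: qblock_def)
  then show ?thesis
    using concat_map_upt[of "query_bit x" "qblock x" "2 * length x + 2"]
    by (simp add: encode_list_def queries_def comp_def)
qed

lemma polytime_queries: "polytime_computable (\<lambda>x. encode_list (queries x))"
proof (rule polytime_computable_pexp[OF _ _ encode_queries])
  show "pexp (\<lambda>x e. (2 * length x + 2) * qblock x)" unfolding qblock_def by (intro pexp_intros)
  show "pexp (\<lambda>x e. of_bool (query_bit x (hd0 e div qblock x) (hd0 e mod qblock x)))"
    unfolding query_bit_def qblock_def if_bool_eq_disj by (intro pexp_intros)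
qed

text \<open>A query has length \<open>3 * length x + 2\<close>; solving for \<open>length x\<close>
  makes its parts accessible.\<close>

definition xlen :: "bool list \<Rightarrow> nat" where "xlen w = (zlen w - 2) div 3"
definition qnum :: "bool list \<Rightarrow> nat" where "qnum w = (\<Sum>k<2 * xlen w + 2. bit_at w (2 * k))"
definition order :: "bool list \<Rightarrow> nat" where "order w = isqrt (xlen w)"
definition wadj :: "bool list \<Rightarrow> nat \<Rightarrow> nat \<Rightarrow> bool" where
  "wadj w i j \<longleftrightarrow> bit_at w (2 * (2 * xlen w + 2 + (i * order w + j))) = 1"
definition cert :: "bool list \<Rightarrow> nat \<Rightarrow> nat" where "cert w i = bit_at w (2 * zlen w + 2 + i)"

definition cover_check :: "bool list \<Rightarrow> bool" where
  "cover_check w \<longleftrightarrow> (\<forall>i<order w. \<forall>j<order w. wadj w i j \<longrightarrow> cert w i = 1 \<or> cert w j = 1) \<and>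
     (\<Sum>i<order w. cert w i) \<le> qnum w div 2"

text \<open>The certificate is the adjacency matrix of a matching: symmetric, part of the graph, at
  most one entry in a row. The nonempty rows are the matched vertices, so the number of ones is the
  size of the ED output.\<close>

definition ed_check :: "nat \<Rightarrow> nat \<Rightarrow> bool list \<Rightarrow> bool" where
  "ed_check p q w \<longleftrightarrow>
     (\<forall>i<order w. \<forall>j<order w. cert w (i * order w + j) = 1 \<longrightarrow> cert w (j * order w + i) = 1 \<and> wadj w i j) \<and>
     (\<forall>i<order w. \<forall>j<order w. \<forall>k<order w.
        cert w (i * order w + j) = 1 \<longrightarrow> cert w (i * order w + k) = 1 \<longrightarrow> j = k) \<and>
     (\<forall>i<order w. \<forall>j<order w. wadj w i j \<longrightarrow>
        (\<exists>k<order w. cert w (i * order w + k) = 1) \<or> (\<exists>k<order w. cert w (j * order w + k) = 1)) \<and>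
     q * (\<Sum>i<order w. \<Sum>j<order w. cert w (i * order w + j)) \<le> p * (qnum w div 2)"

definition verifier :: "nat \<Rightarrow> nat \<Rightarrow> bool list set" where
  "verifier p q = {w. if qnum w mod 2 = 0 then cover_check w else ed_check p q w}"

text \<open>Strings that code no graph are rejected here, whatever the oracle says about the queries
  built from them.\<close>

definition decider :: "bool list set" where
  "decider = {w. 0 < zlen w \<and> isqrt (zlen w) * isqrt (zlen w) = zlen w \<and>
     (\<forall>i<isqrt (zlen w). \<not> bit_at w (2 * (i * isqrt (zlen w) + i)) = 1) \<and>
     (\<forall>i<isqrt (zlen w). \<forall>j<isqrt (zlen w).
        bit_at w (2 * (i * isqrt (zlen w) + j)) = 1 \<longrightarrow> bit_at w (2 * (j * isqrt (zlen w) + i)) = 1) \<and>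
     (\<forall>j<Suc (zlen w). cert w (2 * j) = 1 \<longrightarrow> cert w (2 * j + 1) = 1)}"

text \<open>\<open>[:0, 1:]\<close> is the identity polynomial: certificates with \<open>n\<close>
  or \<open>n * n\<close> bits suffice, and a query is at least as long.\<close>

definition oracle_set :: "nat \<Rightarrow> nat \<Rightarrow> bool list set" where
  "oracle_set p q = {z. \<exists>y. length y \<le> poly [:0, 1:] (length z) \<and> encode_pair z y \<in> verifier p q}"

lemma class_P_pexp:
  assumes "pexp (\<lambda>x e. of_bool (x \<in> L))"
  shows "L \<in> class_P"
proof -
  have "polytime_computable (\<lambda>x. [x \<in> L])"
    by (rule polytime_computable_pexp[where l = "\<lambda>x e. 1" and P = "\<lambda>x i. x \<in> L"]) (auto intro: assms pexp_const)
  then show ?thesis by (simp add: class_P_def)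
qed

lemma pexp_zlen: "pexp (\<lambda>x e. zlen x)"
  unfolding zlen_def by (intro pexp_intros)

lemma pexp_isqrt:
  assumes "pexp a" shows "pexp (\<lambda>x e. isqrt (a x e))"
  by (rule pexp_comp1[OF _ assms]) (unfold isqrt_def, intro pexp_intros)

lemma pexp_parts: "pexp (\<lambda>x e. xlen x)" "pexp (\<lambda>x e. qnum x)" "pexp (\<lambda>x e. order x)"
  unfolding order_def qnum_def xlen_def by (intro pexp_isqrt pexp_intros pexp_zlen)+

lemma pexp_wadj: "pexp i \<Longrightarrow> pexp j \<Longrightarrow> pexp (\<lambda>x e. of_bool (wadj x (i x e) (j x e)))"
  unfolding wadj_def by (intro pexp_intros pexp_parts)

lemma pexp_cert: "pexp i \<Longrightarrow> pexp (\<lambda>x e. cert x (i x e))"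
  unfolding cert_def by (intro pexp_intros pexp_zlen)

lemma verifier_P: "verifier p q \<in> class_P"
proof (rule class_P_pexp)
  show "pexp (\<lambda>x e. of_bool (x \<in> verifier p q))"
    unfolding verifier_def mem_Collect_eq cover_check_def ed_check_def if_bool_eq_disj
    by (intro pexp_intros pexp_parts pexp_wadj pexp_cert)
qed

lemma decider_P: "decider \<in> class_P"
proof (rule class_P_pexp)
  show "pexp (\<lambda>x e. of_bool (x \<in> decider))"
    unfolding decider_def mem_Collect_eq by (intro pexp_intros pexp_isqrt pexp_zlen pexp_cert)
qed

lemma oracle_NP: "oracle_set p q \<in> class_NP"
  unfolding class_NP_def oracle_set_def using verifier_P by blast

lemma bit_at_query:
  "k < 2 * length x + 2 \<Longrightarrow> bit_at (query x c) k = of_bool (k < c)"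
  "bit_at (query x c) (2 * length x + 2 + k) = bit_at x k"
  by (auto simp: query_def bit_at_def nth_append simp del: upt_Suc)

lemma query_parts:
  assumes "c \<le> 2 * length x + 2" "length x = n * n"
  shows "xlen (encode_pair (query x c) y) = n * n" "qnum (encode_pair (query x c) y) = c"
    "order (encode_pair (query x c) y) = n" "cert (encode_pair (query x c) y) i = bit_at y i"
    "i < n \<Longrightarrow> j < n \<Longrightarrow> wadj (encode_pair (query x c) y) i j \<longleftrightarrow> madj x n i j"
proof -
  let ?w = "encode_pair (query x c) y"
  show x: "xlen ?w = n * n" by (simp add: xlen_def zlen_pair assms(2))
  have "qnum ?w = (\<Sum>k<2 * length x + 2. of_bool (k < c))"
    unfolding qnum_def x assms(2)[symmetric]
    by (intro sum.cong) (auto simp: bit_at_pair bit_at_query)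
  also have "\<dots> = card {k. k < 2 * length x + 2 \<and> k < c}" by (rule card_eq_sum_of_bool[symmetric])
  also have "{k. k < 2 * length x + 2 \<and> k < c} = {..<c}" using assms(1) by auto
  finally show "qnum ?w = c" by simp
  show o: "order ?w = n" by (simp add: order_def x isqrt_square)
  show "cert ?w i = bit_at y i" using bit_at_pair(2)[of "query x c" y i] by (simp add: cert_def zlen_pair)
  show "wadj ?w i j \<longleftrightarrow> madj x n i j" if "i < n" "j < n"
  proof -
    have l: "i * n + j < n * n" by (rule mat_index_less[OF that])
    have "bit_at ?w (2 * (2 * (n * n) + 2 + (i * n + j))) = bit_at (query x c) (2 * (n * n) + 2 + (i * n + j))"
      by (rule bit_at_pair(1)) (use l assms(2) in simp)
    also have "\<dots> = bit_at x (i * n + j)" using bit_at_query(2)[of x c "i * n + j"] by (simp only: assms(2))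
    finally show ?thesis unfolding wadj_def x o using l that assms(2) by (simp only: madj_def bit_at_def[of x]) auto
  qed
qed

lemma bit_at_of_bool: "bit_at y i = of_bool (bit_at y i = 1)"
  by (simp add: bit_at_def)

lemma query_cover:
  assumes n: "length x = n * n" "simple_adj (madj x n)" and j: "j \<le> length x"
  shows "query x (2 * j) \<in> oracle_set p q \<longleftrightarrow> mvc (graph_of n (madj x n)) \<le> j"
proof -
  note P = query_parts[of "2 * j" x n, OF _ n(1)]
  have c: "2 * j \<le> 2 * length x + 2" using j by simp
  have V: "encode_pair (query x (2 * j)) y \<in> verifier p q \<longleftrightarrow>
      (\<forall>i<n. \<forall>k<n. madj x n i k \<longrightarrow> bit_at y i = 1 \<or> bit_at y k = 1) \<and> (\<Sum>i<n. bit_at y i) \<le> j" for y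
    unfolding verifier_def cover_check_def by (auto simp: P[OF c])
  show ?thesis
    unfolding mvc_le_iff[OF n(2)]
  proof
    assume "query x (2 * j) \<in> oracle_set p q"
    then obtain y where y: "\<forall>i<n. \<forall>k<n. madj x n i k \<longrightarrow> bit_at y i = 1 \<or> bit_at y k = 1" "(\<Sum>i<n. bit_at y i) \<le> j"
      unfolding oracle_set_def mem_Collect_eq V by blast
    have "card {i. i < n \<and> bit_at y i = 1} = (\<Sum>i<n. bit_at y i)"
      unfolding card_eq_sum_of_bool bit_at_of_bool[symmetric] ..
    then show "\<exists>C. cover {..<n} (madj x n) C \<and> card C \<le> j"
      using y by (intro exI[of _ "{i. i < n \<and> bit_at y i = 1}"]) (auto simp: cover_def)
  next
    assume "\<exists>C. cover {..<n} (madj x n) C \<and> card C \<le> j"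
    then obtain C where C: "cover {..<n} (madj x n) C" "card C \<le> j" by blast
    define y where "y = map (\<lambda>i. i \<in> C) [0..<n]"
    have b: "bit_at y i = of_bool (i < n \<and> i \<in> C)" for i by (simp add: y_def bit_at_def)
    have "(\<Sum>i<n. bit_at y i) = card {i. i < n \<and> i \<in> C}" unfolding card_eq_sum_of_bool b by (intro sum.cong) auto
    also have "{i. i < n \<and> i \<in> C} = C" using C(1) by (auto simp: cover_def)
    finally have "encode_pair (query x (2 * j)) y \<in> verifier p q"
      unfolding V using C by (auto simp: b cover_def)
    moreover have "n \<le> 3 * (n * n) + 2" using le_square[of n] by linarith
    then have "length y \<le> poly [:0, 1:] (length (query x (2 * j)))" by (simp add: y_def n(1))
    ultimately show "query x (2 * j) \<in> oracle_set p q" unfolding oracle_set_def by blast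
  qed
qed

lemma query_ed:
  assumes n: "length x = n * n" "simple_adj (madj x n)" and j: "j \<le> length x"
    and pq: "0 < q"
  shows "query x (2 * j + 1) \<in> oracle_set p q \<longleftrightarrow> q * min_ed (graph_of n (madj x n)) \<le> p * j"
proof -
  note P = query_parts[of "2 * j + 1" x n, OF _ n(1)]
  have c: "2 * j + 1 \<le> 2 * length x + 2" using j by simp
  define mt where "mt y i k \<longleftrightarrow> bit_at y (i * n + k) = 1" for y i k
  have mt_sum: "bit_at y (i * n + k) = of_bool (mt y i k)" for y i k
    unfolding mt_def by (rule bit_at_of_bool)
  have V: "encode_pair (query x (2 * j + 1)) y \<in> verifier p q \<longleftrightarrow>
      (\<forall>i<n. \<forall>k<n. mt y i k \<longrightarrow> mt y k i \<and> madj x n i k) \<and>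
      (\<forall>i<n. \<forall>k<n. \<forall>l<n. mt y i k \<longrightarrow> mt y i l \<longrightarrow> k = l) \<and>
      (\<forall>i<n. \<forall>k<n. madj x n i k \<longrightarrow> (\<exists>l<n. mt y i l) \<or> (\<exists>l<n. mt y k l)) \<and>
      q * (\<Sum>i<n. \<Sum>k<n. of_bool (mt y i k)) \<le> p * j" for y
  proof -
    let ?w = "encode_pair (query x (2 * j + 1)) y"
    have "?w \<in> verifier p q \<longleftrightarrow> ed_check p q ?w" by (simp add: verifier_def P(2)[OF c] del: One_nat_def add_Suc_right)
    also have "\<dots> \<longleftrightarrow> (\<forall>i<n. \<forall>k<n. mt y i k \<longrightarrow> mt y k i \<and> wadj ?w i k) \<and>
      (\<forall>i<n. \<forall>k<n. \<forall>l<n. mt y i k \<longrightarrow> mt y i l \<longrightarrow> k = l) \<and>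
      (\<forall>i<n. \<forall>k<n. wadj ?w i k \<longrightarrow> (\<exists>l<n. mt y i l) \<or> (\<exists>l<n. mt y k l)) \<and>
      q * (\<Sum>i<n. \<Sum>k<n. of_bool (mt y i k)) \<le> p * ((2 * j + 1) div 2)"
      unfolding ed_check_def P(2,3,4)[OF c] mt_sum of_bool_eq_1_iff by (rule refl)
    finally show ?thesis using P(5)[OF c] by simp
  qed
  \<comment> \<open>With at most one entry per row, a row sum is the indicator of a matched
    vertex.\<close>
  have rows: "(\<Sum>i<n. \<Sum>k<n. of_bool (mt y i k)) = card {i. i < n \<and> (\<exists>k<n. mt y i k)}"
    if "\<forall>i<n. \<forall>k<n. \<forall>l<n. mt y i k \<longrightarrow> mt y i l \<longrightarrow> k = l" for y
  proof -
    have "(\<Sum>k<n. of_bool (mt y i k)) = (of_bool (\<exists>k<n. mt y i k) :: nat)" if i: "i < n" for i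
    proof (cases "\<exists>k<n. mt y i k")
      case True
      then obtain k where k: "k < n" "mt y i k" by blast
      then have "{l. l < n \<and> mt y i l} = {k}" using that i \<open>\<forall>i<n. \<forall>k<n. \<forall>l<n. mt y i k \<longrightarrow> mt y i l \<longrightarrow> k = l\<close> by blast
      then show ?thesis using True card_eq_sum_of_bool[of n "mt y i"] by simp
    qed simp
    then show ?thesis unfolding card_eq_sum_of_bool by simp
  qed
  have le: "q * min_ed (graph_of n (madj x n)) \<le> p * j \<longleftrightarrow>
      (\<exists>C f. cover {..<n} (madj x n) C \<and> pmatch (madj x n) C f \<and> q * card C \<le> p * j)"
  proof -
    \<comment> \<open>Rounding down turns the rational bound into a natural number, to which
      \<open>min_ed_le_iff\<close> applies.\<close>
    have "q * m \<le> p * j \<longleftrightarrow> m \<le> p * j div q" for m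
      using pq by (simp add: less_eq_div_iff_mult_less_eq mult.commute)
    then show ?thesis using min_ed_le_iff[OF n(2), of n "p * j div q"] by simp
  qed
  show ?thesis
    unfolding le
  proof
    assume "query x (2 * j + 1) \<in> oracle_set p q"
    then obtain y where "encode_pair (query x (2 * j + 1)) y \<in> verifier p q" unfolding oracle_set_def by blast
    then have y: "\<forall>i<n. \<forall>k<n. mt y i k \<longrightarrow> mt y k i \<and> madj x n i k"
      "\<forall>i<n. \<forall>k<n. \<forall>l<n. mt y i k \<longrightarrow> mt y i l \<longrightarrow> k = l"
      "\<forall>i<n. \<forall>k<n. madj x n i k \<longrightarrow> (\<exists>l<n. mt y i l) \<or> (\<exists>l<n. mt y k l)"
      "q * (\<Sum>i<n. \<Sum>k<n. of_bool (mt y i k)) \<le> p * j" unfolding V by blast+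
    define C where "C = {i. i < n \<and> (\<exists>k<n. mt y i k)}"
    define f where "f i = (SOME k. k < n \<and> mt y i k)" for i
    have f: "f i < n \<and> mt y i (f i)" if "i \<in> C" for i
      using someI_ex[of "\<lambda>k. k < n \<and> mt y i k"] that unfolding f_def C_def by blast
    have "pmatch (madj x n) C f"
      unfolding pmatch_def
    proof
      fix i assume i: "i \<in> C"
      then have fi: "i < n" "f i < n" "mt y i (f i)" "mt y (f i) i" "madj x n i (f i)"
        using f[OF i] y(1) by (auto simp: C_def)
      then have "f i \<in> C" by (auto simp: C_def)
      moreover have "f (f i) = i" using f[OF \<open>f i \<in> C\<close>] fi y(2) by blast
      ultimately show "f i \<in> C \<and> f (f i) = i \<and> madj x n i (f i)" using fi by blast
    qed
    moreover have "cover {..<n} (madj x n) C" using y(3) by (auto simp: cover_def C_def)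
    moreover have "q * card C \<le> p * j" using y(4) rows[OF y(2)] by (simp add: C_def)
    ultimately show "\<exists>C f. cover {..<n} (madj x n) C \<and> pmatch (madj x n) C f \<and> q * card C \<le> p * j" by blast
  next
    assume "\<exists>C f. cover {..<n} (madj x n) C \<and> pmatch (madj x n) C f \<and> q * card C \<le> p * j"
    then obtain C f where Cf: "cover {..<n} (madj x n) C" "pmatch (madj x n) C f" "q * card C \<le> p * j" by blast
    define y where "y = map (\<lambda>k. k div n \<in> C \<and> f (k div n) = k mod n) [0..<n * n]"
    have m: "mt y i k \<longleftrightarrow> i \<in> C \<and> f i = k" if "i < n" "k < n" for i k
      using mat_index_less[OF that] that by (simp add: mt_def bit_at_def y_def)
    have Cn: "C \<subseteq> {..<n}" using Cf(1) by (simp add: cover_def)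
    have fC: "f i \<in> C" "f i < n" "f (f i) = i" "madj x n i (f i)" if "i \<in> C" for i
      using Cf(2) Cn that by (auto simp: pmatch_def)
    have ex: "(\<exists>l<n. mt y i l) \<longleftrightarrow> i \<in> C" if "i < n" for i using m[OF that] fC[of i] by auto
    have fun1: "\<forall>i<n. \<forall>k<n. \<forall>l<n. mt y i k \<longrightarrow> mt y i l \<longrightarrow> k = l" using m by auto
    have "{i. i < n \<and> (\<exists>k<n. mt y i k)} = C" using ex Cn by auto
    then have "(\<Sum>i<n. \<Sum>k<n. of_bool (mt y i k)) = card C" using rows[OF fun1] by simp
    moreover have "\<forall>i<n. \<forall>k<n. mt y i k \<longrightarrow> mt y k i \<and> madj x n i k" using m fC by auto
    moreover have "\<forall>i<n. \<forall>k<n. madj x n i k \<longrightarrow> (\<exists>l<n. mt y i l) \<or> (\<exists>l<n. mt y k l)"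
      using ex Cf(1) by (simp add: cover_def)
    ultimately have "encode_pair (query x (2 * j + 1)) y \<in> verifier p q"
      unfolding V using fun1 Cf(3) by simp
    moreover have "length y \<le> poly [:0, 1:] (length (query x (2 * j + 1)))" by (simp add: y_def n(1))
    ultimately show "query x (2 * j + 1) \<in> oracle_set p q" unfolding oracle_set_def by blast
  qed
qed

lemma decider_iff:
  "encode_pair x a \<in> decider \<longleftrightarrow> (\<exists>n. 0 < n \<and> length x = n * n \<and> simple_adj (madj x n) \<and>
     (\<forall>j \<le> length x. bit_at a (2 * j) = 1 \<longrightarrow> bit_at a (2 * j + 1) = 1))"
proof -
  let ?w = "encode_pair x a" and ?n = "isqrt (length x)"
  have c: "cert ?w i = bit_at a i" for i using bit_at_pair(2)[of x a i] by (simp add: cert_def zlen_pair)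
  have b: "bit_at ?w (2 * (i * ?n + j)) = 1 \<longleftrightarrow> madj x ?n i j" if "?n * ?n = length x" "i < ?n" "j < ?n" for i j
  proof -
    have "i * ?n + j < length x" using mat_index_less[OF that(2,3)] that(1) by simp
    from bit_at_pair(1)[OF this, of a] show ?thesis using that \<open>i * ?n + j < length x\<close> by (simp add: madj_def bit_at_def[of x])
  qed
  have simple: "simple_adj (madj x n) \<longleftrightarrow> (\<forall>i<n. \<not> madj x n i i) \<and> (\<forall>i<n. \<forall>j<n. madj x n i j \<longrightarrow> madj x n j i)" for n
    unfolding simple_adj_def by (auto simp: madj_def)
  have "?w \<in> decider \<longleftrightarrow> 0 < length x \<and> ?n * ?n = length x \<and> simple_adj (madj x ?n) \<and>
     (\<forall>j \<le> length x. bit_at a (2 * j) = 1 \<longrightarrow> bit_at a (2 * j + 1) = 1)"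
    unfolding decider_def mem_Collect_eq zlen_pair simple c less_Suc_eq_le using b by (auto cong: conj_cong)
  also have "\<dots> \<longleftrightarrow> (\<exists>n. 0 < n \<and> length x = n * n \<and> simple_adj (madj x n) \<and>
     (\<forall>j \<le> length x. bit_at a (2 * j) = 1 \<longrightarrow> bit_at a (2 * j + 1) = 1))"
    by (metis isqrt_square nat_0_less_mult_iff)
  finally show ?thesis .
qed

lemma S_ED_in_class:
  assumes r: "1 \<le> r" "r < 2"
  shows "S_ED r \<in> class_P_NP_par"
proof -
  obtain p q :: nat where pq: "0 < q" and "q \<le> p" "p < 2 * q" and ratio: "\<forall>a b :: nat. of_nat a \<le> r * of_nat b \<longleftrightarrow> q * a \<le> p * b"
    using ratio_nat[OF r] by blast
  have "x \<in> S_ED r \<longleftrightarrow> encode_pair x (map (\<lambda>z. z \<in> oracle_set p q) (queries x)) \<in> decider" for x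
  proof -
    let ?a = "map (\<lambda>z. z \<in> oracle_set p q) (queries x)"
    have a: "bit_at ?a c = 1 \<longleftrightarrow> query x c \<in> oracle_set p q" if "c < 2 * length x + 2" for c
      using that by (simp add: bit_at_def queries_def del: upt_Suc)
    have "of_nat (min_ed (graph_of n (madj x n))) \<le> r * of_nat (mvc (graph_of n (madj x n))) \<longleftrightarrow>
       (\<forall>j \<le> length x. bit_at ?a (2 * j) = 1 \<longrightarrow> bit_at ?a (2 * j + 1) = 1)"
      if n: "0 < n" "length x = n * n" "simple_adj (madj x n)" for n
    proof -
      let ?G = "graph_of n (madj x n)"
      have "mvc ?G \<le> n" unfolding mvc_le_iff[OF n(3)] by (intro exI[of _ "{..<n}"]) (auto simp: cover_def)
      \<comment> \<open>So the query for \<open>j = mvc ?G\<close> is among those asked.\<close>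
      then have m: "mvc ?G \<le> length x" using n by (metis le_trans le_square)
      have "(\<forall>j \<le> length x. bit_at ?a (2 * j) = 1 \<longrightarrow> bit_at ?a (2 * j + 1) = 1) \<longleftrightarrow>
          (\<forall>j \<le> length x. mvc ?G \<le> j \<longrightarrow> q * min_ed ?G \<le> p * j)"
        using a query_cover[OF n(2,3), of _ p q] query_ed[OF n(2,3) _ pq, of _ p] by (auto simp del: One_nat_def)
      \<comment> \<open>The right-hand side grows with \<open>j\<close>, so the implication is
        strongest at \<open>j = mvc ?G\<close>.\<close>
      also have "\<dots> \<longleftrightarrow> q * min_ed ?G \<le> p * mvc ?G" using m by (meson le_trans mult_le_mono2 order_refl)
      finally show ?thesis using ratio by simp
    qed
    then show ?thesis unfolding S_ED_iff decider_iff by blast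
  qed
  then have "S_ED r \<le>\<^sub>t\<^sub>t oracle_set p q"
    unfolding tt_reducible_def using polytime_queries decider_P by blast
  then show ?thesis unfolding class_P_NP_par_def using oracle_NP by blast
qed

theorem theorem3p2:
  fixes r :: rat
  assumes "1 \<le> r" and "r < 2"
  shows "complete_for class_P_NP_par (S_ED r)"
  unfolding complete_for_def using S_ED_in_class[OF assms] S_ED_hard[OF assms] by blast

end
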